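(* Let $q$ be a real-valued function on $\mathbb{R}$ with $q(x+1)=q(x)$ which is summable on $[0,1]$. Let $l_n$ ($n\ge 1$) be the length of the $n$-th finite instability interval of the Hill operator $Ly=-y''+q(x)y$, and let $c_n=\int_0^1 q(x)e^{-i2n\pi x}\,dx$ be the Fourier coefficients of $q$. If $l_n=o(n^{-2})$ as $n\to\infty$, then $c_n=o(n^{-2})$ as $n\to\infty$.
   Context: Let $\lambda_n$ and $\mu_n$ ($n=0,1,\ldots$) denote, respectively, the $n$-th eigenvalue (counted with multiplicity, in nondecreasing order) of $-y''+q(x)y=\lambda y$ on $[0,1]$ with the periodic boundary conditions $y(0)=y(1)$, $y'(0)=y'(1)$, and with the anti-periodic boundary conditions $y(0)=-y(1)$, $y'(0)=-y'(1)$. It is well known that $\lambda_0<\mu_0\le\mu_1<\lambda_1\le\lambda_2<\mu_2\le\mu_3<\cdots\to\infty$. For $m=0,1,\ldots$, the intervals $(\mu_{2m},\mu_{2m+1})$ and $(\lambda_{2m+1},\lambda_{2m+2})$ are called, respectively, the $(2m+1)$-th and the $(2m+2)$-th finite instability intervals of $L$ (they may be empty). Thus $l_{2m+1}=\mu_{2m+1}-\mu_{2m}$ and $l_{2m+2}=\lambda_{2m+2}-\lambda_{2m+1}$. *)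

theory Defs
  imports "HOL-Analysis.Analysis" "HOL-Library.Function_Algebras" "HOL-Library.Landau_Symbols"
begin

interpretation cfun: vector_space "\<lambda>(a::complex) (f::real \<Rightarrow> complex) x. a * f x"
  by unfold_locales (auto simp: fun_eq_iff algebra_simps)

text \<open>Absolute continuity on \<open>[0,1]\<close> in Lebesgue's form: \<open>f\<close> is the indefinite integral of a
  summable function \<open>g\<close>, which is then its derivative almost everywhere.\<close>

definition abs_cont_deriv :: "(real \<Rightarrow> complex) \<Rightarrow> (real \<Rightarrow> complex) \<Rightarrow> bool" where
  "abs_cont_deriv f g \<longleftrightarrow>
     g absolutely_integrable_on {0..1} \<and> (\<forall>x\<in>{0..1}. f x = f 0 + integral {0..x} g)"

text \<open>Here \<open>q\<close> is only summable, so the equation \<open>-y'' + q y = t y\<close> is understood almost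
  everywhere, for continuously differentiable \<open>y\<close> with absolutely continuous \<open>y'\<close>.
  The boundary conditions are \<open>y(0) = s y(1)\<close>, \<open>y'(0) = s y'(1)\<close>: periodic for \<open>s = 1\<close>,
  anti-periodic for \<open>s = -1\<close>.  A function on \<open>[0,1]\<close> is represented by its extension by \<open>0\<close>,
  so that the dimension of the eigenspace is the right one.\<close>

definition eigenspace :: "complex \<Rightarrow> (real \<Rightarrow> real) \<Rightarrow> real \<Rightarrow> (real \<Rightarrow> complex) set" where
  "eigenspace s q t = {y. (\<forall>x. x \<notin> {0..1} \<longrightarrow> y x = 0) \<and>
     (\<exists>y' y''.
        (\<forall>x\<in>{0..1}. (y has_vector_derivative y' x) (at x within {0..1})) \<and>
        abs_cont_deriv y' y'' \<and>
        (AE x in lebesgue. x \<in> {0..1} \<longrightarrow>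
           - y'' x + of_real (q x) * y x = of_real t * y x) \<and>
        y 0 = s * y 1 \<and> y' 0 = s * y' 1)}"

text \<open>\<open>e\<close> lists all eigenvalues in nondecreasing order, each repeated according to its
  multiplicity.  This determines \<open>e\<close> uniquely.  Only real \<open>t\<close> matter, the problems being
  self-adjoint; for the same reason there is only one notion of multiplicity.\<close>

definition eigenvalue_enumeration :: "complex \<Rightarrow> (real \<Rightarrow> real) \<Rightarrow> (nat \<Rightarrow> real) \<Rightarrow> bool" where
  "eigenvalue_enumeration s q e \<longleftrightarrow> mono e \<and>
     (\<forall>t. finite {n. e n = t} \<and> card {n. e n = t} = cfun.dim (eigenspace s q t))"

abbreviation periodic_eigenvalues :: "(real \<Rightarrow> real) \<Rightarrow> (nat \<Rightarrow> real) \<Rightarrow> bool" where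
  "periodic_eigenvalues \<equiv> eigenvalue_enumeration 1"

abbreviation antiperiodic_eigenvalues :: "(real \<Rightarrow> real) \<Rightarrow> (nat \<Rightarrow> real) \<Rightarrow> bool" where
  "antiperiodic_eigenvalues \<equiv> eigenvalue_enumeration (-1)"

text \<open>The \<open>(2m+1)\<close>-th interval is \<open>(\<mu>\<^sub>2\<^sub>m, \<mu>\<^sub>2\<^sub>m\<^sub>+\<^sub>1)\<close> and the \<open>(2m+2)\<close>-th is
  \<open>(\<lambda>\<^sub>2\<^sub>m\<^sub>+\<^sub>1, \<lambda>\<^sub>2\<^sub>m\<^sub>+\<^sub>2)\<close>; the value at \<open>n = 0\<close> has no meaning.\<close>

definition instability_length :: "(nat \<Rightarrow> real) \<Rightarrow> (nat \<Rightarrow> real) \<Rightarrow> nat \<Rightarrow> real" where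
  "instability_length lam mu n = (if odd n then mu n - mu (n - 1) else lam n - lam (n - 1))"

definition fourier_coeff :: "(real \<Rightarrow> real) \<Rightarrow> nat \<Rightarrow> complex" where
  "fourier_coeff q n =
     integral {0..1} (\<lambda>x. of_real (q x) * exp (- (\<i> * of_real (2 * real n * pi * x))))"

end

theory Submission
  imports Defs
begin

text \<open>
  Subtract the mean from \<open>q\<close> and from all eigenvalues, and let \<open>Q\<close> be the primitive of \<open>q\<close> with
  \<open>Q 0 = Q 1 = 0\<close>.  For an eigenvalue \<open>k\<^sup>2\<close> with large \<open>k\<close> write the solutions of \<open>-y'' + q y = k\<^sup>2 y\<close> as
  \<open>y = e\<^sup>\<phi> a + e\<^sup>-\<^sup>\<phi> b\<close> with the phase \<open>\<phi> x = i (k x - Q x / (2 k))\<close>.  The amplitudes solve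
  \<open>a' = w b\<close>, \<open>b' = cnj w a\<close>, where the mass \<open>\<integral> \<bar>w\<bar>\<close> is of order \<open>1 / k\<close>.  Let \<open>(A, B)\<close> be the solution
  that starts at \<open>(1, 0)\<close>; the one that starts at \<open>(0, 1)\<close> is \<open>(cnj B, cnj A)\<close>, and
  \<open>\<bar>A\<bar>\<^sup>2 - \<bar>B\<bar>\<^sup>2 = 1\<close>.  With \<open>s = 1\<close> for periodic and \<open>s = -1\<close> for anti-periodic conditions and
  \<open>P = s e\<^sup>i\<^sup>k A(1)\<close>, the number \<open>k\<^sup>2\<close> is an eigenvalue iff \<open>Re P = 1\<close>, and it can only be double if
  \<open>B(1) = 0\<close>.  The proof compares the gaps and the Fourier coefficients with \<open>B(1)\<close>.

  \<^item> Gaps bound \<open>B(1)\<close> (\<open>gap_controls_B\<close>).  At an eigenvalue \<open>\<bar>Im P\<bar> = \<bar>B(1)\<bar>\<close>.  As a function of \<open>k\<close>,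
    \<open>P\<close> moves with speed about \<open>1\<close>, but \<open>B(1)\<close> with speed \<open>O(1 / k)\<close>.  So at two nearby eigenvalues
    \<open>k\<^sup>2\<close> and \<open>k'\<^sup>2\<close> the numbers \<open>Im P\<close> have opposite signs, and \<open>\<bar>B(1)\<bar> \<le> 3 \<bar>k - k'\<bar>\<close>.

  \<^item> The gaps sit in the right place (\<open>small_gaps_imp_small_B\<close>).  Since \<open>\<bar>P\<bar> \<ge> 1\<close>, the intermediate
    value theorem gives an eigenvalue near every large \<open>(n \<pi>)\<^sup>2\<close> of the right parity.  As the gaps
    tend to \<open>0\<close>, the enumeration must pair it with an eigenvalue near the same \<open>(n \<pi>)\<^sup>2\<close>.  The pairs for
    different \<open>n\<close> are different, so the index of the pair is at least of order \<open>n\<close>, and the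
    hypothesis gives \<open>B(1) = o(n\<^sup>-\<^sup>3)\<close> there.

  \<^item> Fourier coefficients (\<open>second_order_expansion\<close>, \<open>coefficient_relation\<close>).  The Riemann-Lebesgue
    lemma yields \<open>2 k B(1) = i (\<integral> q e\<^sup>2\<^sup>i\<^sup>k\<^sup>x - (i / k) \<integral> q Q e\<^sup>2\<^sup>i\<^sup>k\<^sup>x) + o(k\<^sup>-\<^sup>2)\<close>.  At the eigenvalues \<open>k\<close> differs
    from \<open>n \<pi>\<close> by \<open>O(n\<^sup>-\<^sup>2)\<close> only, and integration by parts turns \<open>q Q\<close> into the derivative of \<open>Q\<^sup>2 / 2\<close>.
    With \<open>d\<^sub>n = \<integral> q e\<^sup>2\<^sup>\<pi>\<^sup>i\<^sup>n\<^sup>x\<close> and \<open>f\<^sub>n = \<integral> Q\<^sup>2 e\<^sup>2\<^sup>\<pi>\<^sup>i\<^sup>n\<^sup>x\<close> this reads \<open>d\<^sub>n - f\<^sub>n = o(n\<^sup>-\<^sup>2)\<close>.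

  \<^item> Bootstrapping (\<open>small_B_imp_small_coefficients\<close>).  As \<open>n f\<^sub>n\<close> is a Fourier coefficient of the
    summable function \<open>q Q\<close> up to a constant, \<open>f\<^sub>n = o(n\<^sup>-\<^sup>1)\<close>, hence \<open>d\<^sub>n = o(n\<^sup>-\<^sup>1)\<close>, and the
    coefficients of \<open>Q\<close> are \<open>o(n\<^sup>-\<^sup>2)\<close>.  Then so are those of \<open>Q\<^sup>2\<close> (\<open>fcoef_square_decay\<close>), and the
    relation gives \<open>d\<^sub>n = o(n\<^sup>-\<^sup>2)\<close>.
\<close>

section \<open>Integrals over the unit interval\<close>

definition L1_norm :: "(real \<Rightarrow> complex) \<Rightarrow> real" where
  "L1_norm f = integral {0..1} (\<lambda>t. norm (f t))"

lemmas hk_integral_add = Henstock_Kurzweil_Integration.integral_add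
lemmas hk_integral_diff = Henstock_Kurzweil_Integration.integral_diff
lemmas hk_integral_le = Henstock_Kurzweil_Integration.integral_le

lemma absolutely_integrable_mult_continuous:
  fixes f g :: "real \<Rightarrow> 'a::{euclidean_space,real_normed_field}"
  assumes "f absolutely_integrable_on {0..1}" and "continuous_on {0..1} g"
  shows "(\<lambda>t. f t * g t) absolutely_integrable_on {0..1}"
proof -
  have "(\<lambda>t. g t * f t) absolutely_integrable_on {0..1}"
  proof (rule absolutely_integrable_bounded_measurable_product[where h = "(*) :: 'a \<Rightarrow> 'a \<Rightarrow> 'a"])
    show "bilinear ((*) :: 'a \<Rightarrow> 'a \<Rightarrow> 'a)"
      by (auto simp: bilinear_def linear_iff algebra_simps)
    show "g \<in> borel_measurable (lebesgue_on {0..1})"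
      using assms(2) by (intro continuous_imp_measurable_on_sets_lebesgue) auto
    show "bounded (g ` {0..1})"
      using assms(2) by (intro compact_imp_bounded compact_continuous_image) auto
  qed (use assms in auto)
  then show ?thesis by (simp add: mult.commute)
qed

lemma absolutely_integrable_of_real:
  assumes "f absolutely_integrable_on {0..1::real}"
  shows "(\<lambda>x. complex_of_real (f x)) absolutely_integrable_on {0..1}"
proof -
  have "(complex_of_real \<circ> f) absolutely_integrable_on {0..1}"
    using assms by (rule absolutely_integrable_linear) (rule bounded_linear_of_real)
  then show ?thesis by (simp add: o_def)
qed

lemma absolutely_integrable_cnj:
  assumes "w absolutely_integrable_on {0..1::real}"
  shows "(\<lambda>x. cnj (w x)) absolutely_integrable_on {0..1}"
proof -
  have "(cnj \<circ> w) absolutely_integrable_on {0..1}"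
    using assms by (rule absolutely_integrable_linear) (rule bounded_linear_cnj)
  then show ?thesis by (simp add: o_def)
qed

lemma absolutely_integrable_on_unit_subinterval:
  fixes f :: "real \<Rightarrow> 'a::euclidean_space"
  assumes "f absolutely_integrable_on {0..1}" "0 \<le> x" "y \<le> 1"
  shows "f absolutely_integrable_on {x..y}"
  using absolutely_integrable_on_subinterval[OF assms(1), of x y] assms by auto

lemma integral_diff_unit:
  fixes f :: "real \<Rightarrow> 'a::euclidean_space"
  assumes "f absolutely_integrable_on {0..1}" "0 \<le> x" "x \<le> y" "y \<le> 1"
  shows "integral {0..y} f - integral {0..x} f = integral {x..y} f"
proof -
  have "f integrable_on {0..y}"
    using absolutely_integrable_on_unit_subinterval[OF assms(1), of 0 y] assms
    by (simp add: set_lebesgue_integral_eq_integral(1))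
  then show ?thesis
    using Henstock_Kurzweil_Integration.integral_combine[of 0 x y f] assms by (simp add: algebra_simps)
qed

lemma norm_integral_le_scaled:
  fixes f :: "real \<Rightarrow> complex" and h :: "real \<Rightarrow> complex"
  assumes f: "f absolutely_integrable_on {0..1}" and h: "h absolutely_integrable_on {0..1}"
    and "0 \<le> x" "y \<le> 1" and B: "\<And>t. t \<in> {x..y} \<Longrightarrow> norm (h t) \<le> B * norm (f t)"
  shows "norm (integral {x..y} h) \<le> B * integral {x..y} (\<lambda>t. norm (f t))"
proof -
  have fi: "(\<lambda>t. norm (f t)) integrable_on {x..y}" and hi: "h integrable_on {x..y}"
    using absolutely_integrable_on_unit_subinterval[OF f, of x y] 
     absolutely_integrable_on_unit_subinterval[OF h, of x y] assms
    by (auto simp: absolutely_integrable_on_def)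
  have "norm (integral {x..y} h) \<le> integral {x..y} (\<lambda>t. B * norm (f t))"
    by (rule integral_norm_bound_integral) (use fi hi B in \<open>auto intro: integrable_on_mult_right\<close>)
  then show ?thesis by simp
qed

lemma integral_norm_le_L1:
  assumes "f absolutely_integrable_on {0..1}" "0 \<le> x" "y \<le> 1"
  shows "integral {x..y} (\<lambda>t. norm (f t)) \<le> L1_norm f"
  unfolding L1_norm_def
proof (rule integral_subset_le)
  show "{x..y} \<subseteq> {0..1}" using assms by auto
  show "(\<lambda>t. norm (f t)) integrable_on {x..y}"
    using absolutely_integrable_on_unit_subinterval[OF assms] by (auto simp: absolutely_integrable_on_def)
  show "(\<lambda>t. norm (f t)) integrable_on {0..1}"
    using assms(1) by (auto simp: absolutely_integrable_on_def)
qed auto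

lemma L1_norm_nonneg: "0 \<le> L1_norm f"
proof (cases "(\<lambda>t. norm (f t)) integrable_on {0..1}")
  case True
  then show ?thesis
    unfolding L1_norm_def by (rule Henstock_Kurzweil_Integration.integral_nonneg) simp
qed (simp add: L1_norm_def not_integrable_integral)

lemma norm_integral_le_L1:
  fixes f h :: "real \<Rightarrow> complex"
  assumes f: "f absolutely_integrable_on {0..1}" and h: "h absolutely_integrable_on {0..1}"
    and "0 \<le> x" "y \<le> 1" and B: "\<And>t. t \<in> {0..1} \<Longrightarrow> norm (h t) \<le> B * norm (f t)" and "0 \<le> B"
  shows "norm (integral {x..y} h) \<le> B * L1_norm f"
proof -
  have "norm (integral {x..y} h) \<le> B * integral {x..y} (\<lambda>t. norm (f t))"
    by (rule norm_integral_le_scaled[OF f h]) (use assms in auto)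
  also have "\<dots> \<le> B * L1_norm f"
    by (intro mult_left_mono integral_norm_le_L1 assms)
  finally show ?thesis .
qed

section \<open>Calculus of absolutely continuous functions\<close>

lemma abs_cont_deriv_integrable:
  "abs_cont_deriv f g \<Longrightarrow> g absolutely_integrable_on {0..1}"
  by (simp add: abs_cont_deriv_def)

lemma abs_cont_deriv_eq:
  "abs_cont_deriv f g \<Longrightarrow> x \<in> {0..1} \<Longrightarrow> f x = f 0 + integral {0..x} g"
  unfolding abs_cont_deriv_def by blast

lemma abs_cont_derivI:
  assumes "g absolutely_integrable_on {0..1}" "\<And>x. x \<in> {0..1} \<Longrightarrow> f x = f 0 + integral {0..x} g"
  shows "abs_cont_deriv f g"
  using assms unfolding abs_cont_deriv_def by blast

lemma abs_cont_deriv_diff_eq: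
  assumes "abs_cont_deriv f g" "0 \<le> x" "x \<le> y" "y \<le> 1"
  shows "f y - f x = integral {x..y} g"
proof -
  have "f x = f 0 + integral {0..x} g" "f y = f 0 + integral {0..y} g"
    by (rule abs_cont_deriv_eq[OF assms(1)]; use assms in simp)+
  then show ?thesis
    using integral_diff_unit[OF abs_cont_deriv_integrable[OF assms(1)] assms(2-4)]
    by (metis add_diff_cancel_left)
qed

lemma abs_cont_deriv_continuous:
  assumes "abs_cont_deriv f g" shows "continuous_on {0..1} f"
proof -
  have "continuous_on {0..1} (\<lambda>x. f 0 + integral {0..x} g)"
    using abs_cont_deriv_integrable[OF assms]
    by (intro continuous_intros indefinite_integral_continuous_1) (auto simp: absolutely_integrable_on_def)
  then show ?thesis
    by (rule continuous_on_eq) (rule abs_cont_deriv_eq[OF assms, symmetric])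
qed

lemma abs_cont_deriv_spike:
  assumes "abs_cont_deriv f g" and "AE x in lebesgue. x \<in> {0..1} \<longrightarrow> g x = h x"
  shows "abs_cont_deriv f h"
proof -
  obtain N where N: "negligible N" "{x. \<not> (x \<in> {0..1} \<longrightarrow> g x = h x)} \<subseteq> N"
    using assms(2) unfolding eventually_ae_filter_negligible by blast
  have "h absolutely_integrable_on {0..1}"
    by (rule absolutely_integrable_spike[OF abs_cont_deriv_integrable[OF assms(1)] N(1)]) (use N(2) in auto)
  moreover have "integral {0..x} g = integral {0..x} h" if "x \<in> {0..1}" for x
    by (rule integral_spike[OF N(1)]) (use N(2) that in auto)
  ultimately show ?thesis
    using abs_cont_deriv_eq[OF assms(1)] by (intro abs_cont_derivI) metis+
qed

lemma abs_cont_deriv_cong: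
  assumes "abs_cont_deriv f g" "\<And>x. x \<in> {0..1} \<Longrightarrow> f x = f1 x" "\<And>x. x \<in> {0..1} \<Longrightarrow> g x = g1 x"
  shows "abs_cont_deriv f1 g1"
proof -
  have "abs_cont_deriv f g1" by (rule abs_cont_deriv_spike[OF assms(1)]) (use assms(3) in auto)
  then show ?thesis using assms(2)[of 0] assms(2) unfolding abs_cont_deriv_def
    by (metis atLeastAtMost_iff order_refl zero_le_one)
qed

lemma abs_cont_deriv_add:
  assumes "abs_cont_deriv f f'" "abs_cont_deriv g g'"
  shows "abs_cont_deriv (\<lambda>x. f x + g x) (\<lambda>x. f' x + g' x)"
proof -
  have ai: "f' absolutely_integrable_on {0..1}" "g' absolutely_integrable_on {0..1}"
    using assms by (auto intro: abs_cont_deriv_integrable)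
  have "f' integrable_on {0..x}" "g' integrable_on {0..x}" if "x \<in> {0..1}" for x
    using absolutely_integrable_on_unit_subinterval[OF ai(1), of 0 x]
      absolutely_integrable_on_unit_subinterval[OF ai(2), of 0 x] that
    by (auto simp: absolutely_integrable_on_def)
  note int = this
  show ?thesis
  proof (rule abs_cont_derivI)
    show "(\<lambda>x. f' x + g' x) absolutely_integrable_on {0..1}"
      using ai by (rule set_integral_add)
    fix x :: real assume x: "x \<in> {0..1}"
    show "f x + g x = f 0 + g 0 + integral {0..x} (\<lambda>x. f' x + g' x)"
      unfolding hk_integral_add[OF int[OF x]]
      using abs_cont_deriv_eq[OF assms(1) x] abs_cont_deriv_eq[OF assms(2) x] by (metis add.assoc add.left_commute)
  qed
qed

lemma abs_cont_deriv_cmult: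
  assumes "abs_cont_deriv f f'"
  shows "abs_cont_deriv (\<lambda>x. c * f x) (\<lambda>x. c * f' x)"
proof -
  have "(\<lambda>x. f' x * c) absolutely_integrable_on {0..1}"
    using abs_cont_deriv_integrable[OF assms] by (intro absolutely_integrable_mult_continuous) auto
  then have "(\<lambda>x. c * f' x) absolutely_integrable_on {0..1}"
    by (simp add: mult.commute)
  moreover have "c * f x = c * f 0 + integral {0..x} (\<lambda>x. c * f' x)" if "x \<in> {0..1}" for x
    by (subst abs_cont_deriv_eq[OF assms that]) (simp add: distrib_left)
  ultimately show ?thesis
    by (rule abs_cont_derivI)
qed

lemma abs_cont_deriv_cnj:
  assumes "abs_cont_deriv f f'"
  shows "abs_cont_deriv (\<lambda>x. cnj (f x)) (\<lambda>x. cnj (f' x))"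
proof -
  have "(\<lambda>x. cnj (f' x)) absolutely_integrable_on {0..1}"
    using abs_cont_deriv_integrable[OF assms] by (rule absolutely_integrable_cnj)
  moreover have "cnj (f x) = cnj (f 0) + integral {0..x} (\<lambda>x. cnj (f' x))" if "x \<in> {0..1}" for x
    by (subst abs_cont_deriv_eq[OF assms that]) (simp add: integral_cnj)
  ultimately show ?thesis
    by (rule abs_cont_derivI)
qed

lemma abs_cont_deriv_C1:
  assumes "\<And>x. x \<in> {0..1} \<Longrightarrow> (f has_vector_derivative f' x) (at x within {0..1})"
    and "continuous_on {0..1} f'"
  shows "abs_cont_deriv f f'"
proof (rule abs_cont_derivI)
  show "f' absolutely_integrable_on {0..1}"
    using assms(2) by (rule absolutely_integrable_continuous_real)
  fix x :: real assume x: "x \<in> {0..1}"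
  have "(f' has_integral f x - f 0) {0..x}"
  proof (rule fundamental_theorem_of_calculus)
    fix t assume "t \<in> {0..x}"
    then have "t \<in> {0..1}" using x by auto
    from assms(1)[OF this] show "(f has_vector_derivative f' t) (at t within {0..x})"
      by (rule has_vector_derivative_within_subset) (use x in auto)
  qed (use x in auto)
  then show "f x = f 0 + integral {0..x} f'"
    by (simp add: integral_unique)
qed

lemma abs_cont_deriv_imp_has_vector_derivative:
  assumes "abs_cont_deriv f f'" "continuous_on {0..1} f'" "x \<in> {0..1}"
  shows "(f has_vector_derivative f' x) (at x within {0..1})"
proof -
  have "((\<lambda>x. f 0 + integral {0..x} f') has_vector_derivative f' x) (at x within {0..1})"
    using integral_has_vector_derivative[OF assms(2,3)] 
    by (auto intro!: derivative_eq_intros)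
  then show ?thesis
    by (rule has_vector_derivative_transform[OF assms(3), rotated]) (rule abs_cont_deriv_eq[OF assms(1)])
qed

text \<open>Cut \<open>[x, y]\<close> into pieces shorter than \<open>\<delta>\<close>: both sides of the estimate add up.\<close>

lemma increments_bound_of_local:
  fixes D :: "real \<Rightarrow> complex" and G :: "real \<Rightarrow> real"
  assumes "0 < \<delta>"
    and loc: "\<And>x y. 0 \<le> x \<Longrightarrow> x \<le> y \<Longrightarrow> y \<le> 1 \<Longrightarrow> y - x < \<delta> \<Longrightarrow> norm (D y - D x) \<le> G y - G x"
    and "0 \<le> x" "x \<le> y" "y \<le> 1"
  shows "norm (D y - D x) \<le> G y - G x"
proof -
  have *: "norm (D y - D x) \<le> G y - G x"
    if "0 \<le> x" "x \<le> y" "y \<le> 1" "y - x \<le> real n * (\<delta>/2)" for x y n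
    using that
  proof (induction n arbitrary: y)
    case 0
    then show ?case by simp
  next
    case (Suc n)
    define z where "z = max x (y - \<delta>/2)"
    have z: "x \<le> z" "z \<le> y" "z - x \<le> real n * (\<delta>/2)" "y - z < \<delta>"
      using Suc.prems \<open>0 < \<delta>\<close> by (auto simp: z_def algebra_simps max_def)
    have "norm (D z - D x) \<le> G z - G x"
      by (rule Suc.IH) (use z Suc.prems in auto)
    moreover have "norm (D y - D z) \<le> G y - G z"
      by (rule loc) (use z Suc.prems in auto)
    ultimately show ?case
      using norm_triangle_ineq[of "D y - D z" "D z - D x"] by simp
  qed
  obtain n where "(y - x) / (\<delta>/2) \<le> real n" using real_arch_simple by blast
  then have "y - x \<le> real n * (\<delta>/2)" using \<open>0 < \<delta>\<close> by (simp add: field_simps)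
  with * assms show ?thesis by blast
qed

text \<open>On a short interval the increment of \<open>F \<circ> f\<close> and the integral of \<open>f' * (F' \<circ> f)\<close> both differ from
  \<open>F' (f x)\<close> times the increment of \<open>f\<close> by at most \<open>e\<close> times the mass of \<open>f'\<close> on that interval,
  because \<open>F'\<close> is uniformly continuous on a ball that contains the range of \<open>f\<close>.  So the increments of the
  difference \<open>D\<close> are at most \<open>2 e\<close> times the mass of \<open>f'\<close>, for every \<open>e > 0\<close>, and \<open>D\<close> is constant.\<close>

lemma abs_cont_deriv_chain:
  assumes f: "abs_cont_deriv f f'"
    and F: "\<And>z. (F has_field_derivative F' z) (at z)" and F': "continuous_on UNIV F'"
  shows "abs_cont_deriv (\<lambda>x. F (f x)) (\<lambda>x. f' x * F' (f x))"
proof -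
  note ai = abs_cont_deriv_integrable[OF f] and cf = abs_cont_deriv_continuous[OF f]
  have cF: "continuous_on {0..1} (\<lambda>x. F' (f x))"
    by (rule continuous_on_compose2[OF F' cf]) auto
  define h where "h = (\<lambda>x. f' x * F' (f x))"
  have hi: "h absolutely_integrable_on {0..1}"
    unfolding h_def by (rule absolutely_integrable_mult_continuous[OF ai cF])
  define D where "D = (\<lambda>x. F (f x) - integral {0..x} h)"
  define G where "G = (\<lambda>x. integral {0..x} (\<lambda>t. norm (f' t)))"
  have ni: "(\<lambda>t. norm (f' t)) absolutely_integrable_on {0..1}"
    using absolutely_integrable_norm[OF ai] by (simp add: o_def)
  have Gdiff: "G y - G x = integral {x..y} (\<lambda>t. norm (f' t))" if "0 \<le> x" "x \<le> y" "y \<le> 1" for x y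
    unfolding G_def by (rule integral_diff_unit[OF ni that])
  have "compact (f ` {0..1})" using cf by (intro compact_continuous_image) auto
  then obtain R where "\<And>z. z \<in> f ` {0..1} \<Longrightarrow> norm z \<le> R"
    using compact_imp_bounded[of "f ` {0..1}"] unfolding bounded_iff by metis
  then have R: "f ` {0..1} \<subseteq> cball 0 R" by auto
  have main: "norm (D x - D 0) \<le> (2 * e) * G x" if "0 < e" "x \<in> {0..1}" for e x
  proof -
    have "uniformly_continuous_on (cball 0 R) F'"
      using F' by (intro compact_uniformly_continuous) (auto intro: continuous_on_subset)
    then obtain d where "d > 0" and d: "\<And>z w. z \<in> cball 0 R \<Longrightarrow> w \<in> cball 0 R \<Longrightarrow> dist z w < d \<Longrightarrow> dist (F' z) (F' w) < e"
      using \<open>0 < e\<close> unfolding uniformly_continuous_on_def by metis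
    have "uniformly_continuous_on {0..1} f"
      using cf by (intro compact_uniformly_continuous) auto
    then obtain \<delta> where "\<delta> > 0" and \<delta>: "\<And>z w. z \<in> {0..1} \<Longrightarrow> w \<in> {0..1} \<Longrightarrow> dist z w < \<delta> \<Longrightarrow> dist (f z) (f w) < d"
      using \<open>0 < d\<close> unfolding uniformly_continuous_on_def by metis
    have "norm (D x - D 0) \<le> (2*e) * G x - (2*e) * G 0"
    proof (rule increments_bound_of_local[OF \<open>\<delta> > 0\<close>])
      fix x y :: real assume xy: "0 \<le> x" "x \<le> y" "y \<le> 1" "y - x < \<delta>"
      have close: "dist (f t) (f x) < d" if "t \<in> {x..y}" for t
        using \<delta>[of t x] that xy by (auto simp: dist_real_def)
      define C where "C = {z \<in> cball 0 R. dist z (f x) < d}"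
      have "C = cball 0 R \<inter> ball (f x) d" by (auto simp: C_def dist_commute)
      then have "convex C" by (simp add: convex_Int)
      have inC: "f t \<in> C" if "t \<in> {x..y}" for t
        proof -
        have "f t \<in> f ` {0..1}" using that xy by auto
        then show ?thesis using close[OF that] R by (auto simp: C_def)
      qed
      have fi: "norm (f y - f x) \<le> integral {x..y} (\<lambda>t. norm (f' t))"
        using norm_integral_le_scaled[OF ai ai, of x y 1] abs_cont_deriv_diff_eq[OF f, of x y] xy by simp
      have lip: "norm ((F (f y) - F' (f x) * f y) - (F (f x) - F' (f x) * f x)) \<le> e * norm (f y - f x)"
      proof (rule field_differentiable_bound[OF \<open>convex C\<close>])
        fix z assume "z \<in> C"
        show "((\<lambda>z. F z - F' (f x) * z) has_field_derivative (F' z - F' (f x))) (at z within C)"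
          by (auto intro!: derivative_eq_intros intro: has_field_derivative_at_within[OF F])
        show "norm (F' z - F' (f x)) \<le> e"
          using d[of z "f x"] \<open>z \<in> C\<close> inC[of x] xy by (auto simp: C_def dist_norm)
      qed (use inC xy in auto)
      define k where "k = (\<lambda>t. f' t * (F' (f t) - F' (f x)))"
      have ki: "k absolutely_integrable_on {0..1}"
        unfolding k_def by (intro absolutely_integrable_mult_continuous[OF ai] continuous_intros cF)
      have kb: "norm (integral {x..y} k) \<le> e * integral {x..y} (\<lambda>t. norm (f' t))"
      proof (rule norm_integral_le_scaled[OF ai ki])
        fix t assume t: "t \<in> {x..y}"
        have "norm (F' (f t) - F' (f x)) \<le> e"
          using d[of "f t" "f x"] inC[OF t] inC[of x] xy by (auto simp: C_def dist_norm)
        then show "norm (k t) \<le> e * norm (f' t)"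
          unfolding k_def norm_mult by (subst mult.commute) (rule mult_right_mono, auto)
      qed (use xy in auto)
      have hxy: "integral {x..y} h = integral {x..y} k + F' (f x) * (f y - f x)"
      proof -
        have "k integrable_on {x..y}" "f' integrable_on {x..y}"
          using absolutely_integrable_on_unit_subinterval[OF ki, of x y]
            absolutely_integrable_on_unit_subinterval[OF ai, of x y] xy
          by (auto simp: absolutely_integrable_on_def)
        then have "integral {x..y} (\<lambda>t. k t + F' (f x) * f' t) = integral {x..y} k + F' (f x) * integral {x..y} f'"
          by (subst hk_integral_add) (auto intro: integrable_on_mult_right)
        moreover have "(\<lambda>t. k t + F' (f x) * f' t) = h"
          by (auto simp: k_def h_def algebra_simps)
        ultimately show ?thesis using abs_cont_deriv_diff_eq[OF f, of x y] xy by simp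
      qed
      have "D y - D x = (F (f y) - F (f x)) - integral {x..y} h"
        using integral_diff_unit[OF hi, of x y] xy by (simp add: D_def algebra_simps)
      also have "\<dots> = ((F (f y) - F' (f x) * f y) - (F (f x) - F' (f x) * f x)) - integral {x..y} k"
        unfolding hxy by (simp add: algebra_simps)
      finally have "norm (D y - D x) \<le> e * norm (f y - f x) + e * integral {x..y} (\<lambda>t. norm (f' t))"
        using lip kb norm_triangle_ineq4 by (smt (verit))
      also have "\<dots> \<le> e * integral {x..y} (\<lambda>t. norm (f' t)) + e * integral {x..y} (\<lambda>t. norm (f' t))"
        using fi \<open>0 < e\<close> by simp
      also have "\<dots> = (2*e) * G y - (2*e) * G x"
        using Gdiff[of x y] xy by (simp add: algebra_simps)
      finally show "norm (D y - D x) \<le> (2*e) * G y - (2*e) * G x" .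
    qed (use that in auto)
    then show ?thesis by (simp add: G_def)
  qed
  have "D x = D 0" if x: "x \<in> {0..1}" for x
  proof (rule ccontr)
    assume "D x \<noteq> D 0"
    then have pos: "0 < norm (D x - D 0)" by simp
    have G: "0 \<le> G x"
      using Gdiff[of 0 x] x main[of 1 x] norm_ge_zero[of "D x - D 0"] by linarith
    define e where "e = norm (D x - D 0) / (4 * (G x + 1))"
    have "0 < e" using pos G by (auto simp: e_def)
    have "norm (D x - D 0) \<le> (2 * e) * G x" by (rule main[OF \<open>0 < e\<close> x])
    also have "\<dots> \<le> 2 * e * (G x + 1)" using \<open>0 < e\<close> by simp
    also have "\<dots> = norm (D x - D 0) / 2" using G by (simp add: e_def field_simps)
    finally show False using pos by simp
  qed
  note D_const = this
  have eq: "F (f x) = F (f 0) + integral {0..x} h" if "x \<in> {0..1}" for x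
  proof -
    have "F (f x) - integral {0..x} h = F (f 0)"
      using D_const[OF that] by (simp add: D_def)
    then show ?thesis by (metis diff_add_cancel)
  qed
  show ?thesis
    using hi eq unfolding h_def by (rule abs_cont_derivI)
qed

lemma abs_cont_deriv_exp:
  "abs_cont_deriv f f' \<Longrightarrow> abs_cont_deriv (\<lambda>x. exp (f x)) (\<lambda>x. f' x * exp (f x))"
  by (rule abs_cont_deriv_chain) (auto intro: DERIV_exp continuous_intros)

text \<open>Polarisation reduces the product to the chain rule for the square.\<close>

lemma abs_cont_deriv_mult:
  assumes "abs_cont_deriv f f'" "abs_cont_deriv g g'"
  shows "abs_cont_deriv (\<lambda>x. f x * g x) (\<lambda>x. f' x * g x + f x * g' x)"
proof -
  have sq: "abs_cont_deriv (\<lambda>x. (h x)\<^sup>2) (\<lambda>x. h' x * (2 * h x))" if "abs_cont_deriv h h'" for h h'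
    by (rule abs_cont_deriv_chain[OF that]) (auto intro!: derivative_eq_intros continuous_intros)
  have "abs_cont_deriv (\<lambda>x. (1/4) * (f x + g x)\<^sup>2 + (-1/4) * (f x + (-1) * g x)\<^sup>2)
     (\<lambda>x. (1/4) * ((f' x + g' x) * (2 * (f x + g x))) + (-1/4) * ((f' x + (-1) * g' x) * (2 * (f x + (-1) * g x))))"
    by (intro abs_cont_deriv_add abs_cont_deriv_cmult sq assms)
  then show ?thesis
    by (rule abs_cont_deriv_cong) (auto simp: power2_eq_square field_simps)
qed

section \<open>A Dirac system with summable coefficient\<close>

text \<open>A Dirac (or Zakharov-Shabat) system at spectral parameter \<open>0\<close>.  The conjugate in the second
  equation is responsible for the conserved quantity \<open>\<bar>a\<bar>\<^sup>2 - \<bar>b\<bar>\<^sup>2\<close> and for the symmetry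
  \<open>(a, b) \<mapsto> (cnj b, cnj a)\<close> of the solution space.\<close>

definition dirac_solution :: "(real \<Rightarrow> complex) \<Rightarrow> (real \<Rightarrow> complex) \<Rightarrow> (real \<Rightarrow> complex) \<Rightarrow> bool" where
  "dirac_solution w a b \<longleftrightarrow>
     abs_cont_deriv a (\<lambda>x. w x * b x) \<and> abs_cont_deriv b (\<lambda>x. cnj (w x) * a x)"

lemma L1_norm_cnj: "L1_norm (\<lambda>x. cnj (w x)) = L1_norm w"
  by (simp add: L1_norm_def)

lemma norm_integral_mult_le:
  fixes w f :: "real \<Rightarrow> complex"
  assumes w: "w absolutely_integrable_on {0..1}" and f: "continuous_on {0..1} f"
    and B: "\<And>t. t \<in> {0..1} \<Longrightarrow> norm (f t) \<le> B" and x: "x \<in> {0..1}"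
  shows "norm (integral {0..x} (\<lambda>t. w t * f t)) \<le> B * L1_norm w"
proof (rule norm_integral_le_L1[OF w])
  show "(\<lambda>t. w t * f t) absolutely_integrable_on {0..1}"
    using w f by (rule absolutely_integrable_mult_continuous)
  show "0 \<le> B" using order_trans[OF norm_ge_zero B[of 0]] by simp
  show "norm (w t * f t) \<le> B * norm (w t)" if "t \<in> {0..1}" for t
    using mult_left_mono[OF B[OF that] norm_ge_zero[of "w t"]] by (simp add: norm_mult mult.commute)
qed (use x in auto)

lemma continuous_on_integral_mult:
  fixes w f :: "real \<Rightarrow> complex"
  assumes "w absolutely_integrable_on {0..1}" "continuous_on {0..1} f"
  shows "continuous_on {0..1} (\<lambda>x. integral {0..x} (\<lambda>t. w t * f t))"
  using absolutely_integrable_mult_continuous[OF assms]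
  by (intro indefinite_integral_continuous_1) (simp add: absolutely_integrable_on_def)

text \<open>Eliminating \<open>b\<close> leaves a fixed point equation for \<open>a\<close>.  As \<open>w\<close> has mass at most \<open>1/2\<close>, its right-hand
  side is a contraction with constant \<open>1/4\<close> in the supremum norm.  To use the complete space of
  bounded continuous functions on the real line, functions on \<open>[0, 1]\<close> are extended by constants, that
  is, composed with the retraction \<open>P\<close> onto \<open>[0, 1]\<close>.\<close>

lemma dirac_solution_exists:
  assumes w: "w absolutely_integrable_on {0..1}" and small: "L1_norm w \<le> 1/2"
  shows "\<exists>a b. dirac_solution w a b \<and> a 0 = 1 \<and> b 0 = 0"
proof -
  define P where "P = (\<lambda>x::real. max 0 (min 1 x))"
  have P: "P x \<in> {0..1}" for x by (auto simp: P_def)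
  have Pid: "P x = x" if "x \<in> {0..1}" for x using that by (auto simp: P_def)
  have cP: "continuous_on UNIV P" unfolding P_def by (intro continuous_intros)
  define J where "J = (\<lambda>w (f :: real \<Rightarrow> complex) x. integral {0..x} (\<lambda>t. w t * f t :: complex))"
  define T0 where "T0 = (\<lambda>a x. 1 + J w (J (\<lambda>t. cnj (w t)) a) (P x))"
  note w' = absolutely_integrable_cnj[OF w]
  have cJ: "continuous_on {0..1} (J v f)" if "v absolutely_integrable_on {0..1}" "continuous_on {0..1} f" for v f
    unfolding J_def using that by (rule continuous_on_integral_mult)
  have J_diff: "J v f x - J v g x = J v (\<lambda>t. f t - g t) x"
    if v: "v absolutely_integrable_on {0..1}" and "continuous_on {0..1} f" "continuous_on {0..1} g" "x \<in> {0..1}"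
    for v f g x
  proof -
    have "(\<lambda>t. v t * f t) integrable_on {0..x}" "(\<lambda>t. v t * g t) integrable_on {0..x}"
      using absolutely_integrable_on_unit_subinterval[OF absolutely_integrable_mult_continuous[OF v], of _ 0 x] that
      by (auto simp: absolutely_integrable_on_def)
    from hk_integral_diff[OF this] show ?thesis
      by (simp add: J_def right_diff_distrib)
  qed
  have T0_bcont: "T0 a \<in> bcontfun" if "continuous_on {0..1} a" for a
  proof -
    have c: "continuous_on {0..1} (J w (J (\<lambda>t. cnj (w t)) a))" by (intro cJ w w' that)
    have "continuous_on UNIV (\<lambda>x. J w (J (\<lambda>t. cnj (w t)) a) (P x))"
      by (rule continuous_on_compose2[OF c cP]) (use P in auto)
    then have "continuous_on UNIV (T0 a)" unfolding T0_def by (intro continuous_intros)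
    moreover have "bounded (range (T0 a))"
    proof (rule bounded_subset)
      show "bounded ((\<lambda>x. 1 + J w (J (\<lambda>t. cnj (w t)) a) x) ` {0..1})"
        by (intro compact_imp_bounded compact_continuous_image continuous_intros c) auto
      show "range (T0 a) \<subseteq> (\<lambda>x. 1 + J w (J (\<lambda>t. cnj (w t)) a) x) ` {0..1}"
        using P by (auto simp: T0_def)
    qed
    ultimately show ?thesis by (simp add: bcontfun_def)
  qed
  define T :: "(real \<Rightarrow>\<^sub>C complex) \<Rightarrow> (real \<Rightarrow>\<^sub>C complex)"
    where "T = (\<lambda>a. Bcontfun (T0 (apply_bcontfun a)))"
  have ca: "continuous_on S (apply_bcontfun a)" for a :: "real \<Rightarrow>\<^sub>C complex" and S
    by (rule continuous_on_apply_bcontfun)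
  have Tapp: "apply_bcontfun (T a) x = T0 (apply_bcontfun a) x" for a x
    unfolding T_def by (subst Bcontfun_inverse[OF T0_bcont[OF ca]]) simp
  have "\<exists>!a. T a = a"
  proof (rule banach_fix_type)
    show "\<forall>a b. dist (T a) (T b) \<le> 1/4 * dist a b"
    proof (intro allI dist_bound)
      fix a b :: "real \<Rightarrow>\<^sub>C complex" and x :: real
      define d where "d = dist a b"
      have "0 \<le> d" by (simp add: d_def)
      have 1: "norm (apply_bcontfun a t - apply_bcontfun b t) \<le> d" for t
        unfolding d_def by (metis dist_bounded dist_norm)
      have c1: "continuous_on {0..1} (\<lambda>t. apply_bcontfun a t - apply_bcontfun b t)"
        by (intro continuous_intros ca)
      have 2: "norm (J (\<lambda>t. cnj (w t)) a t - J (\<lambda>t. cnj (w t)) b t) \<le> d / 2" if "t \<in> {0..1}" for t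
      proof -
        have "norm (J (\<lambda>t. cnj (w t)) a t - J (\<lambda>t. cnj (w t)) b t) \<le> d * L1_norm w"
          unfolding J_diff[OF w' ca ca that] unfolding J_def
          using norm_integral_mult_le[OF w' c1 1 that] by (simp add: L1_norm_cnj)
        also have "\<dots> \<le> d * (1/2)" using small \<open>0 \<le> d\<close> by (intro mult_left_mono)
        finally show ?thesis by simp
      qed
      have c2: "continuous_on {0..1} (\<lambda>t. J (\<lambda>t. cnj (w t)) a t - J (\<lambda>t. cnj (w t)) b t)"
        by (intro continuous_on_diff cJ w' ca)
      have "norm (J w (J (\<lambda>t. cnj (w t)) a) (P x) - J w (J (\<lambda>t. cnj (w t)) b) (P x)) \<le> (d/2) * L1_norm w"
        using norm_integral_mult_le[OF w c2 2 P]
        unfolding J_diff[OF w cJ[OF w' ca] cJ[OF w' ca] P] by (simp add: J_def)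
      also have "\<dots> \<le> (d/2) * (1/2)" using small \<open>0 \<le> d\<close> by (intro mult_left_mono) auto
      finally show "dist (apply_bcontfun (T a) x) (apply_bcontfun (T b) x) \<le> 1/4 * dist a b"
        by (simp add: Tapp T0_def dist_norm d_def)
    qed
  qed auto
  then obtain a where a: "T a = a" by blast
  define b where "b = J (\<lambda>t. cnj (w t)) (apply_bcontfun a)"
  have eq: "apply_bcontfun a x = 1 + J w b x" if "x \<in> {0..1}" for x
    using Tapp[of a x] that by (simp add: a T0_def Pid b_def)
  have cb: "continuous_on {0..1} b" unfolding b_def by (intro cJ w' ca)
  have a0: "apply_bcontfun a 0 = 1" using eq[of 0] by (simp add: J_def)
  have b0: "b 0 = 0" by (simp add: b_def J_def)
  have "dirac_solution w (apply_bcontfun a) b"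
    unfolding dirac_solution_def
  proof
    show "abs_cont_deriv (apply_bcontfun a) (\<lambda>x. w x * b x)"
    proof (rule abs_cont_derivI)
      show "(\<lambda>x. w x * b x) absolutely_integrable_on {0..1}"
        using w cb by (rule absolutely_integrable_mult_continuous)
      show "apply_bcontfun a x = apply_bcontfun a 0 + integral {0..x} (\<lambda>x. w x * b x)" if "x \<in> {0..1}" for x
        unfolding a0 using eq[OF that] by (simp add: J_def)
    qed
    show "abs_cont_deriv b (\<lambda>x. cnj (w x) * apply_bcontfun a x)"
    proof (rule abs_cont_derivI)
      show "(\<lambda>x. cnj (w x) * apply_bcontfun a x) absolutely_integrable_on {0..1}"
        using w' ca by (rule absolutely_integrable_mult_continuous)
      show "b x = b 0 + integral {0..x} (\<lambda>x. cnj (w x) * apply_bcontfun a x)" if "x \<in> {0..1}" for x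
        unfolding b0 by (simp add: J_def b_def)
    qed
  qed
  with a0 b0 show ?thesis by blast
qed

text \<open>Evaluate the two integral equations where \<open>norm (a x)\<close> and \<open>norm (b x)\<close> are maximal; as \<open>w\<close> has mass at most
  \<open>1/2\<close>, half of the sum of the two maxima can be absorbed on the left.  The sources \<open>f\<close> and \<open>g\<close>
  serve to compare two systems.\<close>

lemma dirac_perturbed_bound:
  assumes w: "w absolutely_integrable_on {0..1}" and small: "L1_norm w \<le> 1/2"
    and f: "f absolutely_integrable_on {0..1}" and g: "g absolutely_integrable_on {0..1}"
    and a: "abs_cont_deriv a (\<lambda>x. w x * b x + f x)"
    and b: "abs_cont_deriv b (\<lambda>x. cnj (w x) * a x + g x)" and x: "x \<in> {0..1}"
  shows "norm (a x) + norm (b x) \<le> 2 * (norm (a 0) + norm (b 0) + L1_norm f + L1_norm g)"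
proof -
  have step: "norm (u x) \<le> norm (u 0) + B * L1_norm v + L1_norm h"
    if v: "v absolutely_integrable_on {0..1}" and h: "h absolutely_integrable_on {0..1}"
      and u: "abs_cont_deriv u (\<lambda>x. v x * z x + h x)" and z: "continuous_on {0..1} z"
      and B: "\<And>t. t \<in> {0..1} \<Longrightarrow> norm (z t) \<le> B" and x: "x \<in> {0..1}"
    for u v h z :: "real \<Rightarrow> complex" and B x
  proof -
    have int: "(\<lambda>t. v t * z t) integrable_on {0..x}" "h integrable_on {0..x}"
      using absolutely_integrable_on_unit_subinterval[OF absolutely_integrable_mult_continuous[OF v z], of 0 x]
        absolutely_integrable_on_unit_subinterval[OF h, of 0 x] x
      by (auto simp: absolutely_integrable_on_def)
    have "u x = u 0 + (integral {0..x} (\<lambda>t. v t * z t) + integral {0..x} h)"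
      using abs_cont_deriv_eq[OF u x] hk_integral_add[OF int] by metis
    then have "norm (u x) \<le> norm (u 0) + norm (integral {0..x} (\<lambda>t. v t * z t)) + norm (integral {0..x} h)"
      by (metis (no_types) add.assoc norm_triangle_le norm_triangle_ineq add_left_mono)
    moreover have "norm (integral {0..x} (\<lambda>t. v t * z t)) \<le> B * L1_norm v"
      by (rule norm_integral_mult_le[OF v z B x])
    moreover have "norm (integral {0..x} h) \<le> L1_norm h"
      using norm_integral_le_L1[OF h h, of 0 x 1] x by auto
    ultimately show ?thesis by linarith
  qed
  note ca = abs_cont_deriv_continuous[OF a] and cb = abs_cont_deriv_continuous[OF b]
  obtain xa where xa: "xa \<in> {0..1}" "\<And>t. t \<in> {0..1} \<Longrightarrow> norm (a t) \<le> norm (a xa)"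
    using continuous_attains_sup[of "{0..1::real}" "\<lambda>t. norm (a t)"] continuous_on_norm[OF ca] by auto
  obtain xb where xb: "xb \<in> {0..1}" "\<And>t. t \<in> {0..1} \<Longrightarrow> norm (b t) \<le> norm (b xb)"
    using continuous_attains_sup[of "{0..1::real}" "\<lambda>t. norm (b t)"] continuous_on_norm[OF cb] by auto
  have 1: "norm (a xa) \<le> norm (a 0) + norm (b xb) * L1_norm w + L1_norm f"
    by (rule step[OF w f a cb xb(2) xa(1)])
  have 2: "norm (b xb) \<le> norm (b 0) + norm (a xa) * L1_norm w + L1_norm g"
    using step[OF absolutely_integrable_cnj[OF w] g b ca xa(2) xb(1)] by (simp add: L1_norm_cnj)
  have 3: "norm (b xb) * L1_norm w \<le> norm (b xb) * (1/2)" "norm (a xa) * L1_norm w \<le> norm (a xa) * (1/2)"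
    using small by (intro mult_left_mono; simp)+
  show ?thesis using 1 2 3 xa(2)[OF x] xb(2)[OF x] by argo
qed

lemma dirac_bound:
  assumes "w absolutely_integrable_on {0..1}" "L1_norm w \<le> 1/2" "dirac_solution w a b" "x \<in> {0..1}"
  shows "norm (a x) + norm (b x) \<le> 2 * (norm (a 0) + norm (b 0))"
  using dirac_perturbed_bound[of w "\<lambda>_. 0" "\<lambda>_. 0" a b x] assms
  by (simp add: dirac_solution_def L1_norm_def)

lemma dirac_conservation:
  assumes "dirac_solution w a b" "x \<in> {0..1}"
  shows "a x * cnj (a x) - b x * cnj (b x) = a 0 * cnj (a 0) - b 0 * cnj (b 0)"
proof -
  have a: "abs_cont_deriv a (\<lambda>x. w x * b x)" and b: "abs_cont_deriv b (\<lambda>x. cnj (w x) * a x)"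
    using assms(1) by (auto simp: dirac_solution_def)
  have "abs_cont_deriv (\<lambda>x. a x * cnj (a x) + (-1) * (b x * cnj (b x)))
     (\<lambda>x. (w x * b x * cnj (a x) + a x * cnj (w x * b x)) + 
         (-1) * (cnj (w x) * a x * cnj (b x) + b x * cnj (cnj (w x) * a x)))"
    by (intro abs_cont_deriv_add abs_cont_deriv_cmult abs_cont_deriv_mult abs_cont_deriv_cnj a b)
  then have "abs_cont_deriv (\<lambda>x. a x * cnj (a x) - b x * cnj (b x)) (\<lambda>x. 0)"
    by (rule abs_cont_deriv_cong) (auto simp: algebra_simps)
  from abs_cont_deriv_eq[OF this assms(2)] show ?thesis by simp
qed

lemma dirac_norm_conservation:
  assumes "dirac_solution w a b" "x \<in> {0..1}"
  shows "(norm (a x))\<^sup>2 - (norm (b x))\<^sup>2 = (norm (a 0))\<^sup>2 - (norm (b 0))\<^sup>2"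
  using dirac_conservation[OF assms] unfolding complex_norm_square[symmetric]
  by (metis of_real_diff of_real_eq_iff)

lemma dirac_linear:
  assumes "dirac_solution w a b" "dirac_solution w a' b'"
  shows "dirac_solution w (\<lambda>x. c * a x + d * a' x) (\<lambda>x. c * b x + d * b' x)"
proof -
  have "abs_cont_deriv (\<lambda>x. c * a x + d * a' x) (\<lambda>x. c * (w x * b x) + d * (w x * b' x))"
    "abs_cont_deriv (\<lambda>x. c * b x + d * b' x) (\<lambda>x. c * (cnj (w x) * a x) + d * (cnj (w x) * a' x))"
    using assms by (auto simp: dirac_solution_def intro!: abs_cont_deriv_add abs_cont_deriv_cmult)
  then show ?thesis
    unfolding dirac_solution_def by (simp add: algebra_simps)
qed

lemma dirac_conjugate:
  assumes "dirac_solution w a b"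
  shows "dirac_solution w (\<lambda>x. cnj (b x)) (\<lambda>x. cnj (a x))"
  using assms abs_cont_deriv_cnj[of a "\<lambda>x. w x * b x"] abs_cont_deriv_cnj[of b "\<lambda>x. cnj (w x) * a x"]
  by (simp add: dirac_solution_def)

text \<open>The two sides solve the same system with the same initial values, and \<open>dirac_bound\<close> gives uniqueness.\<close>

lemma dirac_representation:
  assumes w: "w absolutely_integrable_on {0..1}" "L1_norm w \<le> 1/2"
    and ab: "dirac_solution w a b" "a 0 = 1" "b 0 = 0" and uv: "dirac_solution w u v" and x: "x \<in> {0..1}"
  shows "u x = u 0 * a x + v 0 * cnj (b x)" "v x = u 0 * b x + v 0 * cnj (a x)"
proof -
  have 1: "dirac_solution w (\<lambda>x. u 0 * a x + v 0 * cnj (b x)) (\<lambda>x. u 0 * b x + v 0 * cnj (a x))"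
    by (intro dirac_linear dirac_conjugate ab)
  have "norm (1 * u x + (-1) * (u 0 * a x + v 0 * cnj (b x))) + norm (1 * v x + (-1) * (u 0 * b x + v 0 * cnj (a x))) \<le> 0"
    using dirac_bound[OF w dirac_linear[OF uv 1, of 1 "-1"] x] ab by simp
  moreover have "norm p + norm r \<le> 0 \<Longrightarrow> p = 0 \<and> r = 0" for p r :: complex
    by (smt (verit) norm_ge_zero norm_eq_zero)
  ultimately have "1 * u x + (-1) * (u 0 * a x + v 0 * cnj (b x)) = 0"
    "1 * v x + (-1) * (u 0 * b x + v 0 * cnj (a x)) = 0"
    by blast+
  moreover have "1 * p + (-1) * r = 0 \<Longrightarrow> p = r" for p r :: complex
    by simp
  ultimately show "u x = u 0 * a x + v 0 * cnj (b x)" "v x = u 0 * b x + v 0 * cnj (a x)"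
    by blast+
qed

lemma dirac_small:
  assumes w: "w absolutely_integrable_on {0..1}" "L1_norm w \<le> 1/2"
    and ab: "dirac_solution w a b" "a 0 = 1" "b 0 = 0" and x: "x \<in> {0..1}"
  shows "norm (b x) \<le> 2 * L1_norm w" "norm (a x - 1) \<le> 2 * (L1_norm w)\<^sup>2"
proof -
  have bd: "norm (a t) \<le> 2" if "t \<in> {0..1}" for t
    using order_trans[OF _ dirac_bound[OF w ab(1) that], of "norm (a t)"] by (simp add: ab)
  have a: "abs_cont_deriv a (\<lambda>x. w x * b x)" and b: "abs_cont_deriv b (\<lambda>x. cnj (w x) * a x)"
    using ab(1) by (auto simp: dirac_solution_def)
  have *: "norm (b t) \<le> 2 * L1_norm w" if t: "t \<in> {0..1}" for t
    using norm_integral_mult_le[OF absolutely_integrable_cnj[OF w(1)] abs_cont_deriv_continuous[OF a] bd t]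
    unfolding abs_cont_deriv_eq[OF b t] ab by (simp add: L1_norm_cnj)
  show "norm (b x) \<le> 2 * L1_norm w" by (rule *[OF x])
  have "norm (a x - 1) \<le> (2 * L1_norm w) * L1_norm w"
    using norm_integral_mult_le[OF w(1) abs_cont_deriv_continuous[OF b] * x]
    unfolding abs_cont_deriv_eq[OF a x] ab by simp
  then show "norm (a x - 1) \<le> 2 * (L1_norm w)\<^sup>2" by (simp add: power2_eq_square)
qed

text \<open>The difference of two solutions solves the first system with sources of the size of \<open>w - w'\<close>.\<close>

lemma dirac_lipschitz:
  assumes w: "w absolutely_integrable_on {0..1}" "L1_norm w \<le> 1/2"
    and ab: "dirac_solution w a b" "a 0 = 1" "b 0 = 0"
    and w': "w' absolutely_integrable_on {0..1}" "L1_norm w' \<le> 1/2"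
    and ab': "dirac_solution w' a' b'" "a' 0 = 1" "b' 0 = 0"
    and x: "x \<in> {0..1}"
  shows "norm (a x - a' x) + norm (b x - b' x) \<le> 8 * L1_norm (\<lambda>t. w t - w' t)"
proof -
  define f where "f = (\<lambda>x. (w x - w' x) * b' x)"
  define g where "g = (\<lambda>x. cnj (w x - w' x) * a' x)"
  have a: "abs_cont_deriv a (\<lambda>x. w x * b x)" and b: "abs_cont_deriv b (\<lambda>x. cnj (w x) * a x)"
    using ab(1) by (auto simp: dirac_solution_def)
  have a': "abs_cont_deriv a' (\<lambda>x. w' x * b' x)" and b': "abs_cont_deriv b' (\<lambda>x. cnj (w' x) * a' x)"
    using ab'(1) by (auto simp: dirac_solution_def)
  have bd: "norm (a' t) \<le> 2" "norm (b' t) \<le> 2" if "t \<in> {0..1}" for t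
    using order_trans[OF _ dirac_bound[OF w' ab'(1) that], of "norm (a' t)"]
      order_trans[OF _ dirac_bound[OF w' ab'(1) that], of "norm (b' t)"] by (simp_all add: ab')
  have dw: "(\<lambda>t. w t - w' t) absolutely_integrable_on {0..1}"
    using w(1) w'(1) by (rule set_integral_diff)
  have f: "f absolutely_integrable_on {0..1}"
    unfolding f_def using dw abs_cont_deriv_continuous[OF b'] by (rule absolutely_integrable_mult_continuous)
  have g: "g absolutely_integrable_on {0..1}"
    unfolding g_def using absolutely_integrable_cnj[OF dw] abs_cont_deriv_continuous[OF a']
    by (rule absolutely_integrable_mult_continuous)
  have L1_le: "L1_norm h \<le> 2 * L1_norm (\<lambda>t. w t - w' t)"
    if h: "h absolutely_integrable_on {0..1}" and "\<And>t. t \<in> {0..1} \<Longrightarrow> norm (h t) \<le> 2 * norm (w t - w' t)" for h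
  proof -
    have "L1_norm h \<le> integral {0..1} (\<lambda>t. 2 * norm (w t - w' t))"
      unfolding L1_norm_def
      by (rule hk_integral_le)
        (use that dw in \<open>auto simp: absolutely_integrable_on_def intro: integrable_on_mult_right\<close>)
    then show ?thesis by (simp add: L1_norm_def)
  qed
  have fb: "norm (f t) \<le> 2 * norm (w t - w' t)" if "t \<in> {0..1}" for t
    using mult_left_mono[OF bd(2)[OF that] norm_ge_zero[of "w t - w' t"]] by (simp add: f_def norm_mult)
  have gb: "norm (g t) \<le> 2 * norm (w t - w' t)" if "t \<in> {0..1}" for t
    using mult_left_mono[OF bd(1)[OF that] norm_ge_zero[of "w t - w' t"]]
    by (simp add: g_def norm_mult flip: complex_cnj_diff)
  have da: "abs_cont_deriv (\<lambda>x. a x - a' x) (\<lambda>x. w x * (b x - b' x) + f x)"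
    using abs_cont_deriv_add[OF a abs_cont_deriv_cmult[OF a', of "-1"]]
    by (rule abs_cont_deriv_cong) (auto simp: f_def algebra_simps)
  have db: "abs_cont_deriv (\<lambda>x. b x - b' x) (\<lambda>x. cnj (w x) * (a x - a' x) + g x)"
    using abs_cont_deriv_add[OF b abs_cont_deriv_cmult[OF b', of "-1"]]
    by (rule abs_cont_deriv_cong) (auto simp: g_def algebra_simps)
  have "norm (a x - a' x) + norm (b x - b' x) \<le> 2 * (L1_norm f + L1_norm g)"
    using dirac_perturbed_bound[OF w f g da db x] ab ab' by simp
  also have "\<dots> \<le> 8 * L1_norm (\<lambda>t. w t - w' t)"
    using L1_le[OF f fb] L1_le[OF g gb] by simp
  finally show ?thesis .
qed

section \<open>Hill's equation in amplitude form\<close>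

text \<open>The potential after subtraction of its mean.  Then the primitive \<open>Q\<close> vanishes at both ends, and the
  phase below takes the same values at \<open>0\<close> and \<open>1\<close> as without potential.\<close>

locale mean_zero_potential =
  fixes q :: "real \<Rightarrow> real"
  assumes q_ai: "q absolutely_integrable_on {0..1}"
    and q_mean: "integral {0..1} q = 0"
begin

definition Q :: "real \<Rightarrow> real" where "Q x = integral {0..x} q"

definition K :: real where "K = L1_norm (\<lambda>t. of_real (q t))"

text \<open>The exponent of the WKB approximation.  The correction by \<open>Q\<close> removes the diagonal terms from the system
  for the amplitudes, so that what remains oscillates.\<close>

definition phase :: "real \<Rightarrow> real \<Rightarrow> complex" where
  "phase k x = \<i> * of_real (k * x - Q x / (2 * k))"

definition coupling :: "real \<Rightarrow> real \<Rightarrow> complex" where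
  "coupling k x = - (\<i> / of_real (2 * k)) * (of_real (q x) * exp (- 2 * phase k x))"

text \<open>Used for positive \<open>k \<ge> K\<close>, when \<open>coupling k\<close> has mass at most \<open>1/2\<close> and the solution exists.\<close>

definition dirac_pair :: "real \<Rightarrow> (real \<Rightarrow> complex) \<times> (real \<Rightarrow> complex)" where
  "dirac_pair k = (SOME ab. dirac_solution (coupling k) (fst ab) (snd ab) \<and> fst ab 0 = 1 \<and> snd ab 0 = 0)"

definition A :: "real \<Rightarrow> real \<Rightarrow> complex" where "A k = fst (dirac_pair k)"
definition B :: "real \<Rightarrow> real \<Rightarrow> complex" where "B k = snd (dirac_pair k)"

lemma qc_ai: "(\<lambda>t. complex_of_real (q t)) absolutely_integrable_on {0..1}"
  using q_ai by (rule absolutely_integrable_of_real)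

lemma K_nonneg: "0 \<le> K" unfolding K_def by (rule L1_norm_nonneg)

lemma Q_0 [simp]: "Q 0 = 0" and Q_1 [simp]: "Q 1 = 0"
  by (simp_all add: Q_def q_mean)

lemma q_int: "x \<in> {0..1} \<Longrightarrow> q integrable_on {0..x}"
  using absolutely_integrable_on_unit_subinterval[OF q_ai, of 0 x] by (auto simp: absolutely_integrable_on_def)

lemma abs_cont_Q: "abs_cont_deriv (\<lambda>x. of_real (Q x)) (\<lambda>x. of_real (q x))"
proof (rule abs_cont_derivI[OF qc_ai])
  fix x :: real assume x: "x \<in> {0..1}"
  have "((\<lambda>x. complex_of_real (q x)) has_integral of_real (integral {0..x} q)) {0..x}"
    using has_integral_linear[OF integrable_integral[OF q_int[OF x]] bounded_linear_of_real] by (simp add: o_def)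
  then have "integral {0..x} (\<lambda>x. complex_of_real (q x)) = of_real (Q x)"
    unfolding Q_def by (rule integral_unique)
  then show "complex_of_real (Q x) = of_real (Q 0) + integral {0..x} (\<lambda>x. of_real (q x))" by simp
qed

lemma continuous_on_Q: "continuous_on {0..1} Q"
  unfolding Q_def[abs_def] using q_int[of 1] by (intro indefinite_integral_continuous_1) auto

lemma abs_Q_le:
  assumes "x \<in> {0..1}" shows "\<bar>Q x\<bar> \<le> K"
proof -
  have "\<bar>Q x\<bar> = norm (integral {0..x} (\<lambda>x. complex_of_real (q x)))"
    using abs_cont_deriv_eq[OF abs_cont_Q assms] by (metis Q_0 add_0 norm_of_real of_real_0)
  also have "\<dots> \<le> 1 * K"
    unfolding K_def using norm_integral_le_L1[OF qc_ai qc_ai, of 0 x 1] assms by auto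
  finally show ?thesis by simp
qed

lemma abs_cont_phase: "abs_cont_deriv (phase k) (\<lambda>x. \<i> * (of_real k - of_real (q x) / of_real (2 * k)))"
proof -
  have id: "abs_cont_deriv (\<lambda>x. complex_of_real x) (\<lambda>x. 1)"
    by (rule abs_cont_deriv_C1) (auto intro!: derivative_eq_intros)
  have "abs_cont_deriv (\<lambda>x. (\<i> * of_real k) * of_real x + (- \<i> / of_real (2 * k)) * of_real (Q x))
    (\<lambda>x. (\<i> * of_real k) * 1 + (- \<i> / of_real (2 * k)) * of_real (q x))"
    by (intro abs_cont_deriv_add abs_cont_deriv_cmult abs_cont_Q id)
  then show ?thesis
    by (rule abs_cont_deriv_cong) (auto simp: phase_def algebra_simps)
qed

lemma phase_0 [simp]: "phase k 0 = 0" and phase_1 [simp]: "phase k 1 = \<i> * of_real k"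
  by (simp_all add: phase_def)

lemma Re_phase [simp]: "Re (phase k x) = 0"
  by (simp add: phase_def)

lemma continuous_on_phase: "continuous_on {0..1} (phase k)"
  using abs_cont_phase by (rule abs_cont_deriv_continuous)

lemma coupling_ai: "coupling k absolutely_integrable_on {0..1}"
proof -
  have "(\<lambda>x. of_real (q x) * (- (\<i> / of_real (2 * k)) * exp (- 2 * phase k x))) absolutely_integrable_on {0..1}"
    by (intro absolutely_integrable_mult_continuous[OF qc_ai] continuous_intros continuous_on_phase)
  then show ?thesis unfolding coupling_def[abs_def] by (simp add: mult_ac)
qed

lemma norm_coupling: "0 < k \<Longrightarrow> norm (coupling k x) = \<bar>q x\<bar> / (2 * k)"
  by (simp add: coupling_def norm_mult norm_divide)

lemma L1_norm_coupling: "0 < k \<Longrightarrow> L1_norm (coupling k) = K / (2 * k)"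
  by (simp add: L1_norm_def K_def norm_coupling)

lemma L1_norm_coupling_le: "0 < k \<Longrightarrow> K \<le> k \<Longrightarrow> L1_norm (coupling k) \<le> 1/2"
  by (simp add: L1_norm_coupling field_simps)

lemma cnj_coupling: "cnj (coupling k x) = (\<i> / of_real (2 * k)) * (of_real (q x) * exp (2 * phase k x))"
proof -
  have "cnj (phase k x) = - phase k x" by (simp add: phase_def)
  then show ?thesis by (simp add: coupling_def exp_cnj)
qed

lemma AB:
  assumes "0 < k" "K \<le> k"
  shows "dirac_solution (coupling k) (A k) (B k)" "A k 0 = 1" "B k 0 = 0"
proof -
  have "\<exists>ab. dirac_solution (coupling k) (fst ab) (snd ab) \<and> fst ab 0 = 1 \<and> snd ab 0 = 0"
    using dirac_solution_exists[OF coupling_ai L1_norm_coupling_le[OF assms]] by auto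
  from someI_ex[OF this]
  show "dirac_solution (coupling k) (A k) (B k)" "A k 0 = 1" "B k 0 = 0"
    unfolding A_def B_def dirac_pair_def by blast+
qed

text \<open>The solution of \<open>-y'' + q y = k\<^sup>2 y\<close> with initial amplitudes \<open>u\<close> and \<open>v\<close>; below, \<open>Y'\<close> is its derivative.
  Outside of \<open>[0, 1]\<close> it is \<open>0\<close> like the members of \<open>eigenspace\<close>.\<close>

definition Y :: "real \<Rightarrow> complex \<Rightarrow> complex \<Rightarrow> real \<Rightarrow> complex" where
  "Y k u v x = (if x \<in> {0..1} then
     exp (phase k x) * (u * A k x + v * cnj (B k x)) + exp (- phase k x) * (u * B k x + v * cnj (A k x))
     else 0)"

definition Y' :: "real \<Rightarrow> complex \<Rightarrow> complex \<Rightarrow> real \<Rightarrow> complex" where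
  "Y' k u v x = \<i> * of_real k * (exp (phase k x) * (u * A k x + v * cnj (B k x))
     - exp (- phase k x) * (u * B k x + v * cnj (A k x)))"

text \<open>Since \<open>y\<close> and \<open>y'\<close> are \<open>e\<^sup>\<phi> a \<plusminus> e\<^sup>-\<^sup>\<phi> b\<close> up to constant factors, the two boundary conditions hold iff
  \<open>e\<^sup>\<phi> a\<close> and \<open>e\<^sup>-\<^sup>\<phi> b\<close> separately are multiplied by \<open>s\<close> from \<open>1\<close> to \<open>0\<close>.\<close>

definition boundary :: "complex \<Rightarrow> real \<Rightarrow> complex \<Rightarrow> complex \<Rightarrow> bool" where
  "boundary s k u v \<longleftrightarrow>
     u = s * (exp (\<i> * of_real k) * (u * A k 1 + v * cnj (B k 1))) \<and>
     v = s * (exp (- (\<i> * of_real k)) * (u * B k 1 + v * cnj (A k 1)))"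

text \<open>Variation of constants: the amplitudes of \<open>y\<close> are \<open>e\<^sup>-\<^sup>\<phi> (y + y' / (i k)) / 2\<close> and
  \<open>e\<^sup>\<phi> (y - y' / (i k)) / 2\<close>.  The phase is chosen such that the differential equation for \<open>y\<close> becomes the Dirac
  system for them.\<close>

lemma eigenfunction_imp_Y:
  assumes k: "0 < k" "K \<le> k" and y: "y \<in> eigenspace s q (k\<^sup>2)"
  shows "\<exists>u v. y = Y k u v \<and> boundary s k u v"
proof -
  from y obtain y' y'' where y0: "\<And>x. x \<notin> {0..1} \<Longrightarrow> y x = 0"
    and dy: "\<And>x. x \<in> {0..1} \<Longrightarrow> (y has_vector_derivative y' x) (at x within {0..1})"
    and dy': "abs_cont_deriv y' y''"
    and ae: "AE x in lebesgue. x \<in> {0..1} \<longrightarrow> - y'' x + of_real (q x) * y x = of_real (k\<^sup>2) * y x"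
    and bc: "y 0 = s * y 1" "y' 0 = s * y' 1"
    unfolding eigenspace_def by blast
  define r where "r = 1 / complex_of_real k"
  have kr: "complex_of_real k * r = 1" using k by (simp add: r_def)
  have acy': "abs_cont_deriv y' (\<lambda>x. (of_real (q x) - of_real (k\<^sup>2)) * y x)"
    by (rule abs_cont_deriv_spike[OF dy']) (use ae in \<open>auto elim!: eventually_mono simp: algebra_simps\<close>)
  have acy: "abs_cont_deriv y y'"
    using dy abs_cont_deriv_continuous[OF dy'] by (rule abs_cont_deriv_C1)
  define u where "u = (\<lambda>x. exp ((-1) * phase k x) * ((1/2) * (y x + (- \<i> * r) * y' x)))"
  define v where "v = (\<lambda>x. exp (phase k x) * ((1/2) * (y x + (\<i> * r) * y' x)))"
  have ph: "\<i> * (of_real k - of_real (q x) / of_real (2 * k)) = \<i> * (of_real k - of_real (q x) * r / 2)" for x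
    by (simp add: r_def)
  note acph = abs_cont_phase[of k, unfolded ph]
  have e: "exp (- 2 * phase k x) * exp (phase k x) = exp ((-1) * phase k x)"
    "exp (2 * phase k x) * exp ((-1) * phase k x) = exp (phase k x)" for x
    by (simp_all flip: exp_add)
  have wc: "coupling k x = - (\<i> * r / 2) * (of_real (q x) * exp (- 2 * phase k x))"
    "cnj (coupling k x) = (\<i> * r / 2) * (of_real (q x) * exp (2 * phase k x))" for x
    unfolding cnj_coupling unfolding coupling_def by (simp_all add: r_def)
  have "abs_cont_deriv u (\<lambda>x. ((-1) * (\<i> * (of_real k - of_real (q x) * r / 2))) * exp ((-1) * phase k x)
        * ((1/2) * (y x + (- \<i> * r) * y' x)) + exp ((-1) * phase k x) *
        ((1/2) * (y' x + (- \<i> * r) * ((of_real (q x) - of_real (k\<^sup>2)) * y x))))"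
    unfolding u_def
    by (intro abs_cont_deriv_mult abs_cont_deriv_exp abs_cont_deriv_cmult abs_cont_deriv_add acph acy acy')
  then have du: "abs_cont_deriv u (\<lambda>x. coupling k x * v x)"
  proof (rule abs_cont_deriv_cong)
    fix x
    have *: "((-1) * (\<i> * (c - qq * r / 2))) * E * ((1/2) * (a + (- \<i> * r) * b))
       + E * ((1/2) * (b + (- \<i> * r) * ((qq - c\<^sup>2) * a))) 
       = - (\<i> * r / 2) * qq * E * ((1/2) * (a + (\<i> * r) * b))" if "c * r = 1" for c qq E a b :: complex
      using that i_squared by algebra
    have cv: "coupling k x * v x = - (\<i> * r / 2) * of_real (q x) * (exp (- 2 * phase k x) * exp (phase k x)) * ((1/2) * (y x + (\<i> * r) * y' x))"
      by (simp add: wc v_def)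
    then show "((-1) * (\<i> * (of_real k - of_real (q x) * r / 2))) * exp ((-1) * phase k x)
        * ((1/2) * (y x + (- \<i> * r) * y' x)) + exp ((-1) * phase k x) *
        ((1/2) * (y' x + (- \<i> * r) * ((of_real (q x) - of_real (k\<^sup>2)) * y x))) = coupling k x * v x"
      unfolding of_real_power *[OF kr] cv e by simp
  qed simp
  have "abs_cont_deriv v (\<lambda>x. (\<i> * (of_real k - of_real (q x) * r / 2)) * exp (phase k x)
        * ((1/2) * (y x + (\<i> * r) * y' x)) + exp (phase k x) *
        ((1/2) * (y' x + (\<i> * r) * ((of_real (q x) - of_real (k\<^sup>2)) * y x))))"
    unfolding v_def
    by (intro abs_cont_deriv_mult abs_cont_deriv_exp abs_cont_deriv_cmult abs_cont_deriv_add acph acy acy')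
  then have dv: "abs_cont_deriv v (\<lambda>x. cnj (coupling k x) * u x)"
  proof (rule abs_cont_deriv_cong)
    fix x
    have *: "(\<i> * (c - qq * r / 2)) * E * ((1/2) * (a + (\<i> * r) * b))
       + E * ((1/2) * (b + (\<i> * r) * ((qq - c\<^sup>2) * a))) 
       = (\<i> * r / 2) * qq * E * ((1/2) * (a + (- \<i> * r) * b))" if "c * r = 1" for c qq E a b :: complex
      using that by (simp add: algebra_simps power2_eq_square)
    have cu: "cnj (coupling k x) * u x = (\<i> * r / 2) * of_real (q x) * (exp (2 * phase k x) * exp ((-1) * phase k x)) * ((1/2) * (y x + (- \<i> * r) * y' x))"
      unfolding u_def by (subst wc(2)) simp
    then show "(\<i> * (of_real k - of_real (q x) * r / 2)) * exp (phase k x)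
        * ((1/2) * (y x + (\<i> * r) * y' x)) + exp (phase k x) *
        ((1/2) * (y' x + (\<i> * r) * ((of_real (q x) - of_real (k\<^sup>2)) * y x))) = cnj (coupling k x) * u x"
      unfolding of_real_power *[OF kr] cu e by simp
  qed simp
  have ds: "dirac_solution (coupling k) u v" using du dv by (simp add: dirac_solution_def)
  note rep = dirac_representation[OF coupling_ai L1_norm_coupling_le[OF k] AB[OF k] ds]
  have yuv: "y x = exp (phase k x) * u x + exp (- phase k x) * v x" for x
  proof -
    have 1: "exp (phase k x) * exp ((-1) * phase k x) = 1" "exp (- phase k x) * exp (phase k x) = 1"
      by (simp_all add: exp_minus)
    show ?thesis
      unfolding u_def v_def mult.assoc[symmetric, of "exp (phase k x)"] mult.assoc[symmetric, of "exp (- phase k x)"] 1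
      by (simp add: field_simps)
  qed
  have "y = Y k (u 0) (v 0)"
  proof
    fix x show "y x = Y k (u 0) (v 0) x"
      using y0[of x] yuv[of x] rep[of x] by (cases "x \<in> {0..1}") (auto simp: Y_def)
  qed
  moreover have "boundary s k (u 0) (v 0)"
  proof -
    have 1: "exp (\<i> * of_real k) * exp ((-1) * phase k 1) = 1" "exp (- (\<i> * of_real k)) * exp (phase k 1) = 1"
      by (simp_all add: exp_minus)
    have E: "exp (\<i> * of_real k) * u 1 = (1/2) * (y 1 + (- \<i> * r) * y' 1)"
      "exp (- (\<i> * of_real k)) * v 1 = (1/2) * (y 1 + (\<i> * r) * y' 1)"
      unfolding u_def v_def mult.assoc[symmetric, of "exp (\<i> * of_real k)"]
        mult.assoc[symmetric, of "exp (- (\<i> * of_real k))"] 1 by simp_all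
    have z: "u 0 = (1/2) * (y 0 + (- \<i> * r) * y' 0)" "v 0 = (1/2) * (y 0 + (\<i> * r) * y' 0)"
      by (simp_all add: u_def v_def)
    have "u 0 = s * (exp (\<i> * of_real k) * u 1)" "v 0 = s * (exp (- (\<i> * of_real k)) * v 1)"
      unfolding E z bc by (simp_all add: algebra_simps)
    moreover have "u 1 = u 0 * A k 1 + v 0 * cnj (B k 1)" "v 1 = u 0 * B k 1 + v 0 * cnj (A k 1)"
      by (rule rep; simp)+
    ultimately show ?thesis
      unfolding boundary_def by metis
  qed
  ultimately show ?thesis by blast
qed

text \<open>The same computation backwards: in the derivative of \<open>Y\<close> all terms with \<open>q\<close> cancel, which makes \<open>Y\<close>
  continuously differentiable although its amplitudes are only absolutely continuous.\<close>

lemma Y_derivative: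
  assumes k: "0 < k" "K \<le> k"
  shows "x \<in> {0..1} \<Longrightarrow> (Y k u v has_vector_derivative Y' k u v x) (at x within {0..1})"
    and "abs_cont_deriv (Y' k u v) (\<lambda>x. (of_real (q x) - of_real (k\<^sup>2)) * Y k u v x)"
proof -
  define U where "U = (\<lambda>x. u * A k x + v * cnj (B k x))"
  define V where "V = (\<lambda>x. u * B k x + v * cnj (A k x))"
  have "dirac_solution (coupling k) U V"
    unfolding U_def V_def by (intro dirac_linear dirac_conjugate AB k)
  then have dU: "abs_cont_deriv U (\<lambda>x. coupling k x * V x)" and dV: "abs_cont_deriv V (\<lambda>x. cnj (coupling k x) * U x)"
    by (auto simp: dirac_solution_def)
  define r where "r = 1 / complex_of_real k"
  have kr: "complex_of_real k * r = 1" using k by (simp add: r_def)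
  have ph: "\<i> * (of_real k - of_real (q x) / of_real (2 * k)) = \<i> * (of_real k - of_real (q x) * r / 2)" for x
    by (simp add: r_def)
  note acph = abs_cont_phase[of k, unfolded ph]
  have wc: "coupling k x = - (\<i> * r / 2) * (of_real (q x) * exp (- 2 * phase k x))"
    "cnj (coupling k x) = (\<i> * r / 2) * (of_real (q x) * exp (2 * phase k x))" for x
    unfolding cnj_coupling unfolding coupling_def by (simp_all add: r_def)
  have e: "exp (phase k x) * coupling k x = - (\<i> * r / 2) * of_real (q x) * exp ((-1) * phase k x)"
    "exp ((-1) * phase k x) * cnj (coupling k x) = (\<i> * r / 2) * of_real (q x) * exp (phase k x)" for x
    by (simp add: wc(1) mult_ac flip: exp_add, subst wc(2), simp add: mult_ac flip: exp_add)
  have d1: "abs_cont_deriv (\<lambda>x. exp (phase k x) * U x)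
    (\<lambda>x. (\<i> * (of_real k - of_real (q x) * r / 2)) * exp (phase k x) * U x + exp (phase k x) * (coupling k x * V x))"
    by (intro abs_cont_deriv_mult abs_cont_deriv_exp acph dU)
  have d2: "abs_cont_deriv (\<lambda>x. exp ((-1) * phase k x) * V x)
    (\<lambda>x. ((-1) * (\<i> * (of_real k - of_real (q x) * r / 2))) * exp ((-1) * phase k x) * V x + exp ((-1) * phase k x) * (cnj (coupling k x) * U x))"
    by (intro abs_cont_deriv_mult abs_cont_deriv_exp abs_cont_deriv_cmult acph dV)
  have Y'_eq: "Y' k u v x = \<i> * of_real k * (exp (phase k x) * U x + (-1) * (exp ((-1) * phase k x) * V x))" for x
    by (simp add: Y'_def U_def V_def)
  have Y_eq: "Y k u v x = exp (phase k x) * U x + exp ((-1) * phase k x) * V x" if "x \<in> {0..1}" for x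
    using that by (simp add: Y_def U_def V_def)
  have ac: "abs_cont_deriv (\<lambda>x. exp (phase k x) * U x + exp ((-1) * phase k x) * V x) (Y' k u v)"
  proof (rule abs_cont_deriv_cong[OF abs_cont_deriv_add[OF d1 d2]])
    fix x
    have *: "(\<i> * (c - qq * r / 2)) * E * a + (- (\<i> * r / 2) * qq * F) * b
        + (((-1) * (\<i> * (c - qq * r / 2))) * F * b + ((\<i> * r / 2) * qq * E) * a)
        = \<i> * c * (E * a + (-1) * (F * b))" for c qq E F a b :: complex
      by (simp add: algebra_simps)
    show "(\<i> * (of_real k - of_real (q x) * r / 2)) * exp (phase k x) * U x + exp (phase k x) * (coupling k x * V x)
       + (((-1) * (\<i> * (of_real k - of_real (q x) * r / 2))) * exp ((-1) * phase k x) * V x + exp ((-1) * phase k x) * (cnj (coupling k x) * U x)) = Y' k u v x"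
      unfolding Y'_eq mult.assoc[symmetric, of "exp (phase k x)" "coupling k x"]
        mult.assoc[symmetric, of "exp ((-1) * phase k x)" "cnj (coupling k x)"] e by (rule *)
  qed simp
  show ac': "abs_cont_deriv (Y' k u v) (\<lambda>x. (of_real (q x) - of_real (k\<^sup>2)) * Y k u v x)"
  proof (rule abs_cont_deriv_cong[OF abs_cont_deriv_cmult[where c = "\<i> * of_real k", OF abs_cont_deriv_add[OF d1 abs_cont_deriv_cmult[where c = "-1", OF d2]]]])
    fix x :: real assume x: "x \<in> {0..1}"
    have *: "\<i> * c * ((\<i> * (c - qq * r / 2)) * E * a + (- (\<i> * r / 2) * qq * F) * b
        + (-1) * (((-1) * (\<i> * (c - qq * r / 2))) * F * b + ((\<i> * r / 2) * qq * E) * a))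
        = (qq - c\<^sup>2) * (E * a + F * b)" if "c * r = 1" for c qq E F a b :: complex
      using that by (simp add: algebra_simps power2_eq_square)
    show "\<i> * of_real k * ((\<i> * (of_real k - of_real (q x) * r / 2)) * exp (phase k x) * U x + exp (phase k x) * (coupling k x * V x)
       + (-1) * (((-1) * (\<i> * (of_real k - of_real (q x) * r / 2))) * exp ((-1) * phase k x) * V x + exp ((-1) * phase k x) * (cnj (coupling k x) * U x))) 
       = (of_real (q x) - of_real (k\<^sup>2)) * Y k u v x"
      unfolding Y_eq[OF x] of_real_power mult.assoc[symmetric, of "exp (phase k x)" "coupling k x"]
        mult.assoc[symmetric, of "exp ((-1) * phase k x)" "cnj (coupling k x)"] e by (rule *[OF kr])
  qed (simp add: Y'_eq)
  show "(Y k u v has_vector_derivative Y' k u v x) (at x within {0..1})" if "x \<in> {0..1}"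
    by (rule has_vector_derivative_transform[OF that Y_eq
        abs_cont_deriv_imp_has_vector_derivative[OF ac abs_cont_deriv_continuous[OF ac'] that]])
qed

lemma AB_0 [simp]: "0 < k \<Longrightarrow> K \<le> k \<Longrightarrow> A k 0 = 1" "0 < k \<Longrightarrow> K \<le> k \<Longrightarrow> B k 0 = 0"
  using AB(2,3) by auto

lemma Y_in_eigenspace:
  assumes k: "0 < k" "K \<le> k" and s: "s * s = 1" and bc: "boundary s k u v"
  shows "Y k u v \<in> eigenspace s q (k\<^sup>2)"
proof -
  have d: "(Y k u v has_vector_derivative Y' k u v x) (at x within {0..1})" if "x \<in> {0..1}" for x
    by (rule Y_derivative(1)[OF k that])
  have d': "abs_cont_deriv (Y' k u v) (\<lambda>x. (of_real (q x) - of_real (k\<^sup>2)) * Y k u v x)"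
    by (rule Y_derivative(2)[OF k])
  define X1 X2 where X: "X1 = exp (\<i> * of_real k) * (u * A k 1 + v * cnj (B k 1))"
    "X2 = exp (- (\<i> * of_real k)) * (u * B k 1 + v * cnj (A k 1))"
  have bc': "u = s * X1" "v = s * X2"
    using bc unfolding boundary_def X by blast+
  have Y0: "Y k u v 0 = u + v" "Y' k u v 0 = \<i> * of_real k * (u - v)"
    using k by (simp_all add: Y_def Y'_def)
  have "Y k u v 1 = X1 + X2" "Y' k u v 1 = \<i> * of_real k * (X1 - X2)"
    by (simp_all add: Y_def Y'_def X)
  moreover have "u + v = s * (X1 + X2)" "u - v = s * (X1 - X2)"
    using bc' by (metis distrib_left right_diff_distrib)+
  ultimately have Y1: "Y k u v 0 = s * Y k u v 1" "Y' k u v 0 = s * Y' k u v 1"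
    unfolding Y0 by simp_all
  have "AE x in lebesgue. x \<in> {0..1} \<longrightarrow> - ((of_real (q x) - of_real (k\<^sup>2)) * Y k u v x)
      + of_real (q x) * Y k u v x = of_real (k\<^sup>2) * Y k u v x"
    by (simp add: algebra_simps)
  moreover have "\<forall>x. x \<notin> {0..1} \<longrightarrow> Y k u v x = 0" by (simp add: Y_def)
  ultimately show ?thesis
    using d d' Y1 unfolding eigenspace_def by blast
qed

lemma Y_eq_0D:
  assumes k: "0 < k" "K \<le> k" and z: "\<And>x. Y k u v x = 0"
  shows "u = 0" "v = 0"
proof -
  have "(Y k u v has_vector_derivative Y' k u v 0) (at 0 within {0..1})"
    by (rule Y_derivative[OF k]) simp
  moreover have "Y k u v = (\<lambda>x. 0)" using z by auto
  then have "(Y k u v has_vector_derivative 0) (at 0 within {0..1})" by simp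
  ultimately have "Y' k u v 0 = 0"
    by (intro vector_derivative_unique_within_closed_interval[of 0 1 0 "Y k u v"]) (auto simp: cbox_interval)
  then have "u = v" using k by (simp add: Y'_def)
  moreover have "u + v = 0" using z[of 0] k by (simp add: Y_def)
  ultimately show "u = 0" "v = 0" by auto
qed

section \<open>Eigenvalues and the multiplier\<close>

text \<open>The diagonal entry of the monodromy matrix in the amplitude basis, times \<open>s\<close>.  Twice its real part
  is \<open>s\<close> times Hill's discriminant.\<close>

definition multiplier :: "complex \<Rightarrow> real \<Rightarrow> complex" where
  "multiplier s k = s * (exp (\<i> * of_real k) * A k 1)"

lemma norm_A_sq:
  assumes k: "0 < k" "K \<le> k" and "x \<in> {0..1}"
  shows "(norm (A k x))\<^sup>2 = 1 + (norm (B k x))\<^sup>2"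
  using dirac_norm_conservation[OF AB(1)[OF k] assms(3)] k by simp

lemma sign_cases: "s = 1 \<or> s = -1 \<Longrightarrow> s * s = 1" "s = 1 \<or> s = -1 \<Longrightarrow> cnj s = s"
  "s = 1 \<or> s = -1 \<Longrightarrow> norm s = 1" for s :: complex
  by auto

lemma norm_multiplier_sq:
  assumes k: "0 < k" "K \<le> k" and s: "s = 1 \<or> s = -1"
  shows "(norm (multiplier s k))\<^sup>2 = 1 + (norm (B k 1))\<^sup>2"
  using norm_A_sq[OF k, of 1] sign_cases(3)[OF s] by (simp add: multiplier_def norm_mult)

lemma norm_one_minus_multiplier_sq:
  assumes k: "0 < k" "K \<le> k" and s: "s = 1 \<or> s = -1"
  shows "(norm (1 - multiplier s k))\<^sup>2 = 2 - 2 * Re (multiplier s k) + (norm (B k 1))\<^sup>2"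
proof -
  have "(norm (1 - z))\<^sup>2 = 1 - 2 * Re z + (norm z)\<^sup>2" for z
    unfolding cmod_power2 by (simp add: power2_eq_square algebra_simps)
  then show ?thesis using norm_multiplier_sq[OF assms] by simp
qed

lemma boundary_iff:
  assumes s: "s = 1 \<or> s = -1"
  shows "boundary s k u v \<longleftrightarrow>
     u * (1 - multiplier s k) = (s * exp (\<i> * of_real k) * cnj (B k 1)) * v \<and>
     v * (1 - cnj (multiplier s k)) = cnj (s * exp (\<i> * of_real k) * cnj (B k 1)) * u"
proof -
  have "cnj (exp (\<i> * of_real k)) = exp (- (\<i> * of_real k))" by (simp add: exp_cnj)
  then show ?thesis
    unfolding boundary_def multiplier_def using sign_cases(2)[OF s] by (auto simp: algebra_simps)
qed

text \<open>For \<open>P = multiplier s k\<close> the boundary condition is a homogeneous linear system for \<open>u\<close> and \<open>v\<close> with determinant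
  \<open>\<bar>1 - P\<bar>\<^sup>2 - \<bar>R\<bar>\<^sup>2\<close>, where \<open>\<bar>R\<bar> = \<bar>B(1)\<bar>\<close>.  By the conservation law this is \<open>2 - 2 Re P\<close>.\<close>

lemma boundary_nontrivial_iff:
  assumes k: "0 < k" "K \<le> k" and s: "s = 1 \<or> s = -1"
  shows "(\<exists>u v. (u \<noteq> 0 \<or> v \<noteq> 0) \<and> boundary s k u v) \<longleftrightarrow> Re (multiplier s k) = 1"
proof
  define P where "P = multiplier s k"
  define R where "R = s * exp (\<i> * of_real k) * cnj (B k 1)"
  have R: "norm R = norm (B k 1)" using sign_cases(3)[OF s] by (simp add: R_def norm_mult)
  have RR: "R * cnj R = of_real ((norm (B k 1))\<^sup>2)" unfolding R[symmetric] by (simp only: complex_norm_square)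
  have PP: "(1 - P) * (1 - cnj P) = of_real ((norm (1 - P))\<^sup>2)"
    by (simp only: complex_norm_square complex_cnj_diff complex_cnj_one)
  note n = norm_one_minus_multiplier_sq[OF k s, folded P_def]
  {
    assume "\<exists>u v. (u \<noteq> 0 \<or> v \<noteq> 0) \<and> boundary s k u v"
    then obtain u v where uv: "u \<noteq> 0 \<or> v \<noteq> 0" and "u * (1 - P) = R * v" "v * (1 - cnj P) = cnj R * u"
      unfolding boundary_iff[OF s] P_def R_def by blast
    then have "u * ((1 - P) * (1 - cnj P)) = u * (R * cnj R)" "v * ((1 - P) * (1 - cnj P)) = v * (R * cnj R)"
      by algebra+
    with uv have "(1 - P) * (1 - cnj P) = R * cnj R" by auto
    then have "(norm (1 - P))\<^sup>2 = (norm (B k 1))\<^sup>2" unfolding RR PP by (metis of_real_eq_iff)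
    with n show "Re (multiplier s k) = 1" unfolding P_def by simp
  next
    assume "Re (multiplier s k) = 1"
    then have nP: "(norm (1 - P))\<^sup>2 = (norm (B k 1))\<^sup>2" using n unfolding P_def by simp
    have eq: "(1 - P) * (1 - cnj P) = R * cnj R" unfolding RR PP nP ..
    show "\<exists>u v. (u \<noteq> 0 \<or> v \<noteq> 0) \<and> boundary s k u v"
    proof (cases "B k 1 = 0")
      case True
      then have "P = 1" "R = 0" using nP R by auto
      then have "boundary s k 1 0" unfolding boundary_iff[OF s] P_def R_def by auto
      then show ?thesis by (intro exI[of _ 1] exI[of _ 0]) simp
    next
      case False
      then have "R \<noteq> 0" using R by auto
      moreover have "boundary s k R (1 - P)"
        unfolding boundary_iff[OF s] P_def[symmetric] R_def[symmetric] using eq by (auto simp: mult.commute)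
      ultimately show ?thesis by blast
    qed
  }
qed

lemma Y_linear: "Y k (c * u) (c * v) = (\<lambda>x. c * Y k u v x)"
  "Y k u v = (\<lambda>x. u * Y k 1 0 x) + (\<lambda>x. v * Y k 0 1 x)"
  by (auto simp: Y_def fun_eq_iff algebra_simps)

lemma eigenspace_subset_span:
  assumes k: "0 < k" "K \<le> k"
  shows "eigenspace s q (k\<^sup>2) \<subseteq> cfun.span {Y k 1 0, Y k 0 1}"
proof
  fix y assume "y \<in> eigenspace s q (k\<^sup>2)"
  then obtain u v where "y = Y k u v" using eigenfunction_imp_Y[OF k] by blast
  moreover have "(\<lambda>x. u * Y k 1 0 x) + (\<lambda>x. v * Y k 0 1 x) \<in> cfun.span {Y k 1 0, Y k 0 1}"
    by (intro cfun.span_add cfun.span_scale cfun.span_base) auto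
  ultimately show "y \<in> cfun.span {Y k 1 0, Y k 0 1}" using Y_linear(2) by metis
qed

text \<open>The dimension is positive because the eigenspace is nontrivial and lies in the span of two functions;
  the latter excludes an infinite basis, for which \<open>cfun.dim\<close> would be \<open>0\<close>.\<close>

lemma dim_eigenspace_pos:
  assumes k: "0 < k" "K \<le> k" and s: "s = 1 \<or> s = -1" and "Re (multiplier s k) = 1"
  shows "1 \<le> cfun.dim (eigenspace s q (k\<^sup>2))"
proof (rule ccontr)
  assume "\<not> 1 \<le> cfun.dim (eigenspace s q (k\<^sup>2))"
  then have d0: "cfun.dim (eigenspace s q (k\<^sup>2)) = 0" by simp
  obtain S where S: "S \<subseteq> eigenspace s q (k\<^sup>2)" "cfun.independent S" "eigenspace s q (k\<^sup>2) \<subseteq> cfun.span S"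
    "card S = cfun.dim (eigenspace s q (k\<^sup>2))"
    by (rule cfun.basis_exists)
  have "finite S"
    using cfun.independent_span_bound[of "{Y k 1 0, Y k 0 1}" S] S eigenspace_subset_span[OF k, of s] by blast
  then have "S = {}" using S(4) d0 by simp
  then have zero: "y = 0" if "y \<in> eigenspace s q (k\<^sup>2)" for y using S(3) that by auto
  obtain u v where uv: "u \<noteq> 0 \<or> v \<noteq> 0" "boundary s k u v"
    using boundary_nontrivial_iff[OF k s] assms(4) by blast
  have "Y k u v = 0" by (rule zero[OF Y_in_eigenspace[OF k sign_cases(1)[OF s] uv(2)]])
  then have "Y k u v x = 0" for x by (metis zero_fun_apply)
  from Y_eq_0D[OF k this] uv(1) show False by blast
qed

lemma dim_eigenspace_posD:
  assumes k: "0 < k" "K \<le> k" and s: "s = 1 \<or> s = -1" and "1 \<le> cfun.dim (eigenspace s q (k\<^sup>2))"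
  shows "Re (multiplier s k) = 1"
proof (rule ccontr)
  assume *: "Re (multiplier s k) \<noteq> 1"
  have "eigenspace s q (k\<^sup>2) \<subseteq> cfun.span {}"
  proof
    fix y assume "y \<in> eigenspace s q (k\<^sup>2)"
    then obtain u v where uv: "y = Y k u v" "boundary s k u v" using eigenfunction_imp_Y[OF k] by blast
    then have "u = 0 \<and> v = 0" using boundary_nontrivial_iff[OF k s] * by blast
    then have "y = 0" using uv by (auto simp: Y_def fun_eq_iff)
    then show "y \<in> cfun.span {}" by simp
  qed
  then have "cfun.dim (eigenspace s q (k\<^sup>2)) \<le> card ({} :: (real \<Rightarrow> complex) set)"
    by (intro cfun.dim_le_card) auto
  with assms(4) show False by simp
qed

text \<open>If \<open>B k 1\<close> is not \<open>0\<close>, the first boundary condition determines \<open>v\<close> by \<open>u\<close>.\<close>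

lemma dim_eigenspace_ge_2D:
  assumes k: "0 < k" "K \<le> k" and s: "s = 1 \<or> s = -1" and "2 \<le> cfun.dim (eigenspace s q (k\<^sup>2))"
  shows "B k 1 = 0"
proof (rule ccontr)
  assume B: "B k 1 \<noteq> 0"
  define R where "R = s * exp (\<i> * of_real k) * cnj (B k 1)"
  have "R \<noteq> 0" using B s by (auto simp: R_def)
  define c where "c = (1 - multiplier s k) / R"
  have "eigenspace s q (k\<^sup>2) \<subseteq> cfun.span {Y k 1 c}"
  proof
    fix y assume "y \<in> eigenspace s q (k\<^sup>2)"
    then obtain u v where uv: "y = Y k u v" "boundary s k u v" using eigenfunction_imp_Y[OF k] by blast
    then have "u * (1 - multiplier s k) = R * v" unfolding boundary_iff[OF s] R_def by blast
    then have "v = u * c" using \<open>R \<noteq> 0\<close> by (simp add: c_def field_simps)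
    then have "y = (\<lambda>x. u * Y k 1 c x)" using Y_linear(1)[of k u 1 c] uv by simp
    then show "y \<in> cfun.span {Y k 1 c}" using cfun.span_scale[OF cfun.span_base, of "Y k 1 c" "{Y k 1 c}" u] by simp
  qed
  then have "cfun.dim (eigenspace s q (k\<^sup>2)) \<le> card {Y k 1 c}"
    by (intro cfun.dim_le_card) auto
  with assms(4) show False by simp
qed

end

section \<open>Existence of eigenvalues and size of the gaps\<close>

lemma norm_iexp_minus_1_le: "norm (exp (\<i> * of_real x) - 1) \<le> \<bar>x\<bar>" for x :: real
  using Taylor_exp[of "\<i> * of_real x" 0] by (simp add: norm_mult)

lemma norm_iexp_Taylor1: "norm (exp (\<i> * of_real x) - 1 - \<i> * of_real x) \<le> x\<^sup>2" for x :: real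
  using Taylor_exp[of "\<i> * of_real x" 1] by (simp add: norm_mult power2_eq_square diff_diff_eq)

lemma norm_iexp_Taylor2: "norm (exp (\<i> * of_real x) - 1 - \<i> * of_real x + of_real (x\<^sup>2) / 2) \<le> \<bar>x\<bar> ^ 3 / 2" for x :: real
proof -
  have "(\<Sum>i\<le>2. (\<i> * complex_of_real x) ^ i / fact i) = 1 + \<i> * of_real x - of_real (x\<^sup>2) / 2"
    by (simp add: eval_nat_numeral power2_eq_square algebra_simps)
  then show ?thesis
    using Taylor_exp[of "\<i> * of_real x" 2] by (simp add: norm_mult eval_nat_numeral algebra_simps)
qed

lemma norm_iexp_minus_1_ge:
  assumes "\<bar>x\<bar> \<le> 1/2"
  shows "\<bar>x\<bar> / 2 \<le> norm (exp (\<i> * of_real x) - 1)"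
proof -
  have "\<bar>x\<bar> = norm (\<i> * complex_of_real x)" by (simp add: norm_mult)
  also have "\<dots> \<le> norm (exp (\<i> * of_real x) - 1) + norm (exp (\<i> * of_real x) - 1 - \<i> * of_real x)"
    by (metis diff_diff_eq2 add.commute add_diff_cancel norm_triangle_ineq4)
  also have "\<dots> \<le> norm (exp (\<i> * of_real x) - 1) + x\<^sup>2" using norm_iexp_Taylor1 by simp
  also have "x\<^sup>2 \<le> \<bar>x\<bar> / 2"
    using mult_left_mono[OF assms, of "\<bar>x\<bar>"] by (simp add: power2_eq_square)
  finally show ?thesis by simp
qed

lemma norm_iexp_diff_le: "norm (exp (\<i> * of_real x) - exp (\<i> * of_real y)) \<le> \<bar>x - y\<bar>" for x y :: real
proof -
  have "exp (\<i> * of_real x) - exp (\<i> * of_real y) = exp (\<i> * of_real y) * (exp (\<i> * of_real (x - y)) - 1)"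
    by (simp add: algebra_simps flip: exp_add)
  then show ?thesis using norm_iexp_minus_1_le[of "x - y"] by (simp add: norm_mult)
qed

context mean_zero_potential
begin

text \<open>The prefactor \<open>1 / (2 k)\<close> of the coupling makes its Lipschitz constant small, of order \<open>1 / m\<close>: this is
  what distinguishes the slow motion of \<open>A\<close> and \<open>B\<close> from that of \<open>exp (\<i> * k)\<close>.\<close>

lemma coupling_lipschitz:
  assumes m: "1 \<le> m" and k: "m \<le> k" and k': "m \<le> k'" and x: "x \<in> {0..1}"
  shows "norm (coupling k x - coupling k' x) \<le> ((3 + K) / (2 * m) * \<bar>k - k'\<bar>) * norm (complex_of_real (q x))"
proof -
  define th where "th = (\<lambda>k. Q x / k - 2 * k * x)"
  have e: "exp (- 2 * phase j x) = exp (\<i> * of_real (th j))" for j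
    by (simp add: phase_def th_def algebra_simps)
  have inv: "\<bar>1 / k - 1 / k'\<bar> \<le> \<bar>k - k'\<bar> / m"
  proof -
    have "\<bar>1 / k - 1 / k'\<bar> = \<bar>k - k'\<bar> / (k * k')"
      using m k k' by (simp add: abs_mult divide_simps abs_minus_commute)
    also have "m * 1 \<le> k * k'" using m k k' by (intro mult_mono) auto
    then have "\<bar>k - k'\<bar> / (k * k') \<le> \<bar>k - k'\<bar> / m"
      using m k k' by (intro divide_left_mono) auto
    finally show ?thesis .
  qed
  have "\<bar>th k - th k'\<bar> \<le> \<bar>Q x * (1 / k - 1 / k')\<bar> + \<bar>2 * x * (k - k')\<bar>"
    by (simp add: th_def algebra_simps)
  also have "\<bar>Q x * (1 / k - 1 / k')\<bar> \<le> K * \<bar>k - k'\<bar>"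
  proof -
    have "\<bar>k - k'\<bar> / m \<le> \<bar>k - k'\<bar> / 1" using m by (intro divide_left_mono) auto
    then have "\<bar>1 / k - 1 / k'\<bar> \<le> \<bar>k - k'\<bar>" using inv by simp
    then show ?thesis unfolding abs_mult using abs_Q_le[OF x] K_nonneg by (intro mult_mono) auto
  qed
  also have "\<bar>2 * x * (k - k')\<bar> \<le> 2 * \<bar>k - k'\<bar>"
    unfolding abs_mult using x by (intro mult_right_mono) auto
  finally have th: "\<bar>th k - th k'\<bar> \<le> (2 + K) * \<bar>k - k'\<bar>" by (simp add: algebra_simps)
  have "coupling k x - coupling k' x = - (\<i> / 2) * of_real (q x) *
    (of_real (1 / k - 1 / k') * exp (\<i> * of_real (th k)) + of_real (1 / k') * (exp (\<i> * of_real (th k)) - exp (\<i> * of_real (th k'))))"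
    unfolding coupling_def e by (simp add: algebra_simps)
  then have "norm (coupling k x - coupling k' x) = \<bar>q x\<bar> / 2 * 
    norm (of_real (1 / k - 1 / k') * exp (\<i> * of_real (th k)) + of_real (1 / k') * (exp (\<i> * of_real (th k)) - exp (\<i> * of_real (th k'))))"
    by (simp add: norm_mult norm_divide del: of_real_diff of_real_divide)
  also have "\<dots> \<le> \<bar>q x\<bar> / 2 * (\<bar>k - k'\<bar> / m + 1 / m * ((2 + K) * \<bar>k - k'\<bar>))"
  proof (intro mult_left_mono order_trans[OF norm_triangle_ineq] add_mono)
    show "norm (of_real (1 / k - 1 / k') * exp (\<i> * of_real (th k))) \<le> \<bar>k - k'\<bar> / m"
      using inv by (simp only: norm_mult norm_exp_i_times norm_of_real mult_1_right)
    have "norm (complex_of_real (1 / k')) \<le> 1 / m" using m k' by (simp add: norm_divide frac_le)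
    moreover have "norm (exp (\<i> * of_real (th k)) - exp (\<i> * of_real (th k'))) \<le> (2 + K) * \<bar>k - k'\<bar>"
      using norm_iexp_diff_le[of "th k" "th k'"] th by linarith
    ultimately show "norm (of_real (1 / k') * (exp (\<i> * of_real (th k)) - exp (\<i> * of_real (th k')))) 
        \<le> 1 / m * ((2 + K) * \<bar>k - k'\<bar>)"
      unfolding norm_mult using m by (intro mult_mono) auto
  qed auto
  also have "\<dots> = ((3 + K) / (2 * m) * \<bar>k - k'\<bar>) * norm (complex_of_real (q x))"
    using m by (simp add: field_simps)
  finally show ?thesis .
qed

lemma AB_lipschitz:
  assumes m: "1 \<le> m" "K \<le> m" and k: "m \<le> k" and k': "m \<le> k'"
  shows "norm (A k 1 - A k' 1) + norm (B k 1 - B k' 1) \<le> 4 * K * (3 + K) / m * \<bar>k - k'\<bar>"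
proof -
  define c where "c = (3 + K) / (2 * m) * \<bar>k - k'\<bar>"
  have pos: "0 < k" "K \<le> k" "0 < k'" "K \<le> k'" using assms by auto
  have "L1_norm (\<lambda>t. coupling k t - coupling k' t) \<le> integral {0..1} (\<lambda>t. c * norm (complex_of_real (q t)))"
    unfolding L1_norm_def
  proof (rule hk_integral_le)
    have "(\<lambda>t. coupling k t - coupling k' t) absolutely_integrable_on {0..1}"
      by (intro set_integral_diff coupling_ai)
    then show "(\<lambda>t. norm (coupling k t - coupling k' t)) integrable_on {0..1}"
      by (simp add: absolutely_integrable_on_def)
    show "(\<lambda>t. c * norm (complex_of_real (q t))) integrable_on {0..1}"
      using qc_ai by (intro integrable_on_mult_right) (simp add: absolutely_integrable_on_def)
  qed (use coupling_lipschitz[OF m(1) k k'] in \<open>auto simp: c_def\<close>)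
  then have "L1_norm (\<lambda>t. coupling k t - coupling k' t) \<le> c * K"
    by (simp add: K_def L1_norm_def)
  moreover have "norm (A k 1 - A k' 1) + norm (B k 1 - B k' 1) \<le> 8 * L1_norm (\<lambda>t. coupling k t - coupling k' t)"
    by (rule dirac_lipschitz[OF coupling_ai L1_norm_coupling_le[OF pos(1,2)] AB[OF pos(1,2)]
          coupling_ai L1_norm_coupling_le[OF pos(3,4)] AB[OF pos(3,4)]]) simp
  moreover have "8 * (c * K) = 4 * K * (3 + K) / m * \<bar>k - k'\<bar>"
    using m by (simp add: c_def field_simps)
  ultimately show ?thesis by linarith
qed

lemma AB_small:
  assumes k: "0 < k" "K \<le> k" and x: "x \<in> {0..1}"
  shows "norm (B k x) \<le> K / k" "norm (A k x - 1) \<le> K\<^sup>2 / k\<^sup>2" "norm (A k x) \<le> 2"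
proof -
  note sm = dirac_small[OF coupling_ai L1_norm_coupling_le[OF k] AB[OF k] x, unfolded L1_norm_coupling[OF k(1)]]
  show "norm (B k x) \<le> K / k" using sm(1) by simp
  have "2 * (K / (2 * k))\<^sup>2 = K\<^sup>2 / k\<^sup>2 / 2" by (simp add: power2_eq_square)
  moreover have "z / 2 \<le> z" if "0 \<le> z" for z :: real using that by simp
  ultimately have "2 * (K / (2 * k))\<^sup>2 \<le> K\<^sup>2 / k\<^sup>2" by (metis zero_le_divide_iff zero_le_power2)
  then show "norm (A k x - 1) \<le> K\<^sup>2 / k\<^sup>2" using sm(2) by (rule order_trans[rotated])
  show "norm (A k x) \<le> 2"
    using dirac_bound[OF coupling_ai L1_norm_coupling_le[OF k] AB(1)[OF k] x] AB(2,3)[OF k]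
      norm_ge_zero[of "B k x"] by (simp del: norm_ge_zero)
qed

lemma multiplier_near_integer:
  "multiplier ((-1) ^ n) (of_nat n * pi + t) = exp (\<i> * of_real t) * A (of_nat n * pi + t) 1"
proof -
  have "exp (\<i> * of_real (of_nat n * pi + t)) = exp (of_nat n * (\<i> * of_real pi)) * exp (\<i> * of_real t)"
    by (simp add: algebra_simps flip: exp_add)
  also have "exp (of_nat n * (\<i> * of_real pi)) = (-1) ^ n"
    by (simp add: exp_of_nat_mult exp_pi_i')
  finally show ?thesis
    unfolding multiplier_def by (simp add: power_mult_distrib[symmetric] flip: mult.assoc)
qed

lemma sign_power: "(-1) ^ n = (1 :: complex) \<or> (-1) ^ n = (-1 :: complex)"
  by (metis neg_one_even_power neg_one_odd_power)

text \<open>For \<open>k = n \<pi> + t\<close> the multiplier \<open>F t\<close> is \<open>e\<^sup>i\<^sup>t\<close> up to \<open>O(k\<^sup>-\<^sup>2)\<close>.  On \<open>[-1/2, 1/2]\<close> its imaginary part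
  changes sign.  At a zero of the imaginary part the real part is positive and, as the modulus is at
  least \<open>1\<close>, at least \<open>1\<close>.  At \<open>t = 1/2\<close> it is below \<open>1\<close>.  In between it takes the value \<open>1\<close>.\<close>

lemma eigenvalue_near:
  "\<exists>N. \<forall>n\<ge>N. \<exists>k. \<bar>k - real n * pi\<bar> \<le> 1/2 \<and> Re (multiplier ((-1) ^ n) k) = 1"
proof -
  \<comment> \<open>then \<open>K / k \<le> 1/10\<close>, so that \<open>F t\<close> is close to \<open>exp (\<i> * t)\<close>\<close>
  define N where "N = nat \<lceil>10 * (K + 1)\<rceil>"
  show ?thesis
  proof (intro exI[of _ N] allI impI)
    fix n assume "N \<le> n"
    then have "10 * (K + 1) \<le> real n" unfolding N_def by linarith
    then have nK: "10 * (K + 1) \<le> real n * pi - 1"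
      using mult_left_mono[OF less_imp_le[OF pi_gt3], of "real n"] K_nonneg of_nat_0_le_iff[of n] by argo
    define F where "F = (\<lambda>t. multiplier ((-1) ^ n) (real n * pi + t))"
    have pos: "0 < real n * pi + t" "K \<le> real n * pi + t" "10 * (K + 1) \<le> real n * pi + t" if "t \<in> {-1/2..1/2}" for t
      using nK that K_nonneg by auto
    have close: "norm (F t - exp (\<i> * of_real t)) \<le> 1/20" if t: "t \<in> {-1/2..1/2}" for t
    proof -
      have "F t - exp (\<i> * of_real t) = exp (\<i> * of_real t) * (A (real n * pi + t) 1 - 1)"
        unfolding F_def multiplier_near_integer by (simp add: algebra_simps)
      then have "norm (F t - exp (\<i> * of_real t)) \<le> K\<^sup>2 / (real n * pi + t)\<^sup>2"
        using AB_small(2)[OF pos(1,2)[OF t], of 1] by (simp add: norm_mult)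
      also have "\<dots> = (K / (real n * pi + t))\<^sup>2" by (simp add: power_divide)
      also have "\<dots> \<le> (1/10)\<^sup>2"
        using pos[OF t] K_nonneg by (intro power_mono) (auto simp: field_simps)
      finally show ?thesis by (simp add: power2_eq_square)
    qed
    have cF: "continuous_on {-1/2..1/2} F"
    proof -
      define c where "c = 4 * K * (3 + K) / (real n * pi - 1/2)"
      have m: "1 \<le> real n * pi - 1/2" "K \<le> real n * pi - 1/2" using nK K_nonneg by auto
      have "c-lipschitz_on {-1/2..1/2} (\<lambda>t. A (real n * pi + t) 1)"
      proof (rule lipschitz_onI)
        fix x y :: real assume "x \<in> {-1/2..1/2}" "y \<in> {-1/2..1/2}"
        then have "norm (A (real n * pi + x) 1 - A (real n * pi + y) 1) + norm (B (real n * pi + x) 1 - B (real n * pi + y) 1)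
            \<le> c * \<bar>(real n * pi + x) - (real n * pi + y)\<bar>"
          unfolding c_def by (intro AB_lipschitz m) auto
        then show "dist (A (real n * pi + x) 1) (A (real n * pi + y) 1) \<le> c * dist x y"
          using norm_ge_zero[of "B (real n * pi + x) 1 - B (real n * pi + y) 1"]
          unfolding dist_norm real_norm_def add_diff_cancel_left by linarith
      qed (use m K_nonneg in \<open>auto simp: c_def\<close>)
      then have "continuous_on {-1/2..1/2} (\<lambda>t. A (real n * pi + t) 1)"
        by (rule lipschitz_on_continuous_on)
      then show ?thesis unfolding F_def multiplier_near_integer by (intro continuous_intros)
    qed
    \<comment> \<open>accurate enough for \<open>1/20 < sin (1/2)\<close> and \<open>cos (1/2) < 1 - 1/20\<close>\<close>
    have tay: "\<bar>cos t - 1 + t\<^sup>2 / 2\<bar> \<le> 1/16" "\<bar>sin t - t\<bar> \<le> 1/16" if t: "t \<in> {-1/2..1/2}" for t :: real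
    proof -
      define z where "z = exp (\<i> * of_real t) - 1 - \<i> * of_real t + of_real (t\<^sup>2) / 2"
      have "\<bar>t\<bar> ^ 3 \<le> (1/2) ^ 3" using t by (intro power_mono) auto
      then have "norm z \<le> 1/16" using norm_iexp_Taylor2[of t] by (simp add: z_def power3_eq_cube)
      moreover have "Re z = cos t - 1 + t\<^sup>2 / 2" "Im z = sin t - t"
        by (simp_all add: z_def Re_exp Im_exp)
      ultimately show "\<bar>cos t - 1 + t\<^sup>2 / 2\<bar> \<le> 1/16" "\<bar>sin t - t\<bar> \<le> 1/16"
        using abs_Re_le_cmod[of z] abs_Im_le_cmod[of z] by linarith+
    qed
    have FI: "\<bar>Im (F t) - sin t\<bar> \<le> 1/20" and FR: "\<bar>Re (F t) - cos t\<bar> \<le> 1/20" if "t \<in> {-1/2..1/2}" for t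
      using close[OF that] abs_Im_le_cmod[of "F t - exp (\<i> * of_real t)"] abs_Re_le_cmod[of "F t - exp (\<i> * of_real t)"]
      by (auto simp: Im_exp Re_exp)
    have h: "(1/2 :: real) \<in> {-1/2..1/2}" "(-1/2 :: real) \<in> {-1/2..1/2}" by auto
    have "\<exists>t\<ge>-1/2. t \<le> 1/2 \<and> Im (F t) = 0"
    proof (rule IVT')
      show "Im (F (-1/2)) \<le> 0" using FI[OF h(2)] tay(2)[OF h(2)] by linarith
      show "0 \<le> Im (F (1/2))" using FI[OF h(1)] tay(2)[OF h(1)] by linarith
      show "continuous_on {-1/2..1/2} (\<lambda>t. Im (F t))" by (intro continuous_intros cF)
    qed simp
    then obtain t where t: "t \<in> {-1/2..1/2}" "Im (F t) = 0" by auto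
    have "0 < Re (F t)"
    proof -
      have "t\<^sup>2 \<le> (1/2)\<^sup>2" using t by (intro abs_le_square_iff[THEN iffD1]) auto
      also have "(1/2)\<^sup>2 = (1/4 :: real)" by (simp add: power2_eq_square)
      finally show ?thesis using FR[OF t(1)] tay(1)[OF t(1)] by linarith
    qed
    have "1 \<le> Re (F t)"
    proof -
      have "(Re (F t))\<^sup>2 = 1 + (norm (B (real n * pi + t) 1))\<^sup>2"
        using norm_multiplier_sq[OF pos(1,2)[OF t(1)] sign_power, of n] t(2) by (simp add: F_def cmod_power2)
      then have "1\<^sup>2 \<le> (Re (F t))\<^sup>2" by simp
      then show ?thesis by (rule power2_le_imp_le) (use \<open>0 < Re (F t)\<close> in simp)
    qed
    moreover have "Re (F (1/2)) \<le> 1"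
    proof -
      have "(1/2)\<^sup>2 / 2 = (1/8 :: real)" by (simp add: power2_eq_square)
      then show ?thesis using FR[OF h(1)] tay(1)[OF h(1)] by linarith
    qed
    moreover have "continuous_on {t..1/2} (\<lambda>t. Re (F t))"
      using t(1) by (intro continuous_intros continuous_on_subset[OF cF]) auto
    ultimately have "\<exists>x\<ge>t. x \<le> 1/2 \<and> Re (F x) = 1"
      using t(1) IVT2'[of "\<lambda>t. Re (F t)" "1/2" 1 t] by simp
    then obtain x where "t \<le> x" "x \<le> 1/2" "Re (F x) = 1" by blast
    then show "\<exists>k. \<bar>k - real n * pi\<bar> \<le> 1/2 \<and> Re (multiplier ((-1) ^ n) k) = 1"
      using t(1) by (intro exI[of _ "real n * pi + x"]) (auto simp: F_def)
  qed
qed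

text \<open>When the real part of \<open>P = multiplier s k\<close> is \<open>1\<close>, its imaginary part is \<open>\<plusminus> norm (B k 1)\<close>.  For two such points
  \<open>k\<close>, \<open>k'\<close> at distance \<open>d\<close>, the difference of the imaginary parts lies between \<open>3 d / 8\<close> and \<open>3 d\<close>, since
  \<open>P\<close> moves like \<open>exp (\<i> * k)\<close>, whereas \<open>norm (B k 1)\<close> changes by at most \<open>d / 8\<close>.  So the signs differ,
  and each of the imaginary parts is at most their difference.\<close>

lemma gap_controls_B:
  "\<exists>M. \<forall>s k k'. (s = 1 \<or> s = -1) \<longrightarrow> M \<le> k \<longrightarrow> M \<le> k' \<longrightarrow> \<bar>k - k'\<bar> \<le> 1/2 \<longrightarrow> k \<noteq> k' \<longrightarrow>
     Re (multiplier s k) = 1 \<longrightarrow> Re (multiplier s k') = 1 \<longrightarrow> norm (B k 1) \<le> 3 * \<bar>k - k'\<bar>"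
proof -
  define C where "C = 4 * K * (3 + K)"
  \<comment> \<open>the Lipschitz constant \<open>C / M\<close> of \<open>A\<close> and \<open>B\<close> is small against the lower bound \<open>1/2\<close> for \<open>\<bar>exp (\<i> * d) - 1\<bar> / d\<close>\<close>
  define M where "M = max 1 (max K (8 * C))"
  have "0 \<le> C" using K_nonneg by (simp add: C_def)
  moreover have "1 \<le> M" "K \<le> M" "8 * C \<le> M" by (auto simp: M_def)
  ultimately have M: "1 \<le> M" "K \<le> M" "C / M \<le> 1/8" "0 \<le> C / M"
    by (auto simp: field_simps)
  show ?thesis
  proof (intro exI[of _ M] allI impI)
    fix s :: complex and k k' :: real
    assume s: "s = 1 \<or> s = -1" and k: "M \<le> k" "M \<le> k'" and near: "\<bar>k - k'\<bar> \<le> 1/2" and "k \<noteq> k'"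
      and R: "Re (multiplier s k) = 1" "Re (multiplier s k') = 1"
    have pos: "0 < k" "K \<le> k" "0 < k'" "K \<le> k'" using k M by auto
    define d where "d = \<bar>k - k'\<bar>"
    have d: "0 < d" using \<open>k \<noteq> k'\<close> by (simp add: d_def)
    have lip: "norm (A k 1 - A k' 1) + norm (B k 1 - B k' 1) \<le> d / 8"
    proof -
      have "norm (A k 1 - A k' 1) + norm (B k 1 - B k' 1) \<le> C / M * d"
        unfolding C_def d_def using M k by (intro AB_lipschitz)
      also have "\<dots> \<le> 1/8 * d" using M d by (intro mult_right_mono) auto
      finally show ?thesis by simp
    qed
    define P where "P = multiplier s k"
    define P' where "P' = multiplier s k'"
    define D where "D = exp (\<i> * of_real (k - k')) - 1"
    have PP: "P - P' = s * exp (\<i> * of_real k') * (D * A k 1 + (A k 1 - A k' 1))"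
    proof -
      have "exp (\<i> * of_real k) = exp (\<i> * of_real k') * exp (\<i> * of_real (k - k'))"
        by (simp add: algebra_simps flip: exp_add)
      then show ?thesis unfolding P_def P'_def multiplier_def D_def by (simp add: algebra_simps)
    qed
    have nPP: "norm (P - P') = norm (D * A k 1 + (A k 1 - A k' 1))"
      unfolding PP using sign_cases(3)[OF s] by (simp add: norm_mult)
    have nD: "d / 2 \<le> norm D" "norm D \<le> d"
      unfolding D_def d_def using norm_iexp_minus_1_ge[OF near] norm_iexp_minus_1_le[of "k - k'"] by auto
    have nA: "1 \<le> norm (A k 1)" "norm (A k 1) \<le> 2"
    proof -
      have "1\<^sup>2 \<le> (norm (A k 1))\<^sup>2" using norm_A_sq[OF pos(1,2), of 1] by simp
      then show "1 \<le> norm (A k 1)" by (rule power2_le_imp_le) simp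
      show "norm (A k 1) \<le> 2" by (rule AB_small(3)[OF pos(1,2)]) simp
    qed
    have "norm D * 1 \<le> norm (D * A k 1)" "norm (D * A k 1) \<le> norm D * 2"
      unfolding norm_mult using nA by (intro mult_left_mono; simp)+
    then have upper: "norm (P - P') \<le> 3 * d" and lower: "3 * d / 8 \<le> norm (P - P')"
      using nPP nD lip norm_triangle_ineq[of "D * A k 1" "A k 1 - A k' 1"]
        norm_diff_ineq[of "D * A k 1" "A k 1 - A k' 1"] norm_ge_zero[of "B k 1 - B k' 1"] d
      by linarith+
    have "\<bar>Im (multiplier s j)\<bar> = norm (B j 1)" if "0 < j" "K \<le> j" "Re (multiplier s j) = 1" for j
    proof (rule power2_eq_imp_eq)
      show "\<bar>Im (multiplier s j)\<bar>\<^sup>2 = (norm (B j 1))\<^sup>2"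
        using norm_one_minus_multiplier_sq[OF that(1,2) s] that(3) by (simp add: cmod_power2[of "1 - multiplier s j"])
    qed auto
    then have I: "\<bar>Im P\<bar> = norm (B k 1)" "\<bar>Im P'\<bar> = norm (B k' 1)"
      using pos R unfolding P_def P'_def by blast+
    have "norm (P - P') = \<bar>Im P - Im P'\<bar>"
      using R by (simp add: P_def P'_def cmod_def)
    moreover have "\<bar>norm (B k 1) - norm (B k' 1)\<bar> \<le> d / 8"
      using norm_triangle_ineq3[of "B k 1" "B k' 1"] lip norm_ge_zero[of "A k 1 - A k' 1"] by linarith
    ultimately have "\<bar>Im P\<bar> \<le> 3 * d"
      using upper lower I d by linarith
    then show "norm (B k 1) \<le> 3 * \<bar>k - k'\<bar>" using I by (simp add: d_def)
  qed
qed

end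

section \<open>Gaps in the enumeration of the eigenvalues\<close>

text \<open>On a parity class \<open>m\<close> grows by at least \<open>1\<close> in each step of length \<open>2\<close>, hence at least like \<open>n / 2\<close> up to a
  constant; the factor \<open>4\<close> absorbs the constant.\<close>

lemma stride_two_index_growth:
  fixes m :: "nat \<Rightarrow> nat"
  assumes step: "\<And>n. N \<le> n \<Longrightarrow> even (n + p) \<Longrightarrow> m n < m (n + 2)"
  shows "\<exists>N'. \<forall>n\<ge>N'. even (n + p) \<longrightarrow> n \<le> 4 * m n"
proof -
  define N1 where "N1 = (if even (N + p) then N else N + 1)"
  have N1: "N \<le> N1" "even (N1 + p)" by (auto simp: N1_def)
  have grow: "i \<le> m (N1 + 2 * i)" for i
  proof (induction i)
    case (Suc i)
    have "m (N1 + 2 * i) < m (N1 + 2 * i + 2)" by (rule step) (use N1 in auto)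
    with Suc show ?case by simp
  qed simp
  have "n \<le> 4 * m n" if n: "2 * N1 \<le> n" "even (n + p)" for n
  proof -
    have "even (n - N1)" using n N1 by auto
    then obtain i where "n - N1 = 2 * i" by (elim evenE)
    then have "n = N1 + 2 * i" using n by linarith
    with grow[of i] n show ?thesis by simp
  qed
  then show ?thesis by blast
qed

context mean_zero_potential
begin

lemma eigenvalue_in_enumeration:
  assumes en: "eigenvalue_enumeration s q e" and k: "0 < k" "K \<le> k"
    and s: "s = 1 \<or> s = -1" and "Re (multiplier s k) = 1"
  shows "\<exists>j. e j = k\<^sup>2"
proof -
  have "card {n. e n = k\<^sup>2} = cfun.dim (eigenspace s q (k\<^sup>2))"
    using en unfolding eigenvalue_enumeration_def by blast
  then have "{n. e n = k\<^sup>2} \<noteq> {}" using dim_eigenspace_pos[OF k s assms(5)] by force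
  then show ?thesis by blast
qed

text \<open>An index counts a dimension: one index means an eigenfunction, two indices with the same value mean an
  eigenspace of dimension at least \<open>2\<close>.\<close>

lemma enumeration_imp_multiplier:
  assumes en: "eigenvalue_enumeration s q e" and k: "0 < k" "K \<le> k"
    and s: "s = 1 \<or> s = -1" and j: "e j = k\<^sup>2"
  shows "Re (multiplier s k) = 1" and "e i = k\<^sup>2 \<Longrightarrow> i \<noteq> j \<Longrightarrow> B k 1 = 0"
proof -
  have c: "card {n. e n = k\<^sup>2} = cfun.dim (eigenspace s q (k\<^sup>2))" "finite {n. e n = k\<^sup>2}"
    using en unfolding eigenvalue_enumeration_def by blast+
  have "card {j} \<le> card {n. e n = k\<^sup>2}" using c j by (intro card_mono) auto
  then show "Re (multiplier s k) = 1" using dim_eigenspace_posD[OF k s] c by simp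
  assume "e i = k\<^sup>2" "i \<noteq> j"
  then have "card {i, j} \<le> card {n. e n = k\<^sup>2}" using c j by (intro card_mono) auto
  then show "B k 1 = 0" using dim_eigenspace_ge_2D[OF k s] c \<open>i \<noteq> j\<close> by simp
qed

definition small_B_near :: "real \<Rightarrow> nat \<Rightarrow> bool" where
  "small_B_near \<epsilon> n \<longleftrightarrow> (\<exists>k. \<bar>k - real n * pi\<bar> \<le> 1/2 \<and>
     Re (multiplier ((-1) ^ n) k) = 1 \<and> norm (B k 1) \<le> \<epsilon> / real n ^ 3)"

text \<open>Here \<open>m n\<close> is the larger index of the pair \<open>(m n - 1, m n)\<close> of the right parity that contains the
  index \<open>J n\<close> of the eigenvalue \<open>(\<kappa> n)\<^sup>2\<close> near \<open>(n \<pi>)\<^sup>2\<close>, and \<open>i n\<close> is the other index of that pair.  For large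
  indices the gap of the pair is at most \<open>1\<close>, so that the whole pair stays near \<open>(n \<pi>)\<^sup>2\<close>.  Hence
  \<open>m\<close> is increasing and \<open>n \<le> 4 * m n\<close> for large \<open>n\<close>, which turns smallness in terms of the index into
  smallness in terms of \<open>n\<close>.  This replaces an exact count of the eigenvalues below \<open>(n \<pi>)\<^sup>2\<close>.\<close>

lemma small_gaps_imp_small_B:
  assumes en: "eigenvalue_enumeration ((-1) ^ p) q e"
    and small: "\<And>\<epsilon>. 0 < \<epsilon> \<Longrightarrow> \<exists>N. \<forall>n\<ge>N. even (n + p) \<longrightarrow> e n - e (n - 1) \<le> \<epsilon> / (real n)\<^sup>2"
    and \<epsilon>: "0 < \<epsilon>"
  shows "\<exists>N. \<forall>n\<ge>N. even (n + p) \<longrightarrow> small_B_near \<epsilon> n"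
proof -
  have mono: "mono e" using en unfolding eigenvalue_enumeration_def by blast
  obtain N0 where N0: "\<And>n. N0 \<le> n \<Longrightarrow> \<exists>k. \<bar>k - real n * pi\<bar> \<le> 1/2 \<and> Re (multiplier ((-1) ^ n) k) = 1"
    using eigenvalue_near by blast
  obtain M where M: "\<And>s k k'. (s = 1 \<or> s = -1) \<Longrightarrow> M \<le> k \<Longrightarrow> M \<le> k' \<Longrightarrow> \<bar>k - k'\<bar> \<le> 1/2 \<Longrightarrow> k \<noteq> k' \<Longrightarrow>
     Re (multiplier s k) = 1 \<Longrightarrow> Re (multiplier s k') = 1 \<Longrightarrow> norm (B k 1) \<le> 3 * \<bar>k - k'\<bar>"
    using gap_controls_B by blast
  obtain Na where Na: "\<And>n. Na \<le> n \<Longrightarrow> even (n + p) \<Longrightarrow> e n - e (n - 1) \<le> 1 / (real n)\<^sup>2"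
    using small[of 1] by auto
  \<comment> \<open>\<open>48 = 3 * 4\<^sup>2\<close>: the factor of \<open>gap_controls_B\<close>, and \<open>n \<le> 4 * m n\<close> squared\<close>
  obtain Nb where Nb: "\<And>n. Nb \<le> n \<Longrightarrow> even (n + p) \<Longrightarrow> e n - e (n - 1) \<le> (\<epsilon> / 48) / (real n)\<^sup>2"
    using small[of "\<epsilon> / 48"] \<epsilon> by auto
  define N2 where "N2 = Na + Nb + 1"
  \<comment> \<open>for \<open>n \<ge> N1\<close> the eigenvalue near \<open>(n \<pi>)\<^sup>2\<close> exceeds \<open>e N2\<close>, hence has an index beyond \<open>N2\<close>\<close>
  define N1 where "N1 = nat \<lceil>max (e N2) (max M K)\<rceil> + N0 + 4"
  obtain \<kappa> where \<kappa>: "\<And>n. N0 \<le> n \<Longrightarrow> \<bar>\<kappa> n - real n * pi\<bar> \<le> 1/2 \<and> Re (multiplier ((-1) ^ n) (\<kappa> n)) = 1"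
    using N0 by metis
  have sgn: "(-1 :: complex) ^ n = (-1) ^ p" if "even (n + p)" for n
    using that by (metis even_add neg_one_even_power neg_one_odd_power)
  have big: "real n + 2 \<le> \<kappa> n" "K \<le> \<kappa> n" "M + 2 \<le> \<kappa> n" "e N2 < (\<kappa> n)\<^sup>2" if "N1 \<le> n" for n
  proof -
    have 1: "\<bar>\<kappa> n - real n * pi\<bar> \<le> 1/2" using \<kappa>[of n] that by (simp add: N1_def)
    have 2: "max (e N2) (max M K) + 4 \<le> real n" using that unfolding N1_def by linarith
    have 3: "4 \<le> real n" using that unfolding N1_def by linarith
    have 4: "real n * 3 \<le> real n * pi" using pi_gt3 by (intro mult_left_mono) auto
    show 5: "real n + 2 \<le> \<kappa> n" using 1 3 4 by linarith
    show "K \<le> \<kappa> n" "M + 2 \<le> \<kappa> n" using 2 5 by linarith+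
    have "\<kappa> n * 1 \<le> \<kappa> n * \<kappa> n" using 5 3 by (intro mult_left_mono) auto
    then show "e N2 < (\<kappa> n)\<^sup>2" using 2 5 unfolding power2_eq_square by linarith
  qed
  have "\<exists>j. e j = (\<kappa> n)\<^sup>2" if "N1 \<le> n" "even (n + p)" for n
    using eigenvalue_in_enumeration[OF en, of "\<kappa> n"] big[OF that(1)] \<kappa>[of n] that sgn[OF that(2)] sign_power[of p]
    by (simp add: N1_def)
  then obtain J where J: "\<And>n. N1 \<le> n \<Longrightarrow> even (n + p) \<Longrightarrow> e (J n) = (\<kappa> n)\<^sup>2" by metis
  define m where "m = (\<lambda>n. if even (J n + p) then J n else J n + 1)"
  define i where "i = (\<lambda>n. if even (J n + p) then J n - 1 else J n + 1)"
  have JN: "N2 < J n" if "N1 \<le> n" "even (n + p)" for n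
  proof (rule ccontr)
    assume "\<not> N2 < J n"
    then have "e (J n) \<le> e N2" using mono by (intro monoD[OF mono]) simp
    then show False using J[OF that] big(4)[OF that(1)] by simp
  qed
  have mp: "even (m n + p)" "N2 \<le> m n" "e (m n - 1) \<le> (\<kappa> n)\<^sup>2" "(\<kappa> n)\<^sup>2 \<le> e (m n)"
    "\<bar>e (i n) - (\<kappa> n)\<^sup>2\<bar> = e (m n) - e (m n - 1)" "i n \<noteq> J n" if "N1 \<le> n" "even (n + p)" for n
    using JN[OF that] J[OF that] monoD[OF mono, of "J n - 1" "J n"] monoD[OF mono, of "J n" "J n + 1"]
    by (auto simp: m_def i_def)
  have gap1: "e (m n) - e (m n - 1) \<le> 1" if "N1 \<le> n" "even (n + p)" for n
  proof -
    have "e (m n) - e (m n - 1) \<le> 1 / (real (m n))\<^sup>2" using mp(1,2)[OF that] by (intro Na) (auto simp: N2_def)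
    also have "\<dots> \<le> 1" using mp(2)[OF that] by (simp add: N2_def field_simps)
    finally show ?thesis .
  qed
  have "m n < m (n + 2)" if n: "N1 \<le> n" "even (n + p)" for n
  proof -
    have n': "N1 \<le> n + 2" "even (n + 2 + p)" using n by auto
    have "\<bar>\<kappa> n - real n * pi\<bar> \<le> 1/2" "\<bar>\<kappa> (n + 2) - real (n + 2) * pi\<bar> \<le> 1/2"
      using \<kappa>[of n] \<kappa>[of "n + 2"] n by (auto simp: N1_def)
    moreover have "real (n + 2) * pi = real n * pi + 2 * pi" by (simp add: algebra_simps)
    ultimately have "\<kappa> n + 1 \<le> \<kappa> (n + 2)" using pi_gt3 by linarith
    then have "(\<kappa> n + 1)\<^sup>2 \<le> (\<kappa> (n + 2))\<^sup>2" using big(1)[OF n(1)] by (intro power_mono) auto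
    then have "(\<kappa> n)\<^sup>2 + 2 * \<kappa> n + 1 \<le> (\<kappa> (n + 2))\<^sup>2" by (simp add: power2_eq_square algebra_simps)
    then have "e (m n) < e (m (n + 2))"
      using gap1[OF n] mp(3)[OF n] mp(4)[OF n'] big(1)[OF n(1)] by linarith
    then show ?thesis using monoD[OF mono, of "m (n + 2)" "m n"] by (meson not_less)
  qed
  from stride_two_index_growth[where m = m and p = p and N = N1, OF this]
  obtain N3 where N3: "\<And>n. N3 \<le> n \<Longrightarrow> even (n + p) \<Longrightarrow> n \<le> 4 * m n" by blast
  show ?thesis
  proof (intro exI[of _ "N1 + N3"] allI impI)
    fix n assume nn: "N1 + N3 \<le> n" and ev: "even (n + p)"
    then have n: "N1 \<le> n" by simp
    have npos: "0 < real n" using n by (simp add: N1_def)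
    define k where "k = \<kappa> n"
    have k: "0 < k" "K \<le> k" "real n \<le> k" "M + 2 \<le> k" "2 \<le> k" using big[OF n] npos by (auto simp: k_def)
    have kk: "\<bar>k - real n * pi\<bar> \<le> 1/2" "Re (multiplier ((-1) ^ n) k) = 1"
      using \<kappa>[of n] n by (auto simp: k_def N1_def)
    define g where "g = e (m n) - e (m n - 1)"
    have g1: "g \<le> 1" unfolding g_def by (rule gap1[OF n ev])
    have mpos: "0 < real (m n)" using mp(2)[OF n ev] by (simp add: N2_def)
    have g2: "g \<le> \<epsilon> / 3 / (real n)\<^sup>2"
    proof -
      have "g \<le> (\<epsilon> / 48) / (real (m n))\<^sup>2"
        unfolding g_def using mp(1,2)[OF n ev] by (intro Nb) (auto simp: N2_def)
      also have "\<dots> = \<epsilon> / 3 / (4 * real (m n))\<^sup>2" by (simp add: power_mult_distrib)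
      also have "\<dots> \<le> \<epsilon> / 3 / (real n)\<^sup>2"
        using N3[of n] nn ev npos \<epsilon> mpos by (intro divide_left_mono power_mono) (auto simp flip: of_nat_le_iff)
      finally show ?thesis .
    qed
    have near: "\<bar>e (i n) - k\<^sup>2\<bar> = g" unfolding g_def k_def by (rule mp(5)[OF n ev])
    have "norm (B k 1) \<le> 3 * (g / k)"
    proof (cases "e (i n) = k\<^sup>2")
      case True
      have "B k 1 = 0"
        by (rule enumeration_imp_multiplier(2)[OF en k(1,2) sign_power _ True mp(6)[OF n ev]])
          (use J[OF n ev] in \<open>simp add: k_def\<close>)
      then show ?thesis using near k by simp
    next
      case False
      define k' where "k' = sqrt (e (i n))"
      have "2 * k \<le> k * k" using k by (intro mult_right_mono) auto
      then have ge: "(k - 1)\<^sup>2 \<le> e (i n)" using near g1 k by (simp add: power2_eq_square algebra_simps)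
      moreover have "0 \<le> (k - 1)\<^sup>2" by simp
      ultimately have ge0: "0 \<le> e (i n)" by linarith
      then have sq: "e (i n) = k'\<^sup>2" by (simp add: k'_def)
      have k'ge: "k - 1 \<le> k'" unfolding k'_def using ge by (intro real_le_rsqrt)
      have "\<bar>k'\<^sup>2 - k\<^sup>2\<bar> = \<bar>k - k'\<bar> * (k + k')"
      proof -
        have "k'\<^sup>2 - k\<^sup>2 = - ((k - k') * (k + k'))" by (simp add: power2_eq_square algebra_simps)
        then show ?thesis using k k'ge by (simp add: abs_mult)
      qed
      then have gk: "g = \<bar>k - k'\<bar> * (k + k')" using near sq by simp
      also have "\<dots> \<ge> \<bar>k - k'\<bar> * k" using k k'ge by (intro mult_left_mono) auto
      finally have d: "\<bar>k - k'\<bar> \<le> g / k" using k by (simp add: field_simps)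
      also have "\<dots> \<le> 1 / 2" using g1 k by (intro frac_le) auto
      finally have d2: "\<bar>k - k'\<bar> \<le> 1 / 2" .
      have "0 < k'" using k k'ge by linarith
      moreover have "K \<le> k'" 
      proof -
        have "max (e N2) (max M K) + 4 \<le> real n" using n unfolding N1_def by linarith
        then show ?thesis using k k'ge by linarith
      qed
      ultimately have R': "Re (multiplier ((-1) ^ p) k') = 1"
        by (rule enumeration_imp_multiplier(1)[OF en _ _ sign_power sq])
      have "norm (B k 1) \<le> 3 * \<bar>k - k'\<bar>"
      proof (rule M[OF sign_power _ _ d2])
        show "k \<noteq> k'" using False sq by auto
      qed (use k k'ge R' kk(2) sgn[OF ev] in auto)
      then show ?thesis by (rule order_trans) (rule mult_left_mono[OF d], simp)
    qed
    also have "\<dots> \<le> 3 * ((\<epsilon> / 3 / (real n)\<^sup>2) / real n)"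
    proof -
      have "0 \<le> g" using near by linarith
      then have "g / k \<le> (\<epsilon> / 3 / (real n)\<^sup>2) / real n" using g2 k npos by (intro frac_le) auto
      then show ?thesis by simp
    qed
    also have "\<dots> = \<epsilon> / real n ^ 3" by (simp add: power2_eq_square power3_eq_cube)
    finally show "small_B_near \<epsilon> n"
      using kk unfolding small_B_near_def by blast
  qed
qed

end

section \<open>The Riemann-Lebesgue lemma\<close>

lemma clamp_Lipschitz: "\<bar>max (- c) (min c x) - max (- c) (min c y)\<bar> \<le> \<bar>x - y\<bar>" for c x y :: real
  by (auto simp: max_def min_def)

text \<open>Truncate \<open>f\<close> at height \<open>n\<close>.  A measurable function is almost everywhere a limit of continuous ones; these are
  truncated at the same height, which keeps them continuous and provides a dominating constant.\<close>

lemma continuous_approximation_L1: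
  fixes f :: "real \<Rightarrow> real"
  assumes f: "f absolutely_integrable_on {0..1}" and "0 < e"
  shows "\<exists>g. continuous_on UNIV g \<and> integral {0..1} (\<lambda>x. \<bar>f x - g x\<bar>) < e"
proof -
  define cl where "cl = (\<lambda>n x. max (- real n) (min (real n) x))"
  have fi: "f integrable_on {0..1}" "(\<lambda>x. \<bar>f x\<bar>) integrable_on {0..1}"
    using f by (auto simp: absolutely_integrable_on_def)
  have clf: "(\<lambda>x. cl n (f x)) absolutely_integrable_on {0..1}" for n
    unfolding cl_def using f
    by (intro absolutely_integrable_max_1 absolutely_integrable_min_1) (auto simp: absolutely_integrable_continuous_real)
  have dclf: "(\<lambda>x. \<bar>f x - cl n (f x)\<bar>) integrable_on {0..1}" for n
    using set_integral_diff(1)[OF f clf[of n]] by (auto simp: absolutely_integrable_on_def)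
  have "(\<lambda>n. integral {0..1} (\<lambda>x. \<bar>f x - cl n (f x)\<bar>)) \<longlonglongrightarrow> integral {0..1::real} (\<lambda>x. 0)"
  proof (rule dominated_convergence(2)[where f = "\<lambda>n x. \<bar>f x - cl n (f x)\<bar>", OF dclf fi(2)])
    show "norm \<bar>f x - cl n (f x)\<bar> \<le> \<bar>f x\<bar>" for n x
      by (auto simp: cl_def max_def min_def)
    show "(\<lambda>n. \<bar>f x - cl n (f x)\<bar>) \<longlonglongrightarrow> 0" for x
    proof (rule tendsto_eventually)
      obtain N where "\<bar>f x\<bar> \<le> real N" using real_arch_simple by blast
      then have "\<bar>f x - cl n (f x)\<bar> = 0" if "N \<le> n" for n
        using that by (auto simp: cl_def max_def min_def)
      then show "\<forall>\<^sub>F n in sequentially. \<bar>f x - cl n (f x)\<bar> = 0"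
        unfolding eventually_sequentially by blast
    qed
  qed
  then have "\<forall>\<^sub>F n in sequentially. integral {0..1} (\<lambda>x. \<bar>f x - cl n (f x)\<bar>) < e / 2"
    using \<open>0 < e\<close> by (intro order_tendstoD(2)) auto
  then obtain n where n: "integral {0..1} (\<lambda>x. \<bar>f x - cl n (f x)\<bar>) < e / 2"
    unfolding eventually_sequentially by blast
  have "f measurable_on {0..1}"
    using absolutely_integrable_imp_borel_measurable[OF f] by (simp add: measurable_on_iff_borel_measurable)
  then obtain N g where N: "negligible N" and g: "\<And>j. continuous_on UNIV (g j)"
    and lim: "\<And>x. x \<notin> N \<Longrightarrow> (\<lambda>j. g j x) \<longlonglongrightarrow> (if x \<in> {0..1} then f x else 0)"
    unfolding measurable_on_def by blast
  define h where "h = (\<lambda>j x. cl n (g j x))"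
  have h: "continuous_on UNIV (h j)" for j
    unfolding h_def cl_def by (intro continuous_intros g)
  have "h j absolutely_integrable_on {0..1}" for j
    using h by (intro absolutely_integrable_continuous_real) (auto intro: continuous_on_subset)
  from set_integral_diff(1)[OF clf this]
  have dh: "(\<lambda>x. \<bar>cl n (f x) - h j x\<bar>) integrable_on {0..1}" for j
    by (auto simp: absolutely_integrable_on_def)
  have dh': "(\<lambda>x. if x \<in> N then 0 else \<bar>cl n (f x) - h j x\<bar>) integrable_on {0..1}" for j
    by (rule integrable_spike[OF dh N]) auto
  have "(\<lambda>j. integral {0..1} (\<lambda>x. if x \<in> N then 0 else \<bar>cl n (f x) - h j x\<bar>)) \<longlonglongrightarrow> integral {0..1::real} (\<lambda>x. 0)"
  proof (rule dominated_convergence(2)[where f = "\<lambda>j x. if x \<in> N then 0 else \<bar>cl n (f x) - h j x\<bar>" and h = "\<lambda>x. 2 * real n", OF dh'])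
    show "(\<lambda>x::real. 2 * real n) integrable_on {0..1}" by (rule integrable_const_ivl)
    show "norm (if x \<in> N then 0 else \<bar>cl n (f x) - h j x\<bar>) \<le> 2 * real n" for j x
      by (auto simp: cl_def h_def max_def min_def)
    show "(\<lambda>j. if x \<in> N then 0 else \<bar>cl n (f x) - h j x\<bar>) \<longlonglongrightarrow> 0" if "x \<in> {0..1}" for x
    proof (cases "x \<in> N")
      case False
      then have "(\<lambda>j. g j x) \<longlonglongrightarrow> f x" using lim[of x] that by simp
      then have "(\<lambda>j. \<bar>f x - g j x\<bar>) \<longlonglongrightarrow> \<bar>f x - f x\<bar>" by (intro tendsto_intros)
      then have "(\<lambda>j. \<bar>f x - g j x\<bar>) \<longlonglongrightarrow> 0" by simp
      then have "(\<lambda>j. \<bar>cl n (f x) - h j x\<bar>) \<longlonglongrightarrow> 0"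
        by (rule Lim_null_comparison[rotated]) (auto simp: h_def cl_def intro!: always_eventually clamp_Lipschitz)
      then show ?thesis using False by simp
    qed simp
  qed
  then have "\<forall>\<^sub>F j in sequentially. integral {0..1} (\<lambda>x. if x \<in> N then 0 else \<bar>cl n (f x) - h j x\<bar>) < e / 2"
    using \<open>0 < e\<close> by (intro order_tendstoD(2)) auto
  then obtain j where "integral {0..1} (\<lambda>x. if x \<in> N then 0 else \<bar>cl n (f x) - h j x\<bar>) < e / 2"
    unfolding eventually_sequentially by blast
  moreover have "integral {0..1} (\<lambda>x. if x \<in> N then 0 else \<bar>cl n (f x) - h j x\<bar>) = integral {0..1} (\<lambda>x. \<bar>cl n (f x) - h j x\<bar>)"
    by (rule integral_spike[OF N]) auto
  ultimately have j: "integral {0..1} (\<lambda>x. \<bar>cl n (f x) - h j x\<bar>) < e / 2" by simp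
  have "integral {0..1} (\<lambda>x. \<bar>f x - h j x\<bar>) \<le> integral {0..1} (\<lambda>x. \<bar>f x - cl n (f x)\<bar> + \<bar>cl n (f x) - h j x\<bar>)"
  proof (rule hk_integral_le)
    have "h j absolutely_integrable_on {0..1}"
      using h by (intro absolutely_integrable_continuous_real) (auto intro: continuous_on_subset)
    from set_integral_diff(1)[OF f this] show "(\<lambda>x. \<bar>f x - h j x\<bar>) integrable_on {0..1}"
      by (auto simp: absolutely_integrable_on_def)
  qed (auto intro: integrable_add dclf dh)
  also have "\<dots> = integral {0..1} (\<lambda>x. \<bar>f x - cl n (f x)\<bar>) + integral {0..1} (\<lambda>x. \<bar>cl n (f x) - h j x\<bar>)"
    by (rule hk_integral_add[OF dclf dh])
  finally have "integral {0..1} (\<lambda>x. \<bar>f x - h j x\<bar>) < e" using n j by linarith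
  with h show ?thesis by blast
qed

lemma polynomial_approximation_L1:
  fixes f :: "real \<Rightarrow> real"
  assumes f: "f absolutely_integrable_on {0..1}" and "0 < e"
  shows "\<exists>p. real_polynomial_function p \<and> integral {0..1} (\<lambda>x. \<bar>f x - p x\<bar>) < e"
proof -
  obtain g where g: "continuous_on UNIV g" "integral {0..1} (\<lambda>x. \<bar>f x - g x\<bar>) < e / 2"
    using continuous_approximation_L1[OF f, of "e / 2"] \<open>0 < e\<close> by auto
  have g': "continuous_on {0..1} g" using g(1) by (rule continuous_on_subset) simp
  obtain p where p: "real_polynomial_function p" "\<And>x. x \<in> {0..1} \<Longrightarrow> \<bar>g x - p x\<bar> < e / 2"
    using Stone_Weierstrass_real_polynomial_function[of "{0..1}" g "e / 2"] g' \<open>0 < e\<close> by auto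
  have p': "continuous_on {0..1} p"
    using p(1) by (intro continuous_on_polymonial_function) (simp add: real_polynomial_function_eq)
  have ai: "(\<lambda>x. \<bar>f x - k x\<bar>) integrable_on {0..1}" if "continuous_on {0..1} k" for k
    using set_integral_diff(1)[OF f absolutely_integrable_continuous_real[OF that]]
    by (auto simp: absolutely_integrable_on_def)
  have "integral {0..1} (\<lambda>x. \<bar>f x - p x\<bar>) \<le> integral {0..1} (\<lambda>x. \<bar>f x - g x\<bar> + e / 2)"
  proof (rule hk_integral_le)
    show "\<bar>f x - p x\<bar> \<le> \<bar>f x - g x\<bar> + e / 2" if "x \<in> {0..1}" for x using p(2)[OF that] by linarith
  qed (auto intro!: integrable_add ai p' g')
  also have "\<dots> = integral {0..1} (\<lambda>x. \<bar>f x - g x\<bar>) + e / 2"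
    by (subst hk_integral_add) (auto intro!: ai g')
  finally show ?thesis using p(1) g(2) by (intro exI[of _ p]) auto
qed

text \<open>One integration by parts.\<close>

lemma oscillatory_integral_polynomial:
  assumes p: "real_polynomial_function (p :: real \<Rightarrow> real)"
  shows "\<exists>C. \<forall>k>0. \<forall>x\<in>{0..1}. norm (integral {0..x} (\<lambda>t. of_real (p t) * exp (\<i> * of_real (2 * k * t)))) \<le> C / k"
proof -
  obtain p' where p': "real_polynomial_function p'" "\<And>x. (p has_real_derivative p' x) (at x)"
    using has_real_derivative_polynomial_function[OF p] by blast
  have cont: "continuous_on {0..1} p" "continuous_on {0..1} p'"
    using p p'(1) by (auto intro!: continuous_on_polymonial_function simp: real_polynomial_function_eq)
  have bd: "\<exists>c. \<forall>x\<in>{0..1}. \<bar>h x\<bar> \<le> c" if "continuous_on {0..1} h" for h :: "real \<Rightarrow> real"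
    using compact_imp_bounded[OF compact_continuous_image[OF that]] unfolding bounded_iff by auto
  obtain c c' where c: "\<And>x. x \<in> {0..1} \<Longrightarrow> \<bar>p x\<bar> \<le> c" "\<And>x. x \<in> {0..1} \<Longrightarrow> \<bar>p' x\<bar> \<le> c'"
    using bd[OF cont(1)] bd[OF cont(2)] by blast
  have "norm (integral {0..x} (\<lambda>t. of_real (p t) * exp (\<i> * of_real (2 * k * t)))) \<le> (2 * c + c') / k"
    if k: "0 < k" and x: "x \<in> {0..1}" for k x
  proof -
    define E where "E = (\<lambda>t. exp (\<i> * complex_of_real (2 * k * t)))"
    have nE: "norm (E t) = 1" for t by (simp add: E_def)
    have cE: "continuous_on S E" for S unfolding E_def by (intro continuous_intros)
    define H where "H = (\<lambda>t. of_real (p t) * E t)"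
    have H: "abs_cont_deriv H (\<lambda>t. of_real (p' t) * E t + (2 * \<i> * of_real k) * H t)"
    proof (rule abs_cont_deriv_C1)
      fix t :: real
      have dp: "((\<lambda>t. complex_of_real (p t)) has_vector_derivative of_real (p' t)) (at t within {0..1})"
        by (auto intro!: has_vector_derivative_of_real has_field_derivative_at_within[OF p'(2)] simp: has_real_derivative_iff_has_vector_derivative[symmetric])
      have dE: "(E has_vector_derivative (2 * \<i> * of_real k) * E t) (at t within {0..1})"
      proof -
        have "((\<lambda>z. exp (\<i> * (2 * of_real k * z))) has_field_derivative (2 * \<i> * of_real k) * exp (\<i> * (2 * of_real k * of_real t))) (at (of_real t))"
          by (auto intro!: derivative_eq_intros)
        from has_vector_derivative_real_field[OF this, of "{0..1}"] show ?thesis by (simp add: E_def)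
      qed
      show "(H has_vector_derivative of_real (p' t) * E t + (2 * \<i> * of_real k) * H t) (at t within {0..1})"
        unfolding H_def using has_vector_derivative_mult[OF dp dE] by (simp add: algebra_simps)
    qed (unfold H_def, intro continuous_intros cont cE)
    have i1: "(\<lambda>t. of_real (p' t) * E t) integrable_on {0..x}" "(\<lambda>t. H t) integrable_on {0..x}"
      unfolding H_def using x cont
      by (auto intro!: integrable_continuous_interval continuous_intros cE intro: continuous_on_subset)
    have "H x - H 0 = integral {0..x} (\<lambda>t. of_real (p' t) * E t) + (2 * \<i> * of_real k) * integral {0..x} H"
      using abs_cont_deriv_diff_eq[OF H, of 0 x] x i1
      by (simp add: hk_integral_add integrable_on_mult_right)
    then have "norm ((2 * \<i> * of_real k) * integral {0..x} H) = norm (H x - H 0 - integral {0..x} (\<lambda>t. of_real (p' t) * E t))"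
      by (simp add: algebra_simps)
    also have "\<dots> \<le> norm (H x) + norm (H 0) + norm (integral {0..x} (\<lambda>t. of_real (p' t) * E t))"
      using norm_triangle_ineq4[of "H x - H 0"] norm_triangle_ineq4[of "H x" "H 0"] by (meson add_right_mono order_trans)
    also have "\<dots> \<le> c + c + c'"
    proof (intro add_mono)
      show "norm (H x) \<le> c" "norm (H 0) \<le> c" using c(1)[OF x] c(1)[of 0] by (auto simp: H_def norm_mult nE)
      have "norm (integral {0..x} (\<lambda>t. of_real (p' t) * E t)) \<le> integral {0..x} (\<lambda>t. c')"
        by (rule integral_norm_bound_integral[OF i1(1)]) (use c(2) x in \<open>auto simp: norm_mult nE\<close>)
      also have "\<dots> \<le> c'" using x order_trans[OF abs_ge_zero c(2)[OF x]] by (simp add: mult_left_le_one_le)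
      finally show "norm (integral {0..x} (\<lambda>t. of_real (p' t) * E t)) \<le> c'" .
    qed
    finally have "2 * k * norm (integral {0..x} H) \<le> 2 * c + c'" using k by (simp add: norm_mult)
    moreover have "0 \<le> k * norm (integral {0..x} H)" using k by simp
    ultimately have "k * norm (integral {0..x} H) \<le> 2 * c + c'" by linarith
    then show ?thesis using k by (simp add: H_def E_def field_simps)
  qed
  then show ?thesis by blast
qed

text \<open>Uniform in the upper limit: this is needed for amplitudes, which are integrals up to \<open>x\<close>.  Both the error
  of the approximation in mean and the estimate for polynomials are uniform.\<close>

lemma Riemann_Lebesgue_uniform:
  fixes f :: "real \<Rightarrow> real"
  assumes f: "f absolutely_integrable_on {0..1}" and "0 < e"
  shows "\<exists>k0. \<forall>k\<ge>k0. \<forall>x\<in>{0..1}. norm (integral {0..x} (\<lambda>t. of_real (f t) * exp (\<i> * of_real (2 * k * t)))) \<le> e"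
proof -
  obtain p where p: "real_polynomial_function p" "integral {0..1} (\<lambda>x. \<bar>f x - p x\<bar>) < e / 2"
    using polynomial_approximation_L1[OF f, of "e / 2"] \<open>0 < e\<close> by auto
  obtain C where C: "\<And>k x. 0 < k \<Longrightarrow> x \<in> {0..1} \<Longrightarrow> norm (integral {0..x} (\<lambda>t. of_real (p t) * exp (\<i> * of_real (2 * k * t)))) \<le> C / k"
    using oscillatory_integral_polynomial[OF p(1)] by blast
  have pc: "continuous_on {0..1} p"
    using p(1) by (intro continuous_on_polymonial_function) (simp add: real_polynomial_function_eq)
  note pa = absolutely_integrable_continuous_real[OF pc]
  have d: "(\<lambda>t. complex_of_real (f t - p t)) absolutely_integrable_on {0..1}"
    by (intro absolutely_integrable_of_real set_integral_diff(1) f pa)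
  have L1d: "L1_norm (\<lambda>t. complex_of_real (f t - p t)) < e / 2"
    unfolding L1_norm_def using p(2) by (simp only: norm_of_real)
  show ?thesis
  proof (intro exI[of _ "max 1 (2 * C / e)"] allI impI ballI)
    fix k x assume k: "max 1 (2 * C / e) \<le> k" and x: "x \<in> {0..1::real}"
    define E where "E = (\<lambda>t. exp (\<i> * complex_of_real (2 * k * t)))"
    have cE: "continuous_on {0..1} E" unfolding E_def by (intro continuous_intros)
    have i: "(\<lambda>t. of_real (f t - p t) * E t) integrable_on {0..x}" "(\<lambda>t. of_real (p t) * E t) integrable_on {0..x}"
      using absolutely_integrable_on_unit_subinterval[OF absolutely_integrable_mult_continuous[OF d cE], of 0 x]
        absolutely_integrable_on_unit_subinterval[OF absolutely_integrable_mult_continuous[OF absolutely_integrable_of_real[OF pa] cE], of 0 x] x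
      by (auto simp: absolutely_integrable_on_def)
    have "integral {0..x} (\<lambda>t. of_real (f t) * E t) = integral {0..x} (\<lambda>t. of_real (f t - p t) * E t + of_real (p t) * E t)"
      by (simp add: algebra_simps)
    also have "\<dots> = integral {0..x} (\<lambda>t. of_real (f t - p t) * E t) + integral {0..x} (\<lambda>t. of_real (p t) * E t)"
      by (rule hk_integral_add[OF i])
    finally have "norm (integral {0..x} (\<lambda>t. of_real (f t) * E t)) \<le> 
       norm (integral {0..x} (\<lambda>t. of_real (f t - p t) * E t)) + norm (integral {0..x} (\<lambda>t. of_real (p t) * E t))"
      by (simp add: norm_triangle_ineq)
    also have "norm (integral {0..x} (\<lambda>t. of_real (f t - p t) * E t)) \<le> 1 * L1_norm (\<lambda>t. complex_of_real (f t - p t))"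
      by (rule norm_integral_mult_le[OF d cE _ x]) (simp add: E_def)
    also have "norm (integral {0..x} (\<lambda>t. of_real (p t) * E t)) \<le> C / k"
      unfolding E_def using k by (intro C x) auto
    also have "C / k \<le> e / 2" using k \<open>0 < e\<close> by (simp add: field_simps)
    finally show "norm (integral {0..x} (\<lambda>t. of_real (f t) * exp (\<i> * of_real (2 * k * t)))) \<le> e"
      using L1d by (simp add: E_def)
  qed
qed

section \<open>Uniqueness of Fourier coefficients\<close>

definition mode :: "int \<Rightarrow> real \<Rightarrow> complex" where
  "mode m t = exp (\<i> * of_real (2 * pi * of_int m * t))"

lemma mode_add: "mode (m + n) t = mode m t * mode n t"
  by (simp add: mode_def algebra_simps flip: exp_add)

lemma mode_0 [simp]: "mode 0 t = 1"
  by (simp add: mode_def)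

lemma norm_mode [simp]: "norm (mode m t) = 1"
  by (simp add: mode_def)

lemma continuous_on_mode [continuous_intros]: "continuous_on S (mode m)"
  unfolding mode_def by (intro continuous_intros)

lemma mode_at_1 [simp]: "mode m 1 = 1" and mode_at_0 [simp]: "mode m 0 = 1"
proof -
  have "mode m 1 = cis (2 * pi * of_int m)" by (simp add: mode_def cis_conv_exp)
  then show "mode m 1 = 1" by (simp add: cis_multiple_2pi)
qed (simp add: mode_def)

lemma cnj_mode: "cnj (mode m t) = mode (- m) t"
  by (simp add: mode_def exp_cnj)

lemma integral_mode: "integral {0..1} (mode m) = (if m = 0 then 1 else 0)"
proof (cases "m = 0")
  case False
  define c where "c = 2 * complex_of_real pi * of_int m * \<i>"
  have c: "c \<noteq> 0" using False by (simp add: c_def)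
  have "((\<lambda>t. mode m t) has_integral mode m 1 / c - mode m 0 / c) {0..1}"
  proof (rule fundamental_theorem_of_calculus)
    fix t :: real
    have "((\<lambda>z. exp (c * z) / c) has_field_derivative exp (c * of_real t)) (at (of_real t))"
      using c by (auto intro!: derivative_eq_intros)
    from has_vector_derivative_real_field[OF this, of "{0..1}"]
    show "((\<lambda>t. mode m t / c) has_vector_derivative mode m t) (at t within {0..1})"
      by (simp add: mode_def c_def mult_ac)
  qed simp
  then show ?thesis using False by (simp add: integral_unique)
next
  case True
  then have "mode m = (\<lambda>t. 1)" by auto
  then show ?thesis using True by simp
qed

definition no_modes :: "(real \<Rightarrow> complex) set" where
  "no_modes = {h. continuous_on {0..1} h \<and> (\<forall>m. integral {0..1} (\<lambda>t. h t * mode m t) = 0)}"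

text \<open>The circle is the quotient of \<open>[0, 1]\<close> by its end points: preimages of closed sets under \<open>F\<close> are images
  of compact sets.\<close>

lemma circle_function_continuous:
  fixes g :: "real \<Rightarrow> real"
  assumes g: "continuous_on {0..1} g" "g 0 = g 1"
  shows "\<exists>F. continuous_on (sphere 0 1) F \<and> (\<forall>t\<in>{0..1}. F (mode 1 t) = g t)"
proof -
  define F where "F = (\<lambda>z. g (Arg2pi z / (2 * pi)))"
  have F: "F (mode 1 t) = g t" if t: "t \<in> {0..1}" for t
  proof (cases "t = 1")
    case True
    then show ?thesis using g(2) by (simp add: F_def Arg2pi_of_real[of 1, simplified])
  next
    case False
    have "Arg2pi (mode 1 t) = 2 * pi * t"
      by (rule Arg2pi_unique[of 1]) (use t False in \<open>auto simp: mode_def\<close>)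
    then show ?thesis by (simp add: F_def)
  qed
  have surj: "\<exists>t\<in>{0..1}. z = mode 1 t" if "z \<in> sphere 0 1" for z
  proof (rule bexI)
    show "z = mode 1 (Arg2pi z / (2 * pi))"
      using Arg2pi_eq[of z] that by (simp add: mode_def)
    show "Arg2pi z / (2 * pi) \<in> {0..1}"
      using Arg2pi_ge_0[of z] Arg2pi_lt_2pi[of z] by (auto simp: field_simps)
  qed
  have "continuous_on (sphere 0 1) F"
    unfolding continuous_on_closed_vimage[OF closed_sphere]
  proof (intro allI impI)
    fix C :: "real set" assume "closed C"
    have "F -` C \<inter> sphere 0 1 = mode 1 ` ({0..1} \<inter> g -` C)"
    proof (intro set_eqI iffI)
      fix z assume z: "z \<in> F -` C \<inter> sphere 0 1"
      then obtain t where "t \<in> {0..1}" "z = mode 1 t" using surj by blast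
      then show "z \<in> mode 1 ` ({0..1} \<inter> g -` C)" using z F[of t] by auto
    next
      fix z assume "z \<in> mode 1 ` ({0..1} \<inter> g -` C)"
      then show "z \<in> F -` C \<inter> sphere 0 1" using F by auto
    qed
    moreover have "compact ({0..1} \<inter> g -` C)"
    proof -
      have "closed (g -` C \<inter> {0..1})"
        using g(1) \<open>closed C\<close> continuous_on_closed_vimage[of "{0..1}" g] by auto
      then have "compact ({0..1} \<inter> (g -` C \<inter> {0..1}))" by (intro compact_Int_closed) auto
      moreover have "{0..1} \<inter> (g -` C \<inter> {0..1}) = {0..1} \<inter> g -` C" by blast
      ultimately show ?thesis by simp
    qed
    ultimately show "closed (F -` C \<inter> sphere 0 1)"
      by (auto intro!: compact_imp_closed compact_continuous_image continuous_intros)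
  qed
  with F show ?thesis by blast
qed

lemma no_modes_cmult_add:
  assumes "h \<in> no_modes" "h' \<in> no_modes"
  shows "(\<lambda>t. c * h t + d * h' t) \<in> no_modes"
proof -
  have c: "continuous_on {0..1} h" "continuous_on {0..1} h'" using assms by (auto simp: no_modes_def)
  have "integral {0..1} (\<lambda>t. (c * h t + d * h' t) * mode m t) = 0" for m
  proof -
    have i: "(\<lambda>t. c * (h t * mode m t)) integrable_on {0..1}" "(\<lambda>t. d * (h' t * mode m t)) integrable_on {0..1}"
      by (intro integrable_continuous_interval continuous_intros c)+
    have "integral {0..1} (\<lambda>t. (c * h t + d * h' t) * mode m t) = integral {0..1} (\<lambda>t. c * (h t * mode m t) + d * (h' t * mode m t))"
      by (simp add: algebra_simps)
    also have "\<dots> = 0"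
      unfolding hk_integral_add[OF i] using assms by (simp add: no_modes_def)
    finally show ?thesis .
  qed
  then show ?thesis using c by (auto simp: no_modes_def intro!: continuous_intros)
qed

lemma no_modes_shift:
  assumes "h \<in> no_modes"
  shows "(\<lambda>t. h t * mode n t) \<in> no_modes"
proof -
  have "(\<lambda>t. h t * mode n t * mode m t) = (\<lambda>t. h t * mode (n + m) t)" for m
    by (simp add: mode_add mult.assoc)
  then show ?thesis using assms by (auto simp: no_modes_def intro!: continuous_intros)
qed

text \<open>Stone-Weierstrass on the circle, for the set \<open>P\<close> of functions such that multiplication by them preserves
  \<open>no_modes\<close>.  This set is closed under products by its definition, and it contains the two
  coordinate functions since \<open>2 cos\<close> and \<open>2 i sin\<close> are a sum and a difference of two modes.\<close>

lemma no_modes_approximation: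
  fixes u :: "real \<Rightarrow> real"
  assumes u: "continuous_on {0..1} u" "u 0 = u 1" and "0 < e"
  shows "\<exists>w. continuous_on {0..1} w \<and> (\<forall>h\<in>no_modes. (\<lambda>t. h t * of_real (w t)) \<in> no_modes) \<and> (\<forall>t\<in>{0..1}. \<bar>u t - w t\<bar> < e)"
proof -
  obtain F where F: "continuous_on (sphere 0 1) F" "\<And>t. t \<in> {0..1} \<Longrightarrow> F (mode 1 t) = u t"
    using circle_function_continuous[OF u] by blast
  define P where "P = (\<lambda>f :: complex \<Rightarrow> real. continuous_on (sphere 0 1) f \<and>
    (\<forall>h\<in>no_modes. (\<lambda>t. h t * of_real (f (mode 1 t))) \<in> no_modes))"
  have Pre: "P Re"
    unfolding P_def
  proof (intro conjI ballI)
    fix h assume h: "h \<in> no_modes"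
    have "h t * of_real (Re (mode 1 t)) = (1/2) * (h t * mode 1 t) + (1/2) * (h t * mode (-1) t)" for t
      by (simp add: complex_eq_iff cnj_mode[of 1, symmetric] field_simps)
    then show "(\<lambda>t. h t * of_real (Re (mode 1 t))) \<in> no_modes"
      using no_modes_cmult_add[OF no_modes_shift[OF h, of 1] no_modes_shift[OF h, of "-1"], of "1/2" "1/2"] by simp
  qed (intro continuous_intros)
  have Pim: "P Im"
    unfolding P_def
  proof (intro conjI ballI)
    fix h assume h: "h \<in> no_modes"
    have "h t * of_real (Im (mode 1 t)) = (- \<i>/2) * (h t * mode 1 t) + (\<i>/2) * (h t * mode (-1) t)" for t
      by (simp add: complex_eq_iff cnj_mode[of 1, symmetric] field_simps)
    then show "(\<lambda>t. h t * of_real (Im (mode 1 t))) \<in> no_modes"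
      using no_modes_cmult_add[OF no_modes_shift[OF h, of 1] no_modes_shift[OF h, of "-1"], of "- \<i>/2" "\<i>/2"] by simp
  qed (intro continuous_intros)
  have "\<exists>f. P f \<and> (\<forall>z\<in>sphere 0 1. \<bar>F z - f z\<bar> < e)"
  proof (rule Stone_Weierstrass_HOL[where P = P])
    show "compact (sphere (0 :: complex) 1)" by simp
    show "P (\<lambda>x. c)" for c
      unfolding P_def using no_modes_cmult_add[of _ _ "of_real c" 0] by (auto simp: mult.commute)
    show "continuous_on (sphere 0 1) f" if "P f" for f using that by (simp add: P_def)
    show "P (\<lambda>x. f x + g x)" if "P f \<and> P g" for f g
      unfolding P_def
    proof (intro conjI ballI)
      show "continuous_on (sphere 0 1) (\<lambda>x. f x + g x)" using that by (auto simp: P_def intro!: continuous_intros)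
      fix h assume "h \<in> no_modes"
      then have "(\<lambda>t. h t * of_real (f (mode 1 t))) \<in> no_modes" "(\<lambda>t. h t * of_real (g (mode 1 t))) \<in> no_modes"
        using that by (auto simp: P_def)
      from no_modes_cmult_add[OF this, of 1 1] show "(\<lambda>t. h t * of_real (f (mode 1 t) + g (mode 1 t))) \<in> no_modes"
        by (simp add: algebra_simps)
    qed
    show "P (\<lambda>x. f x * g x)" if "P f \<and> P g" for f g
      unfolding P_def
    proof (intro conjI ballI)
      show "continuous_on (sphere 0 1) (\<lambda>x. f x * g x)" using that by (auto simp: P_def intro!: continuous_intros)
      fix h assume "h \<in> no_modes"
      then have "(\<lambda>t. h t * of_real (f (mode 1 t))) \<in> no_modes" using that by (auto simp: P_def)
      then have "(\<lambda>t. h t * of_real (f (mode 1 t)) * of_real (g (mode 1 t))) \<in> no_modes" using that by (auto simp: P_def)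
      then show "(\<lambda>t. h t * of_real (f (mode 1 t) * g (mode 1 t))) \<in> no_modes" by (simp add: mult.assoc)
    qed
    show "\<exists>f. P f \<and> f x \<noteq> f y" if "x \<in> sphere 0 1 \<and> y \<in> sphere 0 1 \<and> x \<noteq> y" for x y
      using Pre Pim that complex_eqI by blast
  qed (use F \<open>0 < e\<close> in auto)
  then obtain f where f: "P f" "\<And>z. z \<in> sphere 0 1 \<Longrightarrow> \<bar>F z - f z\<bar> < e" by blast
  show ?thesis
  proof (intro exI[of _ "\<lambda>t. f (mode 1 t)"] conjI ballI)
    have "continuous_on (sphere 0 1) f" using f(1) by (simp add: P_def)
    then show "continuous_on {0..1} (\<lambda>t. f (mode 1 t))"
      by (rule continuous_on_compose2[OF _ continuous_on_mode]) auto
    show "(\<lambda>t. h t * of_real (f (mode 1 t))) \<in> no_modes" if "h \<in> no_modes" for h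
      using f(1) that by (simp add: P_def)
    show "\<bar>u t - f (mode 1 t)\<bar> < e" if "t \<in> {0..1}" for t
      using f(2)[of "mode 1 t"] F(2)[OF that] by simp
  qed
qed

text \<open>By the approximation, \<open>cnj g\<close> is a uniform limit of functions \<open>z\<close> with \<open>\<integral> g z = 0\<close>.  So \<open>\<integral> \<bar>g\<bar>\<^sup>2 = 0\<close>.\<close>

lemma no_modes_periodic_eq_0:
  assumes g: "g \<in> no_modes" "g 0 = g 1" and t: "t \<in> {0..1}"
  shows "g t = 0"
proof -
  have cg: "continuous_on {0..1} g" using g by (simp add: no_modes_def)
  have int0: "integral {0..1} h = 0" if "h \<in> no_modes" for h
    using that mode_0 by (auto simp: no_modes_def dest: spec[of _ 0])
  define I where "I = integral {0..1} (\<lambda>t. (norm (g t))\<^sup>2)"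
  have n2: "(\<lambda>t. (norm (g t))\<^sup>2) integrable_on {0..1}"
    by (intro integrable_continuous_interval continuous_intros cg)
  have I0: "0 \<le> I" unfolding I_def by (rule Henstock_Kurzweil_Integration.integral_nonneg[OF n2]) simp
  have gai: "g absolutely_integrable_on {0..1}" by (rule absolutely_integrable_continuous_real[OF cg])
  have cRe: "continuous_on {0..1} (\<lambda>t. Re (g t))" and cIm: "continuous_on {0..1} (\<lambda>t. Im (g t))"
    by (intro continuous_intros cg)+
  have main: "I \<le> (2 * e) * L1_norm g" if e0: "0 < e" for e
  proof -
    obtain w where w: "continuous_on {0..1} w" "\<forall>h\<in>no_modes. (\<lambda>t. h t * of_real (w t)) \<in> no_modes"
        "\<forall>t\<in>{0..1}. \<bar>Re (g t) - w t\<bar> < e"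
      using no_modes_approximation[OF cRe, OF _ e0] g(2) by auto
    obtain v where v: "continuous_on {0..1} v" "\<forall>h\<in>no_modes. (\<lambda>t. h t * of_real (v t)) \<in> no_modes"
        "\<forall>t\<in>{0..1}. \<bar>Im (g t) - v t\<bar> < e"
      using no_modes_approximation[OF cIm, OF _ e0] g(2) by auto
    define z where "z = (\<lambda>t. complex_of_real (w t) + (- \<i>) * complex_of_real (v t))"
    have cz: "continuous_on {0..1} z" unfolding z_def using w v by (intro continuous_intros) auto
    have "(\<lambda>t. 1 * (g t * of_real (w t)) + (- \<i>) * (g t * of_real (v t))) \<in> no_modes"
      using w(2) v(2) g(1) by (intro no_modes_cmult_add) auto
    then have "(\<lambda>t. g t * z t) \<in> no_modes" by (simp add: z_def algebra_simps)
    then have gz: "integral {0..1} (\<lambda>t. g t * z t) = 0" by (rule int0)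
    have "((\<lambda>t. complex_of_real ((norm (g t))\<^sup>2)) has_integral of_real I) {0..1}"
      unfolding I_def using has_integral_linear[OF integrable_integral[OF n2] bounded_linear_of_real] by (simp add: o_def)
    then have "complex_of_real I = integral {0..1} (\<lambda>t. complex_of_real ((norm (g t))\<^sup>2))" by (simp add: integral_unique)
    also have "\<dots> = integral {0..1} (\<lambda>t. g t * cnj (g t))" by (simp only: complex_norm_square)
    also have "\<dots> = integral {0..1} (\<lambda>t. g t * cnj (g t)) - integral {0..1} (\<lambda>t. g t * z t)" by (simp add: gz)
    also have "\<dots> = integral {0..1} (\<lambda>t. g t * (cnj (g t) - z t))"
      by (subst hk_integral_diff[symmetric])
        (auto intro!: integrable_continuous_interval continuous_intros cg cz simp: right_diff_distrib)
    finally have "I = norm (integral {0..1} (\<lambda>t. g t * (cnj (g t) - z t)))" using I0 by (metis abs_of_nonneg norm_of_real)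
    also have "\<dots> \<le> (2 * e) * L1_norm g"
    proof (rule norm_integral_mult_le[OF gai])
      show "continuous_on {0..1} (\<lambda>t. cnj (g t) - z t)" by (intro continuous_intros cg cz)
      fix t :: real assume t: "t \<in> {0..1}"
      have "norm (cnj (g t) - z t) \<le> \<bar>Re (cnj (g t) - z t)\<bar> + \<bar>Im (cnj (g t) - z t)\<bar>" by (rule cmod_le)
      also have "\<dots> \<le> 2 * e"
        using w(3)[rule_format, OF t] v(3)[rule_format, OF t] by (simp add: z_def)
      finally show "norm (cnj (g t) - z t) \<le> 2 * e" .
    qed simp
    finally show ?thesis .
  qed
  have "I = 0"
  proof (rule ccontr)
    assume "I \<noteq> 0"
    then have "0 < I" using I0 by simp
    define e where "e = I / (4 * (L1_norm g + 1))"
    have L: "0 \<le> L1_norm g" by (rule L1_norm_nonneg)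
    have e: "0 < e" using \<open>0 < I\<close> L by (simp add: e_def)
    have "I \<le> (2 * e) * L1_norm g" by (rule main[OF e])
    also have "\<dots> \<le> (2 * e) * (L1_norm g + 1)" using e by (intro mult_left_mono) auto
    also have "\<dots> = I / 2" using L by (simp add: e_def field_simps)
    finally show False using \<open>0 < I\<close> by simp
  qed
  then have "\<forall>t\<in>{0..1}. (norm (g t))\<^sup>2 = 0"
    unfolding I_def by (subst (asm) integral_eq_0_iff) (auto intro!: continuous_intros cg)
  then show ?thesis using t by simp
qed

section \<open>Fourier coefficients of a square\<close>

definition fcoef :: "(real \<Rightarrow> complex) \<Rightarrow> int \<Rightarrow> complex" where
  "fcoef h m = integral {0..1} (\<lambda>t. h t * mode (- m) t)"

lemma sum_over_ints_le:
  fixes F :: "int set" and b :: "nat \<Rightarrow> real"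
  assumes "finite F" "\<And>n. 0 \<le> b n" "summable b"
  shows "(\<Sum>m\<in>F. b (nat \<bar>m\<bar>)) \<le> 2 * suminf b"
proof -
  have half: "(\<Sum>m\<in>G. b (nat \<bar>m\<bar>)) \<le> suminf b" if "finite G" "inj_on (\<lambda>m. nat \<bar>m\<bar>) G" for G :: "int set"
  proof -
    have "(\<Sum>m\<in>G. b (nat \<bar>m\<bar>)) = sum b ((\<lambda>m. nat \<bar>m\<bar>) ` G)"
      using that(2) by (simp add: sum.reindex o_def)
    also have "\<dots> \<le> suminf b" using assms that by (intro sum_le_suminf) auto
    finally show ?thesis .
  qed
  have "(\<Sum>m\<in>F. b (nat \<bar>m\<bar>)) = (\<Sum>m\<in>F \<inter> {0..}. b (nat \<bar>m\<bar>)) + (\<Sum>m\<in>F \<inter> {..<0}. b (nat \<bar>m\<bar>))"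
    using assms(1) by (subst sum.union_disjoint[symmetric]) (auto intro!: sum.cong)
  also have "\<dots> \<le> suminf b + suminf b"
    by (intro add_mono half) (use assms(1) in \<open>auto simp: inj_on_def\<close>)
  finally show ?thesis by simp
qed

lemma fourier_coefficients_summable:
  fixes a :: "int \<Rightarrow> complex"
  assumes "\<And>m. M \<le> \<bar>m\<bar> \<Longrightarrow> norm (a m) * (real_of_int m)\<^sup>2 \<le> 1"
  shows "\<exists>A\<ge>0. \<forall>F. finite F \<longrightarrow> (\<Sum>m\<in>F. norm (a m)) \<le> A"
proof -
  define b where "b = (\<lambda>n. 1 / (1 + real n)\<^sup>2)"
  have sb: "summable b"
  proof -
    have "summable (\<lambda>n. inverse ((of_nat n)\<^sup>2) :: real)" by (rule inverse_power_summable) simp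
    then show ?thesis
      unfolding b_def by (subst (asm) summable_Suc_iff[symmetric]) (simp add: divide_inverse add.commute)
  qed
  \<comment> \<open>outside of the finite set \<open>G\<close> the hypothesis applies and \<open>(1 + \<bar>m\<bar>)\<^sup>2 \<le> 4 m\<^sup>2\<close>\<close>
  define G where "G = {- (max M 1)..max M 1}"
  define C where "C = 4 + (\<Sum>m\<in>G. norm (a m) * (1 + \<bar>real_of_int m\<bar>)\<^sup>2)"
  have C: "norm (a m) * (1 + \<bar>real_of_int m\<bar>)\<^sup>2 \<le> C" for m
  proof (cases "m \<in> G")
    case True
    then have "norm (a m) * (1 + \<bar>real_of_int m\<bar>)\<^sup>2 \<le> (\<Sum>m\<in>G. norm (a m) * (1 + \<bar>real_of_int m\<bar>)\<^sup>2)"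
      by (intro member_le_sum) (auto simp: G_def)
    then show ?thesis by (simp add: C_def)
  next
    case False
    then have m: "M \<le> \<bar>m\<bar>" "1 \<le> \<bar>m\<bar>" by (auto simp: G_def)
    have "1 + \<bar>real_of_int m\<bar> \<le> 2 * \<bar>real_of_int m\<bar>" using m(2) by linarith
    then have "(1 + \<bar>real_of_int m\<bar>)\<^sup>2 \<le> (2 * \<bar>real_of_int m\<bar>)\<^sup>2" by (intro power_mono) auto
    then have "norm (a m) * (1 + \<bar>real_of_int m\<bar>)\<^sup>2 \<le> norm (a m) * (4 * (real_of_int m)\<^sup>2)"
      by (intro mult_left_mono) (auto simp: power_mult_distrib)
    also have "\<dots> \<le> 4" using assms[OF m(1)] by simp
    also have "\<dots> \<le> C" unfolding C_def by (simp add: sum_nonneg)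
    finally show ?thesis .
  qed
  have C0: "0 \<le> C" unfolding C_def by (simp add: sum_nonneg add_nonneg_nonneg)
  have ab: "norm (a m) \<le> C * b (nat \<bar>m\<bar>)" for m
  proof -
    have "0 < (1 + \<bar>real_of_int m\<bar>)\<^sup>2" by (intro zero_less_power) linarith
    then show ?thesis using C[of m] by (simp add: b_def field_simps)
  qed
  have "(\<Sum>m\<in>F. norm (a m)) \<le> C * (2 * suminf b)" if "finite F" for F
  proof -
    have "(\<Sum>m\<in>F. norm (a m)) \<le> (\<Sum>m\<in>F. C * b (nat \<bar>m\<bar>))" by (intro sum_mono ab)
    also have "\<dots> = C * (\<Sum>m\<in>F. b (nat \<bar>m\<bar>))" by (simp add: sum_distrib_left)
    also have "\<dots> \<le> C * (2 * suminf b)"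
      using sum_over_ints_le[OF that _ sb] C0 by (intro mult_left_mono) (auto simp: b_def)
    finally show ?thesis .
  qed
  moreover have "0 \<le> C * (2 * suminf b)"
    using C0 suminf_nonneg[OF sb] by (simp add: b_def)
  ultimately show ?thesis by blast
qed

text \<open>The series converges uniformly to a continuous function with the same coefficients as \<open>g\<close>.\<close>

lemma periodic_eq_fourier_series:
  assumes g: "continuous_on {0..1} g" "g 0 = g 1" and A: "\<And>F. finite F \<Longrightarrow> (\<Sum>m\<in>F. norm (fcoef g m)) \<le> A"
  shows "uniform_limit {0..1} (\<lambda>X t. \<Sum>m\<in>X. fcoef g m * mode m t) g (finite_subsets_at_top UNIV)"
proof -
  define a where "a = fcoef g"
  define P where "P = (\<lambda>X t. \<Sum>m\<in>X. a m * mode m t)"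
  define S where "S = (\<lambda>t. \<Sum>\<^sub>\<infinity>m\<in>UNIV. a m * mode m t)"
  have "(\<lambda>m. norm (a m)) summable_on UNIV"
    by (rule nonneg_bdd_above_summable_on) (use A in \<open>auto simp: a_def bdd_above_def\<close>)
  then have unif: "uniform_limit {0..1} P S (finite_subsets_at_top UNIV)"
    unfolding P_def S_def by (intro Weierstrass_m_test_general) (auto simp: norm_mult)
  have cP: "continuous_on {0..1} (P X)" for X unfolding P_def by (intro continuous_intros)
  have cS: "continuous_on {0..1} S"
    by (rule uniform_limit_theorem[OF _ unif]) (auto simp: cP)
  have coefP: "integral {0..1} (\<lambda>t. P X t * mode (- m) t) = a m" if "finite X" "m \<in> X" for X m
  proof -
    have "integral {0..1} (\<lambda>t. P X t * mode (- m) t) = integral {0..1} (\<lambda>t. \<Sum>j\<in>X. a j * mode (j - m) t)"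
      by (simp add: P_def sum_distrib_right mult.assoc flip: mode_add)
    also have "\<dots> = (\<Sum>j\<in>X. integral {0..1} (\<lambda>t. a j * mode (j - m) t))"
      by (intro integral_sum that(1) integrable_continuous_interval continuous_intros)
    also have "\<dots> = (\<Sum>j\<in>X. if j = m then a j else 0)"
      by (intro sum.cong refl) (simp add: integral_mode)
    also have "\<dots> = a m" using that by simp
    finally show ?thesis .
  qed
  have coefS: "integral {0..1} (\<lambda>t. S t * mode (- m) t) = a m" for m
  proof -
    have "norm (a m - integral {0..1} (\<lambda>t. S t * mode (- m) t)) \<le> e" if "0 < e" for e
    proof -
      have "\<forall>\<^sub>F X in finite_subsets_at_top UNIV. \<forall>t\<in>{0..1}. dist (P X t) (S t) < e"
        using unif that unfolding uniform_limit_iff by blast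
      moreover have "\<forall>\<^sub>F X in finite_subsets_at_top (UNIV :: int set). finite X \<and> {m} \<subseteq> X"
        unfolding eventually_finite_subsets_at_top by (intro exI[of _ "{m}"]) auto
      ultimately have "\<forall>\<^sub>F X in finite_subsets_at_top (UNIV :: int set). (\<forall>t\<in>{0..1}. dist (P X t) (S t) < e) \<and> finite X \<and> {m} \<subseteq> X"
        by eventually_elim auto
      then obtain X where X: "\<forall>t\<in>{0..1}. dist (P X t) (S t) < e" "finite X" "m \<in> X"
        using eventually_happens' finite_subsets_at_top_neq_bot by (metis (no_types, lifting) insert_subset)
      have "a m - integral {0..1} (\<lambda>t. S t * mode (- m) t) = integral {0..1} (\<lambda>t. mode (- m) t * (P X t - S t))"
        unfolding coefP[OF X(2,3), symmetric]
        by (subst hk_integral_diff[symmetric])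
          (auto intro!: integrable_continuous_interval continuous_intros cP cS simp: algebra_simps)
      also have "norm \<dots> \<le> e * L1_norm (mode (- m))"
        by (rule norm_integral_mult_le)
          (use X(1) in \<open>auto intro!: absolutely_integrable_continuous_real continuous_intros cP cS simp: dist_norm less_imp_le\<close>)
      also have "L1_norm (mode (- m)) = 1" by (simp add: L1_norm_def)
      finally show ?thesis by simp
    qed
    then have "norm (a m - integral {0..1} (\<lambda>t. S t * mode (- m) t)) \<le> 0" by (rule field_le_epsilon) simp
    then show ?thesis by simp
  qed
  have "(\<lambda>t. 1 * g t + (-1) * S t) \<in> no_modes"
    unfolding no_modes_def
  proof (intro CollectI conjI allI)
    fix m
    have "integral {0..1} (\<lambda>t. (1 * g t + (-1) * S t) * mode m t) = integral {0..1} (\<lambda>t. g t * mode m t) - integral {0..1} (\<lambda>t. S t * mode m t)"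
      by (subst hk_integral_diff[symmetric])
        (auto intro!: integrable_continuous_interval continuous_intros g(1) cS simp: algebra_simps)
    also have "\<dots> = 0" using coefS[of "- m"] by (simp add: a_def fcoef_def)
    finally show "integral {0..1} (\<lambda>t. (1 * g t + (-1) * S t) * mode m t) = 0" .
  qed (intro continuous_intros g(1) cS)
  moreover have "S 0 = S 1" by (simp add: S_def)
  ultimately have "1 * g t + (-1) * S t = 0" if "t \<in> {0..1}" for t
    by (intro no_modes_periodic_eq_0[OF _ _ that]) (use g(2) in auto)
  then have "g t = S t" if "t \<in> {0..1}" for t using that by simp
  then show ?thesis
    using unif unfolding P_def a_def uniform_limit_iff by simp
qed

text \<open>The coefficient of \<open>g\<^sup>2\<close> at \<open>k\<close> is the sum of \<open>a m * a (k - m)\<close> over all \<open>m\<close>.  In each term one of the indices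
  is at least \<open>\<bar>k\<bar> / 2\<close> in modulus, and the corresponding factor is at most \<open>4 \<delta> / k\<^sup>2\<close>; the other factor is
  summable.\<close>

lemma fcoef_square_decay:
  assumes g: "continuous_on {0..1} g" "g 0 = g 1"
    and decay: "\<And>\<epsilon>. 0 < \<epsilon> \<Longrightarrow> \<exists>M. \<forall>m. M \<le> \<bar>m\<bar> \<longrightarrow> norm (fcoef g m) * (real_of_int m)\<^sup>2 \<le> \<epsilon>"
    and \<epsilon>: "0 < \<epsilon>"
  shows "\<exists>M. \<forall>m. M \<le> \<bar>m\<bar> \<longrightarrow> norm (fcoef (\<lambda>t. g t * g t) m) * (real_of_int m)\<^sup>2 \<le> \<epsilon>"
proof -
  define a where "a = fcoef g"
  obtain M1 where "\<And>m. M1 \<le> \<bar>m\<bar> \<Longrightarrow> norm (a m) * (real_of_int m)\<^sup>2 \<le> 1"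
    using decay[of 1] unfolding a_def by auto
  from fourier_coefficients_summable[OF this]
  obtain A where A: "0 \<le> A" "\<And>F. finite F \<Longrightarrow> (\<Sum>m\<in>F. norm (a m)) \<le> A" by blast
  note unif = periodic_eq_fourier_series[OF g A(2)[unfolded a_def], folded a_def]
  define P where "P = (\<lambda>X t. \<Sum>m\<in>X. a m * mode m t)"
  have cP: "continuous_on {0..1} (P X)" for X unfolding P_def by (intro continuous_intros)
  \<comment> \<open>\<open>A\<close> bounds each of the two sums of the moduli \<open>norm (a m)\<close> and \<open>norm (a (k - m))\<close>, which enter with the factor \<open>4 * \<delta>\<close>\<close>
  define \<delta> where "\<delta> = \<epsilon> / (8 * (A + 1))"
  have \<delta>: "0 < \<delta>" using \<epsilon> A by (simp add: \<delta>_def)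
  obtain M where M: "\<And>m. M \<le> \<bar>m\<bar> \<Longrightarrow> norm (a m) * (real_of_int m)\<^sup>2 \<le> \<delta>"
    using decay[OF \<delta>] unfolding a_def by blast
  have "norm (fcoef (\<lambda>t. g t * g t) k) * (real_of_int k)\<^sup>2 \<le> \<epsilon>" if k: "2 * max M 1 \<le> \<bar>k\<bar>" for k
  proof -
    have kpos: "0 < (real_of_int k)\<^sup>2" using k by auto
    have large: "norm (a m) * (real_of_int k)\<^sup>2 \<le> 4 * \<delta>" if "\<bar>k\<bar> \<le> 2 * \<bar>m\<bar>" for m
    proof -
      have "\<bar>real_of_int k\<bar> \<le> \<bar>2 * real_of_int m\<bar>" using that by linarith
      then have "(real_of_int k)\<^sup>2 \<le> (2 * real_of_int m)\<^sup>2" by (simp add: abs_le_square_iff)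
      then have "norm (a m) * (real_of_int k)\<^sup>2 \<le> norm (a m) * (4 * (real_of_int m)\<^sup>2)"
        by (intro mult_left_mono) (auto simp: power_mult_distrib)
      also have "\<dots> \<le> 4 * \<delta>" using M[of m] that k by simp
      finally show ?thesis .
    qed
    have product: "norm (a m * a (k - m)) * (real_of_int k)\<^sup>2 \<le> 4 * \<delta> * (norm (a m) + norm (a (k - m)))" for m
    proof (cases "\<bar>k\<bar> \<le> 2 * \<bar>m\<bar>")
      case True
      have "norm (a m * a (k - m)) * (real_of_int k)\<^sup>2 = (norm (a m) * (real_of_int k)\<^sup>2) * norm (a (k - m))"
        by (simp add: norm_mult)
      also have "\<dots> \<le> (4 * \<delta>) * norm (a (k - m))" by (intro mult_right_mono large True) auto
      also have "\<dots> \<le> 4 * \<delta> * (norm (a m) + norm (a (k - m)))" using \<delta> by (intro mult_left_mono) auto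
      finally show ?thesis .
    next
      case False
      have "\<bar>k\<bar> \<le> 2 * \<bar>k - m\<bar>" 
      proof -
        have "x \<le> 2 * z" if "\<not> x \<le> 2 * y" "x - y \<le> z" for x y z :: int using that by linarith
        from this[OF False abs_triangle_ineq2] show ?thesis .
      qed
      from large[OF this] have "(norm (a (k - m)) * (real_of_int k)\<^sup>2) * norm (a m) \<le> (4 * \<delta>) * norm (a m)"
        by (intro mult_right_mono) auto
      also have "\<dots> \<le> 4 * \<delta> * (norm (a m) + norm (a (k - m)))" using \<delta> by (intro mult_left_mono) auto
      finally show ?thesis by (simp add: norm_mult mult_ac)
    qed
    have coef: "norm (integral {0..1} (\<lambda>t. (g t * mode (- k) t) * P X t)) * (real_of_int k)\<^sup>2 \<le> 8 * \<delta> * A"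
      if X: "finite X" for X
    proof -
      have "integral {0..1} (\<lambda>t. (g t * mode (- k) t) * P X t) = integral {0..1} (\<lambda>t. \<Sum>m\<in>X. a m * (g t * mode (- (k - m)) t))"
      proof (rule arg_cong[where f = "integral {0..1}"], rule ext)
        fix t
        have "mode (- (k - m)) t = mode (- k) t * mode m t" for m by (simp flip: mode_add)
        then show "(g t * mode (- k) t) * P X t = (\<Sum>m\<in>X. a m * (g t * mode (- (k - m)) t))"
          by (simp add: P_def sum_distrib_left mult_ac)
      qed
      also have "\<dots> = (\<Sum>m\<in>X. integral {0..1} (\<lambda>t. a m * (g t * mode (- (k - m)) t)))"
        by (intro integral_sum X integrable_continuous_interval continuous_intros g(1))
      also have "\<dots> = (\<Sum>m\<in>X. a m * a (k - m))"
        by (simp add: a_def fcoef_def)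
      finally have "norm (integral {0..1} (\<lambda>t. (g t * mode (- k) t) * P X t)) * (real_of_int k)\<^sup>2
         \<le> (\<Sum>m\<in>X. norm (a m * a (k - m))) * (real_of_int k)\<^sup>2"
        by (simp add: mult_right_mono norm_sum)
      also have "\<dots> \<le> (\<Sum>m\<in>X. 4 * \<delta> * (norm (a m) + norm (a (k - m))))"
        unfolding sum_distrib_right by (intro sum_mono product)
      also have "\<dots> = 4 * \<delta> * ((\<Sum>m\<in>X. norm (a m)) + (\<Sum>m\<in>X. norm (a (k - m))))"
        by (simp only: sum_distrib_left[symmetric] sum.distrib)
      also have "(\<Sum>m\<in>X. norm (a (k - m))) = (\<Sum>m\<in>(\<lambda>m. k - m) ` X. norm (a m))"
        by (subst sum.reindex) (auto simp: inj_on_def)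
      also have "4 * \<delta> * ((\<Sum>m\<in>X. norm (a m)) + (\<Sum>m\<in>(\<lambda>m. k - m) ` X. norm (a m))) \<le> 4 * \<delta> * (A + A)"
        using \<delta> X by (intro mult_left_mono add_mono A(2)) auto
      finally show ?thesis by simp
    qed
    have gm: "(\<lambda>t. g t * mode (- k) t) absolutely_integrable_on {0..1}"
      by (intro absolutely_integrable_continuous_real continuous_intros g(1))
    define L where "L = L1_norm (\<lambda>t. g t * mode (- k) t)"
    have L0: "0 \<le> L" unfolding L_def by (rule L1_norm_nonneg)
    have "norm (fcoef (\<lambda>t. g t * g t) k) * (real_of_int k)\<^sup>2 \<le> 8 * \<delta> * A + e" if e: "0 < e" for e
    proof -
      define e' where "e' = e / ((L + 1) * (real_of_int k)\<^sup>2)"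
      have e': "0 < e'" using e L0 kpos by (simp add: e'_def)
      have "\<forall>\<^sub>F X in finite_subsets_at_top UNIV. \<forall>t\<in>{0..1}. dist (P X t) (g t) < e'"
        using unif e' unfolding uniform_limit_iff P_def by blast
      moreover have "\<forall>\<^sub>F X in finite_subsets_at_top (UNIV :: int set). finite X"
        unfolding eventually_finite_subsets_at_top by (intro exI[of _ "{}"]) auto
      ultimately have "\<forall>\<^sub>F X in finite_subsets_at_top (UNIV :: int set). (\<forall>t\<in>{0..1}. dist (P X t) (g t) < e') \<and> finite X"
        by eventually_elim auto
      from eventually_happens'[OF finite_subsets_at_top_neq_bot this]
      obtain X where X: "\<forall>t\<in>{0..1}. dist (P X t) (g t) < e'" "finite X"
        by blast
      define D where "D = integral {0..1} (\<lambda>t. (g t * mode (- k) t) * (g t - P X t))"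
      have "fcoef (\<lambda>t. g t * g t) k = D + integral {0..1} (\<lambda>t. (g t * mode (- k) t) * P X t)"
        unfolding fcoef_def D_def
        by (subst hk_integral_add[symmetric])
          (auto intro!: integrable_continuous_interval continuous_intros g(1) cP simp: algebra_simps)
      then have "norm (fcoef (\<lambda>t. g t * g t) k) * (real_of_int k)\<^sup>2 \<le> norm D * (real_of_int k)\<^sup>2
          + norm (integral {0..1} (\<lambda>t. (g t * mode (- k) t) * P X t)) * (real_of_int k)\<^sup>2"
        by (simp add: norm_triangle_ineq mult_right_mono flip: distrib_right)
      moreover have "norm D * (real_of_int k)\<^sup>2 \<le> e"
      proof -
        have "norm D \<le> e' * L"
          unfolding D_def L_def
        proof (rule norm_integral_mult_le[OF gm])
          show "norm (g t - P X t) \<le> e'" if "t \<in> {0..1}" for t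
            using X(1) that by (simp add: dist_norm norm_minus_commute less_imp_le)
        qed (auto intro!: continuous_intros g(1) cP)
        also have "\<dots> \<le> e' * (L + 1)" using e' by (intro mult_left_mono) auto
        finally have "norm D * (real_of_int k)\<^sup>2 \<le> e' * (L + 1) * (real_of_int k)\<^sup>2"
          by (rule mult_right_mono) simp
        also have "\<dots> = e" using L0 kpos by (simp add: e'_def)
        finally show ?thesis .
      qed
      ultimately show ?thesis using coef[OF X(2)] by linarith
    qed
    then have "norm (fcoef (\<lambda>t. g t * g t) k) * (real_of_int k)\<^sup>2 \<le> 8 * \<delta> * A" by (rule field_le_epsilon)
    also have "\<dots> \<le> 8 * \<delta> * (A + 1)" using \<delta> by simp
    also have "\<dots> = \<epsilon>" 
    proof -
      have "A + 1 \<noteq> 0" "8 * A + 8 \<noteq> 0" using A(1) by linarith+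
      then show ?thesis by (simp add: \<delta>_def field_simps)
    qed
    finally show ?thesis .
  qed
  then show ?thesis by blast
qed

section \<open>Second order asymptotics of the off-diagonal amplitude\<close>

definition osc :: "real \<Rightarrow> real \<Rightarrow> complex" where
  "osc k t = exp (\<i> * of_real (2 * k * t))"

definition osc_integral :: "(real \<Rightarrow> real) \<Rightarrow> real \<Rightarrow> complex" where
  "osc_integral f k = integral {0..1} (\<lambda>t. of_real (f t) * osc k t)"

lemma norm_osc [simp]: "norm (osc k t) = 1"
  by (simp add: osc_def)

lemma continuous_on_osc [continuous_intros]: "continuous_on S (osc k)"
  unfolding osc_def by (intro continuous_intros)

lemma Riemann_Lebesgue_eventually:
  assumes "f absolutely_integrable_on {0..1}" "0 < e"
  shows "\<forall>\<^sub>F k in at_top. \<forall>x\<in>{0..1}. norm (integral {0..x} (\<lambda>t. of_real (f t) * osc k t)) \<le> e"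
  unfolding osc_def eventually_at_top_linorder by (rule Riemann_Lebesgue_uniform[OF assms])

lemma osc_integral_small:
  assumes "f absolutely_integrable_on {0..1}" "0 < e"
  shows "\<forall>\<^sub>F k in at_top. norm (osc_integral f k) \<le> e"
  using Riemann_Lebesgue_eventually[OF assms] by eventually_elim (auto simp: osc_integral_def)

context mean_zero_potential
begin

lemma qc_integrable:
  fixes h :: "real \<Rightarrow> complex"
  assumes "continuous_on {0..1} h" "x \<in> {0..1}"
  shows "(\<lambda>t. of_real (q t) * h t) integrable_on {0..x}"
  using absolutely_integrable_on_unit_subinterval[OF absolutely_integrable_mult_continuous[OF qc_ai assms(1)], of 0 x] assms(2)
  by (auto simp: absolutely_integrable_on_def)

lemma continuous_on_Qc: "continuous_on {0..1} (\<lambda>t. complex_of_real (Q t))"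
  using abs_cont_Q by (rule abs_cont_deriv_continuous)

lemma continuous_on_A: "0 < k \<Longrightarrow> K \<le> k \<Longrightarrow> continuous_on {0..1} (A k)"
  and continuous_on_B: "0 < k \<Longrightarrow> K \<le> k \<Longrightarrow> continuous_on {0..1} (B k)"
  using AB(1)[of k] unfolding dirac_solution_def by (auto intro: abs_cont_deriv_continuous)

lemma B_eq:
  assumes k: "0 < k" "K \<le> k" and x: "x \<in> {0..1}"
  shows "B k x = \<i> / of_real (2 * k) *
    integral {0..x} (\<lambda>t. of_real (q t) * (osc k t * (exp (- (\<i> * of_real (Q t / k))) * A k t)))"
proof -
  have e: "exp (2 * phase k t) = osc k t * exp (- (\<i> * of_real (Q t / k)))" for t
    by (simp add: phase_def osc_def algebra_simps flip: exp_add)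
  have "abs_cont_deriv (B k) (\<lambda>t. cnj (coupling k t) * A k t)"
    using AB(1)[OF k] by (simp add: dirac_solution_def)
  from abs_cont_deriv_eq[OF this x]
  have "B k x = integral {0..x} (\<lambda>t. cnj (coupling k t) * A k t)" using k by simp
  also have "\<dots> = integral {0..x} (\<lambda>t. \<i> / of_real (2 * k) * (of_real (q t) * (osc k t * (exp (- (\<i> * of_real (Q t / k))) * A k t))))"
    unfolding cnj_coupling e by (simp only: mult.assoc)
  finally show ?thesis by simp
qed

lemma norm_exp_Q [simp]: "norm (exp (- (\<i> * of_real (Q t / k)))) = 1"
  by simp

lemma norm_exp_Q_minus_1_le:
  assumes "0 < k" "t \<in> {0..1}"
  shows "norm (exp (- (\<i> * of_real (Q t / k))) - 1) \<le> K / k"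
  using norm_iexp_minus_1_le[of "- (Q t / k)"] abs_Q_le[OF assms(2)] assms(1)
  by (simp add: divide_right_mono order_trans[OF _ divide_right_mono])

text \<open>The amplitude \<open>A k\<close> and the exponential of \<open>Q / k\<close> are \<open>1 + O(1 / k)\<close>, and what remains of the integral for
  \<open>B k x\<close> is small by the Riemann-Lebesgue lemma.\<close>

lemma B_uniformly_small:
  assumes "0 < \<epsilon>"
  shows "\<forall>\<^sub>F k in at_top. \<forall>x\<in>{0..1}. norm (B k x) \<le> \<epsilon> / k"
proof -
  define C where "C = K * (K\<^sup>2 + K)"
  have 1: "\<forall>\<^sub>F k in at_top. \<forall>x\<in>{0..1}. norm (integral {0..x} (\<lambda>t. of_real (q t) * osc k t)) \<le> \<epsilon>"
    using q_ai assms by (rule Riemann_Lebesgue_eventually)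
  have 2: "\<forall>\<^sub>F k in at_top. max 1 (max K (C / \<epsilon>)) \<le> k" by (rule eventually_ge_at_top)
  from 1 2 show ?thesis
  proof eventually_elim
    case (elim k)
    then have k: "0 < k" "K \<le> k" "1 \<le> k" and Ck: "C / k \<le> \<epsilon>" using assms by (auto simp: field_simps)
    show ?case
    proof
      fix x :: real assume x: "x \<in> {0..1}"
      define D where "D = (\<lambda>t. osc k t * (exp (- (\<i> * of_real (Q t / k))) * A k t - 1))"
      have cD: "continuous_on {0..1} D"
        unfolding D_def using k by (intro continuous_intros continuous_on_A continuous_on_Q) auto
      have Db: "norm (D t) \<le> (K\<^sup>2 + K) / k" if t: "t \<in> {0..1}" for t
      proof -
        have "exp (- (\<i> * of_real (Q t / k))) * A k t - 1 = exp (- (\<i> * of_real (Q t / k))) * (A k t - 1) + (exp (- (\<i> * of_real (Q t / k))) - 1)"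
          by (simp add: algebra_simps)
        then have "norm (D t) \<le> norm (A k t - 1) + norm (exp (- (\<i> * of_real (Q t / k))) - 1)"
          unfolding D_def norm_mult norm_osc
          by (metis mult_1 norm_exp_Q norm_mult norm_triangle_ineq)
        also have "\<dots> \<le> K\<^sup>2 / k\<^sup>2 + K / k"
          using AB_small(2)[OF k(1,2) t] norm_exp_Q_minus_1_le[OF k(1) t] by (rule add_mono)
        also have "K\<^sup>2 / k\<^sup>2 \<le> K\<^sup>2 / k"
          using k self_le_power[of k 2] by (intro divide_left_mono) auto
        finally show ?thesis by (simp add: add_divide_distrib)
      qed
      have "integral {0..x} (\<lambda>t. of_real (q t) * (osc k t * (exp (- (\<i> * of_real (Q t / k))) * A k t)))
        = integral {0..x} (\<lambda>t. of_real (q t) * osc k t + of_real (q t) * D t)"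
        by (simp add: D_def algebra_simps)
      also have "\<dots> = integral {0..x} (\<lambda>t. of_real (q t) * osc k t) + integral {0..x} (\<lambda>t. of_real (q t) * D t)"
        by (intro hk_integral_add qc_integrable cD x continuous_intros)
      also have "norm \<dots> \<le> \<epsilon> + (K\<^sup>2 + K) / k * K"
        using elim x norm_integral_mult_le[OF qc_ai cD Db x]
        by (intro order_trans[OF norm_triangle_ineq] add_mono) (auto simp: K_def)
      also have "\<dots> \<le> 2 * \<epsilon>" using Ck by (simp add: C_def mult.commute)
      finally have "norm (integral {0..x} (\<lambda>t. of_real (q t) * (osc k t * (exp (- (\<i> * of_real (Q t / k))) * A k t)))) \<le> 2 * \<epsilon>" .
      then have "norm (B k x) \<le> 1 / (2 * k) * (2 * \<epsilon>)"
        unfolding B_eq[OF k(1,2) x] norm_mult using k by (intro mult_mono) (auto simp: norm_divide)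
      then show "norm (B k x) \<le> \<epsilon> / k" by simp
    qed
  qed
qed

text \<open>Integrate \<open>coupling k * B k\<close>, where the first factor has mass \<open>O(1 / k)\<close> and the second one is \<open>o(1 / k)\<close>.\<close>

lemma A_uniformly_close:
  assumes "0 < \<epsilon>"
  shows "\<forall>\<^sub>F k in at_top. \<forall>x\<in>{0..1}. norm (A k x - 1) \<le> \<epsilon> / k\<^sup>2"
proof -
  define \<delta> where "\<delta> = \<epsilon> / (K + 1)"
  have \<delta>: "0 < \<delta>" using assms K_nonneg by (simp add: \<delta>_def)
  have 2: "\<forall>\<^sub>F k in at_top. max 1 K \<le> k" by (rule eventually_ge_at_top)
  from B_uniformly_small[OF \<delta>] 2 show ?thesis
  proof eventually_elim
    case (elim k)
    then have k: "0 < k" "K \<le> k" by auto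
    show ?case
    proof
      fix x :: real assume x: "x \<in> {0..1}"
      have "abs_cont_deriv (A k) (\<lambda>t. coupling k t * B k t)"
        using AB(1)[OF k] by (simp add: dirac_solution_def)
      from abs_cont_deriv_eq[OF this x]
      have "A k x - 1 = integral {0..x} (\<lambda>t. coupling k t * B k t)" using k by simp
      also have "norm \<dots> \<le> (\<delta> / k) * (K / (2 * k))"
        unfolding L1_norm_coupling[OF k(1), symmetric]
        by (rule norm_integral_mult_le[OF coupling_ai continuous_on_B[OF k] _ x]) (use elim in auto)
      also have "\<dots> = (\<delta> * K / 2) / k\<^sup>2" by (simp add: power2_eq_square)
      also have "\<dots> \<le> \<epsilon> / k\<^sup>2"
      proof (rule divide_right_mono)
        have "\<delta> * K / 2 \<le> \<delta> * (K + 1)" using \<delta> K_nonneg by (simp add: field_simps)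
        also have "\<dots> = \<epsilon>" using K_nonneg by (simp add: \<delta>_def)
        finally show "\<delta> * K / 2 \<le> \<epsilon>" .
      qed simp
      finally show "norm (A k x - 1) \<le> \<epsilon> / k\<^sup>2" .
    qed
  qed
qed

text \<open>In the integral for \<open>B k 1\<close>, replacing \<open>A k\<close> by \<open>1\<close> costs \<open>o(k\<^sup>-\<^sup>2)\<close>, and in the expansion of the exponential of
  \<open>Q / k\<close> the quadratic term is \<open>O(k\<^sup>-\<^sup>2)\<close> times an oscillatory integral, hence \<open>o(k\<^sup>-\<^sup>2)\<close>.\<close>

lemma second_order_expansion:
  assumes "0 < \<epsilon>"
  shows "\<forall>\<^sub>F k in at_top. norm (osc_integral q k - \<i> / of_real k * osc_integral (\<lambda>t. q t * Q t) k)
           \<le> 2 * k * norm (B k 1) + \<epsilon> / k\<^sup>2"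
proof -
  define \<delta> where "\<delta> = \<epsilon> / (K + 1)"
  have \<delta>: "0 < \<delta>" using assms K_nonneg by (simp add: \<delta>_def)
  have qQ2: "(\<lambda>t. q t * (Q t)\<^sup>2) absolutely_integrable_on {0..1}"
    by (intro absolutely_integrable_mult_continuous q_ai continuous_intros continuous_on_Q)
  have 1: "\<forall>\<^sub>F k in at_top. norm (osc_integral (\<lambda>t. q t * (Q t)\<^sup>2) k) \<le> \<epsilon> / 2"
    using qQ2 assms by (intro osc_integral_small) auto
  \<comment> \<open>the last bound makes the cubic Taylor remainder negligible\<close>
  have 2: "\<forall>\<^sub>F k in at_top. max 1 (max K (2 * K ^ 4 / \<epsilon>)) \<le> k" by (rule eventually_ge_at_top)
  have 3: "\<forall>\<^sub>F k in at_top. \<forall>x\<in>{0..1}. norm (A k x - 1) \<le> \<epsilon> / (4 * (K + 1)) / k\<^sup>2"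
    by (rule A_uniformly_close) (use assms K_nonneg in simp)
  from 1 2 3 show ?thesis
  proof eventually_elim
    case (elim k)
    then have k: "0 < k" "K \<le> k" "1 \<le> k" and K4: "K ^ 4 / k \<le> \<epsilon> / 2" using assms by (auto simp: field_simps)
    have k0: "complex_of_real k \<noteq> 0" using k by simp
    define X where "X = (\<lambda>t. exp (- (\<i> * of_real (Q t / k))))"
    define T where "T = (\<lambda>h. integral {0..1} (\<lambda>t. of_real (q t) * (osc k t * h t)))"
    have Tadd: "T (\<lambda>t. g t + h t) = T g + T h" if "continuous_on {0..1} g" "continuous_on {0..1} h" for g h
    proof -
      have "T (\<lambda>t. g t + h t) = integral {0..1} (\<lambda>t. of_real (q t) * (osc k t * g t) + of_real (q t) * (osc k t * h t))"
        by (simp add: T_def algebra_simps)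
      also have "\<dots> = T g + T h" unfolding T_def
        by (intro hk_integral_add qc_integrable continuous_intros that) auto
      finally show ?thesis .
    qed
    have Tmult: "T (\<lambda>t. c * h t) = c * T h" for c h
    proof -
      have "T (\<lambda>t. c * h t) = integral {0..1} (\<lambda>t. c * (of_real (q t) * (osc k t * h t)))"
        by (simp add: T_def mult_ac)
      then show ?thesis by (simp add: T_def)
    qed
    have Tbound: "norm (T h) \<le> c * K" if "continuous_on {0..1} h" "\<And>t. t \<in> {0..1} \<Longrightarrow> norm (h t) \<le> c" for c h
      unfolding T_def K_def
      by (rule norm_integral_mult_le[OF qc_ai]) (use that in \<open>auto intro!: continuous_intros simp: norm_mult\<close>)
    have cX: "continuous_on {0..1} X" unfolding X_def using k by (intro continuous_intros continuous_on_Q) auto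
    note cA = continuous_on_A[OF k(1,2)]
    have nX: "norm (X t) = 1" for t by (simp add: X_def)
    \<comment> \<open>replacing \<open>A\<close> by \<open>1\<close>\<close>
    define a1 where "a1 = T (\<lambda>t. X t * (A k t + - 1))"
    have TXA: "T (\<lambda>t. X t * A k t) = T X + a1"
      unfolding a1_def by (subst Tadd[symmetric]) (auto intro!: continuous_intros cX cA simp: algebra_simps)
    have a1: "norm a1 \<le> \<epsilon> / (4 * k\<^sup>2)"
    proof -
      have "norm a1 \<le> (\<epsilon> / (4 * (K + 1)) / k\<^sup>2) * K"
        unfolding a1_def using elim assms K_nonneg
        by (intro Tbound continuous_intros cX cA) (auto simp: norm_mult nX)
      also have "\<dots> = \<epsilon> / (4 * k\<^sup>2) * (K / (K + 1))" by (simp add: field_simps)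
      also have "\<dots> \<le> \<epsilon> / (4 * k\<^sup>2) * 1" using assms K_nonneg by (intro mult_left_mono) (auto simp: field_simps)
      finally show ?thesis by simp
    qed
    have "B k 1 = \<i> / of_real (2 * k) * T (\<lambda>t. X t * A k t)"
      using B_eq[OF k(1,2), of 1] by (simp add: T_def X_def)
    then have "norm (B k 1) = norm (T (\<lambda>t. X t * A k t)) / (2 * k)" using k by (simp add: norm_mult norm_divide)
    then have nT: "norm (T (\<lambda>t. X t * A k t)) = 2 * k * norm (B k 1)" using k by simp
    \<comment> \<open>expanding \<open>X\<close> to second order\<close>
    define Rm where "Rm = (\<lambda>t. X t + (- 1 + (\<i> / of_real k * of_real (Q t) + of_real (1 / (2 * k\<^sup>2)) * of_real ((Q t)\<^sup>2))))"
    have cR: "continuous_on {0..1} Rm"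
      unfolding Rm_def using k by (intro continuous_intros cX continuous_on_Q) auto
    have Rb: "norm (Rm t) \<le> K ^ 3 / (2 * k ^ 3)" if t: "t \<in> {0..1}" for t
    proof -
      have "Rm t = exp (\<i> * of_real (- (Q t / k))) - 1 - \<i> * of_real (- (Q t / k)) + of_real ((- (Q t / k))\<^sup>2) / 2"
        by (simp add: Rm_def X_def power_divide)
      then have "norm (Rm t) \<le> \<bar>Q t / k\<bar> ^ 3 / 2" using norm_iexp_Taylor2[of "- (Q t / k)"] by simp
      also have "\<dots> \<le> (K / k) ^ 3 / 2"
        using abs_Q_le[OF t] k by (intro divide_right_mono power_mono) (auto intro: divide_right_mono)
      finally show ?thesis by (simp add: power_divide)
    qed
    have TX: "T X = osc_integral q k - \<i> / of_real k * osc_integral (\<lambda>t. q t * Q t) k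
        - of_real (1 / (2 * k\<^sup>2)) * osc_integral (\<lambda>t. q t * (Q t)\<^sup>2) k + T Rm"
    proof -
      have "T Rm = T X + (T (\<lambda>t. - 1) + (T (\<lambda>t. \<i> / of_real k * of_real (Q t)) + T (\<lambda>t. of_real (1 / (2 * k\<^sup>2)) * of_real ((Q t)\<^sup>2))))"
        unfolding Rm_def
        by (subst Tadd, (intro continuous_intros cX continuous_on_Q; simp add: k0)+)+ simp
      moreover have "T (\<lambda>t. - 1) = - osc_integral q k"
        using Tmult[of "-1" "\<lambda>t. 1"] by (simp add: T_def osc_integral_def)
      moreover have "T (\<lambda>t. of_real (Q t)) = osc_integral (\<lambda>t. q t * Q t) k"
        "T (\<lambda>t. of_real ((Q t)\<^sup>2)) = osc_integral (\<lambda>t. q t * (Q t)\<^sup>2) k"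
        by (simp_all add: T_def osc_integral_def mult_ac)
      ultimately show ?thesis unfolding Tmult by simp
    qed
    have "osc_integral q k - \<i> / of_real k * osc_integral (\<lambda>t. q t * Q t) k
      = T (\<lambda>t. X t * A k t) - a1 + of_real (1 / (2 * k\<^sup>2)) * osc_integral (\<lambda>t. q t * (Q t)\<^sup>2) k - T Rm"
      unfolding TXA TX by simp
    also have "norm \<dots> \<le> norm (T (\<lambda>t. X t * A k t)) + norm a1 + norm (of_real (1 / (2 * k\<^sup>2)) * osc_integral (\<lambda>t. q t * (Q t)\<^sup>2) k) + norm (T Rm)"
      by (intro order_trans[OF norm_triangle_ineq4] order_trans[OF norm_triangle_ineq] add_mono order_refl norm_triangle_ineq4)
    also have "\<dots> \<le> 2 * k * norm (B k 1) + \<epsilon> / (4 * k\<^sup>2) + (1 / (2 * k\<^sup>2)) * (\<epsilon> / 2) + \<epsilon> / (4 * k\<^sup>2)"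
    proof (intro add_mono a1)
      show "norm (T (\<lambda>t. X t * A k t)) \<le> 2 * k * norm (B k 1)" using nT by simp
      have "norm (of_real (1 / (2 * k\<^sup>2)) * osc_integral (\<lambda>t. q t * (Q t)\<^sup>2) k) = 1 / (2 * k\<^sup>2) * norm (osc_integral (\<lambda>t. q t * (Q t)\<^sup>2) k)"
        unfolding norm_mult norm_of_real by simp
      also have "\<dots> \<le> (1 / (2 * k\<^sup>2)) * (\<epsilon> / 2)" using elim(1) by (intro mult_left_mono) auto
      finally show "norm (of_real (1 / (2 * k\<^sup>2)) * osc_integral (\<lambda>t. q t * (Q t)\<^sup>2) k) \<le> (1 / (2 * k\<^sup>2)) * (\<epsilon> / 2)" .
      have "norm (T Rm) \<le> K ^ 3 / (2 * k ^ 3) * K" by (rule Tbound[OF cR Rb])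
      also have "\<dots> = (K ^ 4 / k) / (2 * k\<^sup>2)" by (simp add: eval_nat_numeral field_simps)
      also have "\<dots> \<le> (\<epsilon> / 2) / (2 * k\<^sup>2)" using K4 by (intro divide_right_mono) auto
      finally show "norm (T Rm) \<le> \<epsilon> / (4 * k\<^sup>2)" by simp
    qed
    also have "\<dots> \<le> 2 * k * norm (B k 1) + \<epsilon> / k\<^sup>2"
      using assms k by (simp add: field_simps)
    finally show ?case .
  qed
qed

end

section \<open>Fourier coefficients of the potential and of the squared primitive\<close>

lemma osc_pi: "osc (real n * pi) = mode (int n)"
  by (simp add: osc_def mode_def fun_eq_iff mult_ac)

lemma abs_cont_mode: "abs_cont_deriv (mode m) (\<lambda>t. (2 * of_real pi * of_int m * \<i>) * mode m t)"
proof (rule abs_cont_deriv_C1)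
  fix t :: real
  define c where "c = 2 * complex_of_real pi * of_int m * \<i>"
  have "((\<lambda>z. exp (c * z)) has_field_derivative c * exp (c * of_real t)) (at (of_real t))"
    by (auto intro!: derivative_eq_intros)
  from has_vector_derivative_real_field[OF this, of "{0..1}"]
  show "(mode m has_vector_derivative (2 * of_real pi * of_int m * \<i>) * mode m t) (at t within {0..1})"
    by (simp add: mode_def[abs_def] c_def mult_ac)
qed (intro continuous_intros)

lemma integration_by_parts_mode:
  assumes f: "abs_cont_deriv f f'" and "f 0 = f 1"
  shows "integral {0..1} (\<lambda>t. f' t * mode m t) = - (2 * of_real pi * of_int m * \<i>) * fcoef f (- m)"
proof -
  have cf: "continuous_on {0..1} f" using f by (rule abs_cont_deriv_continuous)
  have "abs_cont_deriv (\<lambda>t. f t * mode m t) (\<lambda>t. f' t * mode m t + f t * ((2 * of_real pi * of_int m * \<i>) * mode m t))"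
    by (intro abs_cont_deriv_mult f abs_cont_mode)
  from abs_cont_deriv_diff_eq[OF this, of 0 1]
  have "0 = integral {0..1} (\<lambda>t. f' t * mode m t + f t * ((2 * of_real pi * of_int m * \<i>) * mode m t))"
    using assms(2) by simp
  also have "\<dots> = integral {0..1} (\<lambda>t. f' t * mode m t) + integral {0..1} (\<lambda>t. f t * ((2 * of_real pi * of_int m * \<i>) * mode m t))"
  proof (rule hk_integral_add)
    show "(\<lambda>t. f' t * mode m t) integrable_on {0..1}"
      using absolutely_integrable_mult_continuous[OF abs_cont_deriv_integrable[OF f] continuous_on_mode]
      by (auto simp: absolutely_integrable_on_def)
    show "(\<lambda>t. f t * ((2 * of_real pi * of_int m * \<i>) * mode m t)) integrable_on {0..1}"
      by (intro integrable_continuous_interval continuous_intros cf)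
  qed
  also have "(\<lambda>t. f t * ((2 * of_real pi * of_int m * \<i>) * mode m t)) = (\<lambda>t. (2 * of_real pi * of_int m * \<i>) * (f t * mode m t))"
    by (rule ext) (rule mult.left_commute)
  finally show ?thesis by (simp add: fcoef_def eq_neg_iff_add_eq_0)
qed

context mean_zero_potential
begin

text \<open>The first order term is kept as an oscillatory integral, because only its smallness makes the shift by
  \<open>O(n\<^sup>-\<^sup>2)\<close> from \<open>k\<close> to \<open>n \<pi>\<close> harmless.\<close>

lemma osc_integral_q_shift:
  "norm (osc_integral q k - osc_integral q k0) \<le> 2 * \<bar>k - k0\<bar> * norm (osc_integral (\<lambda>t. q t * t) k0) + 4 * (k - k0)\<^sup>2 * K"
proof -
  define d where "d = k - k0"
  define r where "r = (\<lambda>t. exp (\<i> * of_real (2 * d * t)) - 1 - \<i> * of_real (2 * d * t))"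
  have cr: "continuous_on {0..1} (\<lambda>t. osc k0 t * r t)" unfolding r_def by (intro continuous_intros)
  have rb: "norm (osc k0 t * r t) \<le> 4 * d\<^sup>2" if "t \<in> {0..1}" for t
  proof -
    have "norm (r t) \<le> (2 * d * t)\<^sup>2" unfolding r_def by (rule norm_iexp_Taylor1)
    also have "\<dots> = 4 * d\<^sup>2 * t\<^sup>2" by (simp add: power_mult_distrib)
    also have "\<dots> \<le> 4 * d\<^sup>2 * 1" using that by (intro mult_left_mono) (auto simp: power_le_one)
    finally show ?thesis by (simp add: norm_mult)
  qed
  have int: "(\<lambda>t. of_real (q t) * osc k0 t) integrable_on {0..1}"
    "(\<lambda>t. of_real (q t) * (2 * \<i> * of_real d * (of_real t * osc k0 t))) integrable_on {0..1}"
    "(\<lambda>t. of_real (q t) * (osc k0 t * r t)) integrable_on {0..1}"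
    by (intro qc_integrable continuous_intros cr; simp)+
  have "osc_integral q k = integral {0..1} (\<lambda>t. of_real (q t) * osc k0 t + (of_real (q t) * (2 * \<i> * of_real d * (of_real t * osc k0 t)) + of_real (q t) * (osc k0 t * r t)))"
  proof -
    have "osc k t = osc k0 t * exp (\<i> * of_real (2 * d * t))" for t
      by (simp add: osc_def d_def algebra_simps flip: exp_add)
    then show ?thesis unfolding osc_integral_def by (simp add: r_def algebra_simps)
  qed
  also have "\<dots> = osc_integral q k0 + (integral {0..1} (\<lambda>t. of_real (q t) * (2 * \<i> * of_real d * (of_real t * osc k0 t))) 
      + integral {0..1} (\<lambda>t. of_real (q t) * (osc k0 t * r t)))"
    using int by (simp add: hk_integral_add integrable_add osc_integral_def)
  also have "(\<lambda>t. of_real (q t) * (2 * \<i> * of_real d * (of_real t * osc k0 t))) = (\<lambda>t. 2 * \<i> * of_real d * (of_real (q t * t) * osc k0 t))"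
    by (simp add: mult_ac)
  also have "integral {0..1} (\<lambda>t. 2 * \<i> * of_real d * (of_real (q t * t) * osc k0 t)) = 2 * \<i> * of_real d * osc_integral (\<lambda>t. q t * t) k0"
    by (simp add: osc_integral_def)
  finally have "osc_integral q k - osc_integral q k0 = 2 * \<i> * of_real d * osc_integral (\<lambda>t. q t * t) k0 + integral {0..1} (\<lambda>t. of_real (q t) * (osc k0 t * r t))"
    by simp
  also have "norm \<dots> \<le> norm (2 * \<i> * of_real d * osc_integral (\<lambda>t. q t * t) k0) + norm (integral {0..1} (\<lambda>t. of_real (q t) * (osc k0 t * r t)))"
    by (rule norm_triangle_ineq)
  also have "\<dots> \<le> 2 * \<bar>d\<bar> * norm (osc_integral (\<lambda>t. q t * t) k0) + 4 * d\<^sup>2 * K"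
    using norm_integral_mult_le[OF qc_ai cr rb, of 1] by (simp add: norm_mult K_def)
  finally show ?thesis by (simp add: d_def)
qed

lemma norm_osc_integral_qQ_le: "norm (osc_integral (\<lambda>t. q t * Q t) k) \<le> K\<^sup>2"
proof -
  have "norm (integral {0..1} (\<lambda>t. of_real (q t) * (of_real (Q t) * osc k t))) \<le> K * L1_norm (\<lambda>t. of_real (q t))"
  proof (rule norm_integral_mult_le[OF qc_ai])
    show "continuous_on {0..1} (\<lambda>t. of_real (Q t) * osc k t)" by (intro continuous_intros continuous_on_Q)
    show "norm (of_real (Q t) * osc k t) \<le> K" if "t \<in> {0..1}" for t
      using abs_Q_le[OF that] by (simp add: norm_mult)
  qed simp
  then show ?thesis by (simp add: osc_integral_def K_def power2_eq_square mult.assoc)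
qed

lemma osc_integral_qQ_shift:
  "norm (osc_integral (\<lambda>t. q t * Q t) k - osc_integral (\<lambda>t. q t * Q t) k0) \<le> 2 * \<bar>k - k0\<bar> * K\<^sup>2"
proof -
  have int: "(\<lambda>t. of_real (q t) * (of_real (Q t) * osc j t)) integrable_on {0..1}" for j
    by (intro qc_integrable continuous_intros continuous_on_Q; simp)
  have "osc_integral (\<lambda>t. q t * Q t) k - osc_integral (\<lambda>t. q t * Q t) k0
     = integral {0..1} (\<lambda>t. of_real (q t) * (of_real (Q t) * (osc k t - osc k0 t)))"
  proof -
    have "osc_integral (\<lambda>t. q t * Q t) j = integral {0..1} (\<lambda>t. of_real (q t) * (of_real (Q t) * osc j t))" for j
      by (simp add: osc_integral_def mult.assoc)
    then show ?thesis
      using hk_integral_diff[OF int[of k] int[of k0]]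
      by (simp only: right_diff_distrib)
  qed
  also have "norm \<dots> \<le> (K * (2 * \<bar>k - k0\<bar>)) * L1_norm (\<lambda>t. of_real (q t))"
  proof (rule norm_integral_mult_le[OF qc_ai])
    show "continuous_on {0..1} (\<lambda>t. of_real (Q t) * (osc k t - osc k0 t))"
      by (intro continuous_intros continuous_on_Q)
    fix t :: real assume t: "t \<in> {0..1}"
    have "norm (osc k t - osc k0 t) \<le> \<bar>2 * k * t - 2 * k0 * t\<bar>" unfolding osc_def by (rule norm_iexp_diff_le)
    also have "2 * k * t - 2 * k0 * t = 2 * (k - k0) * t" by (simp add: algebra_simps)
    also have "\<bar>2 * (k - k0) * t\<bar> = 2 * \<bar>k - k0\<bar> * t" using t by (simp only: abs_mult) simp
    also have "\<dots> \<le> 2 * \<bar>k - k0\<bar> * 1" using t by (intro mult_left_mono) auto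
    finally show "norm (of_real (Q t) * (osc k t - osc k0 t)) \<le> K * (2 * \<bar>k - k0\<bar>)"
      unfolding norm_mult using abs_Q_le[OF t] by (intro mult_mono) auto
  qed simp
  finally show ?thesis by (simp add: K_def power2_eq_square mult_ac)
qed

text \<open>At an eigenvalue the multiplier has distance \<open>norm (B k 1)\<close> from \<open>1\<close>, and it differs from
  \<open>exp (\<i> * (k - n * pi))\<close> only by \<open>norm (A k 1 - 1)\<close>.\<close>

lemma eigenvalue_location:
  assumes k: "0 < k" "K \<le> k" and near: "\<bar>k - real n * pi\<bar> \<le> 1/2" and R: "Re (multiplier ((-1) ^ n) k) = 1"
  shows "\<bar>k - real n * pi\<bar> \<le> 2 * (norm (B k 1) + K\<^sup>2 / k\<^sup>2)"
proof -
  define d where "d = k - real n * pi"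
  define E where "E = exp (\<i> * complex_of_real d)"
  have m: "multiplier ((-1) ^ n) k = E * A k 1"
    using multiplier_near_integer[of n d] by (simp add: d_def E_def)
  have "(norm (1 - multiplier ((-1) ^ n) k))\<^sup>2 = (norm (B k 1))\<^sup>2"
    using norm_one_minus_multiplier_sq[OF k sign_power, of n] R by simp
  then have b: "norm (1 - E * A k 1) = norm (B k 1)" unfolding m by (rule power2_eq_imp_eq) auto
  have "\<bar>d\<bar> / 2 \<le> norm (E - 1)" unfolding E_def by (rule norm_iexp_minus_1_ge) (use near in \<open>simp add: d_def\<close>)
  also have "E - 1 = - (1 - E * A k 1) - E * (A k 1 - 1)" by (simp add: algebra_simps)
  also have "norm \<dots> \<le> norm (1 - E * A k 1) + norm (E * (A k 1 - 1))"
    using norm_triangle_ineq4[of "- (1 - E * A k 1)" "E * (A k 1 - 1)"] by (simp only: norm_minus_cancel)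
  also have "norm (E * (A k 1 - 1)) = norm (A k 1 - 1)" by (simp add: norm_mult E_def)
  also have "norm (1 - E * A k 1) + norm (A k 1 - 1) \<le> norm (B k 1) + K\<^sup>2 / k\<^sup>2"
    using b AB_small(2)[OF k, of 1] by simp
  finally have "\<bar>d\<bar> / 2 \<le> norm (B k 1) + K\<^sup>2 / k\<^sup>2" .
  moreover have "y \<le> 2 * z" if "y / 2 \<le> z" for y z :: real using that by simp
  ultimately show ?thesis unfolding d_def by blast
qed

text \<open>Four errors are collected, each multiplied by \<open>n\<^sup>2\<close>: that of the expansion at the eigenvalue \<open>k\<close>, and those
  of replacing \<open>k\<close> by \<open>n \<pi>\<close> in the first integral, in the second integral and in its factor
  \<open>\<i> / k\<close>.  The last three are controlled by \<open>\<bar>k - n \<pi>\<bar> \<le> c / n\<^sup>2\<close>.\<close>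

lemma coefficient_relation:
  assumes H: "\<And>\<epsilon>. 0 < \<epsilon> \<Longrightarrow> \<forall>\<^sub>F n in sequentially. small_B_near \<epsilon> n"
    and \<epsilon>: "0 < \<epsilon>"
  shows "\<forall>\<^sub>F n in sequentially. norm (osc_integral q (real n * pi)
           - \<i> / of_real (real n * pi) * osc_integral (\<lambda>t. q t * Q t) (real n * pi)) * (real n)\<^sup>2 \<le> \<epsilon>"
proof -
  \<comment> \<open>by \<open>eigenvalue_location\<close>, \<open>c / n\<^sup>2\<close> bounds the distance of \<open>k\<close> from \<open>n \<pi>\<close>\<close>
  define c where "c = 2 + 2 * K\<^sup>2"
  have c: "2 \<le> c" by (simp add: c_def)
  \<comment> \<open>the four errors below add up to at most \<open>(14 + 2 * c) * \<delta>\<close>\<close>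
  define \<delta> where "\<delta> = min 1 (\<epsilon> / (14 + 2 * c))"
  have \<delta>: "0 < \<delta>" "\<delta> \<le> 1" "(14 + 2 * c) * \<delta> \<le> \<epsilon>"
  proof -
    have pos: "0 < 14 + 2 * c" using c by simp
    then show "0 < \<delta>" using \<epsilon> by (simp add: \<delta>_def)
    show "\<delta> \<le> 1" by (simp add: \<delta>_def)
    have "\<delta> \<le> \<epsilon> / (14 + 2 * c)" by (simp add: \<delta>_def)
    then show "(14 + 2 * c) * \<delta> \<le> \<epsilon>" using pos by (simp add: pos_le_divide_eq mult.commute)
  qed
  have npi: "filterlim (\<lambda>n. real n * pi) at_top sequentially"
    by (intro filterlim_at_top_mult_tendsto_pos[OF tendsto_const] filterlim_real_sequentially) simp
  have nh: "filterlim (\<lambda>n. real n * pi - 1) at_top sequentially"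
    using filterlim_tendsto_add_at_top[OF tendsto_const npi, of "-1"] by simp
  have qt: "(\<lambda>t. q t * t) absolutely_integrable_on {0..1}"
    by (intro absolutely_integrable_mult_continuous q_ai continuous_intros)
  have 1: "\<forall>\<^sub>F n in sequentially. norm (osc_integral (\<lambda>t. q t * t) (real n * pi)) \<le> \<delta>"
    using eventually_compose_filterlim[OF osc_integral_small[OF qt \<delta>(1)] npi] .
  obtain k1 where k1: "\<And>k. k1 \<le> k \<Longrightarrow> norm (osc_integral q k - \<i> / of_real k * osc_integral (\<lambda>t. q t * Q t) k)
           \<le> 2 * k * norm (B k 1) + \<delta> / k\<^sup>2"
    using second_order_expansion[OF \<delta>(1)] unfolding eventually_at_top_linorder by blast
  have 2: "\<forall>\<^sub>F n in sequentially. max k1 K \<le> real n * pi - 1"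
    using nh unfolding filterlim_at_top by blast
  have 3: "\<forall>\<^sub>F n in sequentially. max 1 ((4 * c\<^sup>2 * K + 2 * c * K\<^sup>2) / \<delta>) \<le> real n"
    using filterlim_real_sequentially unfolding filterlim_at_top by blast
  from 1 2 3 H[OF \<delta>(1)] show ?thesis
  proof eventually_elim
    case (elim n)
    define N where "N = real n"
    have N: "1 \<le> N" and big: "4 * c\<^sup>2 * K + 2 * c * K\<^sup>2 \<le> \<delta> * N"
      using elim(3) \<delta>(1) by (auto simp: N_def field_simps)
    have N2: "N \<le> N\<^sup>2" "0 < N\<^sup>2" using N self_le_power[of N 2] by auto
    from elim(4)[unfolded small_B_near_def] obtain k where near: "\<bar>k - N * pi\<bar> \<le> 1/2" and R: "Re (multiplier ((-1) ^ n) k) = 1"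
      and Bk: "norm (B k 1) \<le> \<delta> / N ^ 3" unfolding N_def by blast
    have pi3: "N * 3 \<le> N * pi" "N * pi \<le> N * 4"
      using N pi_gt3 pi_less_4 by (intro mult_left_mono; simp)+
    have k: "K \<le> k" "k1 \<le> k" "N \<le> k" "k \<le> 5 * N" "0 < k"
    proof -
      have "k1 \<le> N * pi - 1" "K \<le> N * pi - 1" using elim(2) unfolding N_def by auto
      then show "K \<le> k" "k1 \<le> k" "N \<le> k" "k \<le> 5 * N" "0 < k" using near pi3 N by linarith+
    qed
    have kp: "0 < k\<^sup>2" "N\<^sup>2 \<le> k\<^sup>2" using k N by (auto intro: power_mono)
    define d where "d = k - N * pi"
    have d: "\<bar>d\<bar> \<le> c / N\<^sup>2"
    proof -
      have "\<bar>d\<bar> \<le> 2 * (norm (B k 1) + K\<^sup>2 / k\<^sup>2)"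
        unfolding d_def N_def by (rule eigenvalue_location[OF k(5,1) near[unfolded N_def] R])
      also have "norm (B k 1) \<le> 1 / N\<^sup>2"
      proof -
        have "norm (B k 1) \<le> \<delta> / N ^ 3" by (rule Bk)
        also have "\<dots> \<le> 1 / N\<^sup>2" using \<delta> N N2 power_increasing[of 2 3 N] by (intro frac_le) auto
        finally show ?thesis .
      qed
      also have "K\<^sup>2 / k\<^sup>2 \<le> K\<^sup>2 / N\<^sup>2" using kp N2 by (intro divide_left_mono) auto
      also have "2 * (1 / N\<^sup>2 + K\<^sup>2 / N\<^sup>2) = c / N\<^sup>2" by (simp add: c_def add_divide_distrib)
      finally show ?thesis by simp
    qed
    have dN: "\<bar>d\<bar> * N\<^sup>2 \<le> c" using d N2 by (simp add: field_simps)
    define D G where "D = osc_integral q" and "G = osc_integral (\<lambda>t. q t * Q t)"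
    define x where "x = N * pi"
    have x: "N \<le> x" "0 < x" using pi3 N by (auto simp: x_def)
    define e1 e2 e3 e4 where e: "e1 = D k - \<i> / of_real k * G k" "e2 = D k - D x"
      "e3 = \<i> / of_real k * (G k - G x)" "e4 = \<i> * of_real (1 / k - 1 / x) * G x"
    have "D x - \<i> / of_real x * G x = e1 - e2 + e3 + e4"
      by (simp add: e algebra_simps)
    also have "norm \<dots> \<le> norm e1 + norm e2 + norm e3 + norm e4"
      by (intro order_trans[OF norm_triangle_ineq] order_trans[OF norm_triangle_ineq4] add_mono order_refl norm_triangle_ineq4)
    finally have "norm (D x - \<i> / of_real x * G x) * N\<^sup>2 \<le> (norm e1 + norm e2 + norm e3 + norm e4) * N\<^sup>2"
      by (rule mult_right_mono) simp
    also have "\<dots> = norm e1 * N\<^sup>2 + norm e2 * N\<^sup>2 + norm e3 * N\<^sup>2 + norm e4 * N\<^sup>2"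
      by (simp only: distrib_right)
    also have "\<dots> \<le> 11 * \<delta> + (2 * c * \<delta> + \<delta>) + \<delta> + \<delta>"
    proof (intro add_mono)
      have "2 * k * norm (B k 1) \<le> 2 * (5 * N) * (\<delta> / N ^ 3)" using k Bk N by (intro mult_mono) auto
      also have "\<dots> = 10 * \<delta> / N\<^sup>2" using N by (simp add: eval_nat_numeral)
      finally have "norm e1 \<le> 10 * \<delta> / N\<^sup>2 + \<delta> / N\<^sup>2"
        using k1[OF k(2)] kp N2 \<delta> divide_left_mono[of "N\<^sup>2" "k\<^sup>2" \<delta>] unfolding e D_def G_def by simp
      then show "norm e1 * N\<^sup>2 \<le> 11 * \<delta>" using N2 by (simp add: field_simps)
    next
      have "norm e2 \<le> 2 * \<bar>d\<bar> * \<delta> + 4 * d\<^sup>2 * K"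
        using osc_integral_q_shift[of k x] elim(1) mult_left_mono[OF elim(1), of "2 * \<bar>d\<bar>"]
        unfolding e D_def d_def x_def N_def by simp
      then have "norm e2 * N\<^sup>2 \<le> (2 * \<bar>d\<bar> * \<delta> + 4 * d\<^sup>2 * K) * N\<^sup>2" by (rule mult_right_mono) simp
      also have "\<dots> = 2 * \<delta> * (\<bar>d\<bar> * N\<^sup>2) + 4 * (\<bar>d\<bar> * N\<^sup>2)\<^sup>2 * K / N\<^sup>2"
        using N2 by (simp add: power2_eq_square field_simps)
      also have "\<dots> \<le> 2 * \<delta> * c + 4 * c\<^sup>2 * K / N\<^sup>2"
        using dN \<delta> K_nonneg by (intro add_mono mult_left_mono divide_right_mono mult_right_mono power_mono) auto
      also have "4 * c\<^sup>2 * K / N\<^sup>2 \<le> \<delta>"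
      proof -
        have "0 \<le> 2 * c * K\<^sup>2" using c by simp
        then have "4 * c\<^sup>2 * K \<le> \<delta> * N" using big by linarith
        also have "\<dots> \<le> \<delta> * N\<^sup>2" using N2(1) \<delta>(1) by (intro mult_left_mono) auto
        finally have "4 * c\<^sup>2 * K \<le> \<delta> * N\<^sup>2" .
        then show ?thesis using N2 by (simp add: field_simps)
      qed
      finally show "norm e2 * N\<^sup>2 \<le> 2 * c * \<delta> + \<delta>" by (simp add: mult_ac)
    next
      have "norm e3 \<le> 1 / N * (2 * \<bar>d\<bar> * K\<^sup>2)"
        unfolding e norm_mult using osc_integral_qQ_shift[of k x] k N
        by (intro mult_mono) (auto simp: norm_divide G_def d_def x_def frac_le)
      then have "norm e3 * N\<^sup>2 \<le> 1 / N * (2 * \<bar>d\<bar> * K\<^sup>2) * N\<^sup>2" by (rule mult_right_mono) simp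
      also have "\<dots> = 2 * K\<^sup>2 * (\<bar>d\<bar> * N\<^sup>2) / N" by simp
      also have "\<dots> \<le> 2 * K\<^sup>2 * c / N" using dN N by (intro divide_right_mono mult_left_mono) auto
      also have "\<dots> \<le> \<delta>"
      proof -
        have "0 \<le> 4 * c\<^sup>2 * K" using K_nonneg by simp
        then have "2 * K\<^sup>2 * c \<le> \<delta> * N" using big by (simp add: mult_ac)
        then show ?thesis using N by (simp add: field_simps)
      qed
      finally show "norm e3 * N\<^sup>2 \<le> \<delta>" .
    next
      have "\<bar>1 / k - 1 / x\<bar> = \<bar>d\<bar> / (k * x)"
      proof -
        have "1 / k - 1 / x = - d / (k * x)" using k x by (simp add: d_def x_def field_simps)
        then show ?thesis using k x by simp
      qed
      also have "\<dots> \<le> \<bar>d\<bar> / N"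
      proof -
        have "N * 1 \<le> k * x" using k x N by (intro mult_mono) auto
        then show ?thesis using N by (intro divide_left_mono) auto
      qed
      finally have "\<bar>1 / k - 1 / x\<bar> * norm (G x) \<le> \<bar>d\<bar> / N * K\<^sup>2"
        unfolding G_def using norm_osc_integral_qQ_le[of x] N by (intro mult_mono) auto
      then have "norm e4 \<le> \<bar>d\<bar> / N * K\<^sup>2"
        by (simp only: e norm_mult norm_of_real norm_ii mult_1)
      then have "norm e4 * N\<^sup>2 \<le> \<bar>d\<bar> / N * K\<^sup>2 * N\<^sup>2" by (rule mult_right_mono) simp
      also have "\<dots> = K\<^sup>2 * (\<bar>d\<bar> * N\<^sup>2) / N" by simp
      also have "\<dots> \<le> K\<^sup>2 * c / N" using dN N by (intro divide_right_mono mult_left_mono) auto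
      also have "\<dots> \<le> \<delta>"
      proof -
        have "0 \<le> 4 * c\<^sup>2 * K" "0 \<le> c * K\<^sup>2" using K_nonneg c by auto
        then have "K\<^sup>2 * c \<le> \<delta> * N" using big by (simp add: mult_ac)
        then show ?thesis using N by (simp add: field_simps)
      qed
      finally show "norm e4 * N\<^sup>2 \<le> \<delta>" .
    qed
    also have "\<dots> = (14 + 2 * c) * \<delta>" by (simp add: algebra_simps)
    also have "\<dots> \<le> \<epsilon>" by (rule \<delta>(3))
    finally show ?case by (simp add: D_def G_def x_def N_def)
  qed
qed

section \<open>Bootstrapping\<close>

lemma osc_integral_eq_fcoef:
  "osc_integral q (real n * pi) = - (2 * of_real pi * of_nat n * \<i>) * fcoef (\<lambda>t. of_real (Q t)) (- int n)"
  unfolding osc_integral_def osc_pi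
  using integration_by_parts_mode[OF abs_cont_Q, of "int n"] by simp

lemma osc_integral_qQ_eq_fcoef:
  "osc_integral (\<lambda>t. q t * Q t) (real n * pi) = - (of_real pi * of_nat n * \<i>) * fcoef (\<lambda>t. of_real (Q t) * of_real (Q t)) (- int n)"
proof -
  have "abs_cont_deriv (\<lambda>t. (1/2) * (complex_of_real (Q t) * of_real (Q t))) (\<lambda>t. (1/2) * (of_real (q t) * of_real (Q t) + of_real (Q t) * of_real (q t)))"
    by (intro abs_cont_deriv_cmult abs_cont_deriv_mult abs_cont_Q)
  then have "abs_cont_deriv (\<lambda>t. (1/2) * (complex_of_real (Q t) * of_real (Q t))) (\<lambda>t. of_real (q t * Q t))"
    by (rule abs_cont_deriv_cong) (auto simp: mult.commute)
  from integration_by_parts_mode[OF this, of "int n"]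
  show ?thesis unfolding osc_integral_def osc_pi by (simp add: fcoef_def)
qed

lemma fcoef_Q_uminus: "norm (fcoef (\<lambda>t. of_real (Q t)) (- m)) = norm (fcoef (\<lambda>t. of_real (Q t)) m)"
proof -
  have "cnj (fcoef (\<lambda>t. of_real (Q t)) m) = fcoef (\<lambda>t. of_real (Q t)) (- m)"
    unfolding fcoef_def integral_cnj by (simp add: cnj_mode)
  then show ?thesis by (metis complex_mod_cnj)
qed

text \<open>With \<open>D\<close>, \<open>F\<close>, \<open>G\<close> for the coefficients of \<open>q\<close>, \<open>Q\<^sup>2\<close> and \<open>q Q\<close>: by \<open>coefficient_relation\<close>, \<open>D n - F n\<close>
  is \<open>o(n\<^sup>-\<^sup>2)\<close>.  First \<open>G n \<longrightarrow> 0\<close> gives \<open>F n = o(1 / n)\<close>, thus \<open>D n = o(1 / n)\<close>, and so the coefficients of \<open>Q\<close> are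
  \<open>o(n\<^sup>-\<^sup>2)\<close>; this improves \<open>F n\<close>, and then \<open>D n\<close>, to \<open>o(n\<^sup>-\<^sup>2)\<close>.\<close>

lemma small_B_imp_small_coefficients:
  assumes H: "\<And>\<epsilon>. 0 < \<epsilon> \<Longrightarrow> \<forall>\<^sub>F n in sequentially. small_B_near \<epsilon> n"
    and \<epsilon>: "0 < \<epsilon>"
  shows "\<forall>\<^sub>F n in sequentially. norm (osc_integral q (real n * pi)) * (real n)\<^sup>2 \<le> \<epsilon>"
proof -
  define D where "D = (\<lambda>n. osc_integral q (real n * pi))"
  define F where "F = (\<lambda>n. fcoef (\<lambda>t. complex_of_real (Q t) * of_real (Q t)) (- int n))"
  define G where "G = (\<lambda>n. osc_integral (\<lambda>t. q t * Q t) (real n * pi))"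
  have GF: "\<i> / of_real (real n * pi) * G n = F n" if "1 \<le> n" for n
    using that unfolding G_def F_def osc_integral_qQ_eq_fcoef by (simp add: field_simps)
  have nG: "norm (G n) = pi * real n * norm (F n)" for n
    unfolding G_def F_def osc_integral_qQ_eq_fcoef by (simp add: norm_mult)
  have nD: "norm (D n) = 2 * pi * real n * norm (fcoef (\<lambda>t. of_real (Q t)) (- int n))" for n
    unfolding D_def osc_integral_eq_fcoef by (simp add: norm_mult)
  have ge1: "\<forall>\<^sub>F n in sequentially. (1 :: nat) \<le> n" by (rule eventually_ge_at_top)
  have rel: "\<forall>\<^sub>F n in sequentially. norm (D n - F n) * (real n)\<^sup>2 \<le> e" if "0 < e" for e
  proof -
    have "\<forall>\<^sub>F n in sequentially. norm (D n - \<i> / of_real (real n * pi) * G n) * (real n)\<^sup>2 \<le> e"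
      unfolding D_def G_def by (rule coefficient_relation[OF H that])
    with ge1 show ?thesis
    proof eventually_elim
      case (elim n)
      then show ?case using GF[of n] by simp
    qed
  qed
  have npi: "filterlim (\<lambda>n. real n * pi) at_top sequentially"
    by (intro filterlim_at_top_mult_tendsto_pos[OF tendsto_const] filterlim_real_sequentially) simp
  have qQ: "(\<lambda>t. q t * Q t) absolutely_integrable_on {0..1}"
    by (intro absolutely_integrable_mult_continuous q_ai continuous_intros continuous_on_Q)
  have Gsmall: "\<forall>\<^sub>F n in sequentially. norm (G n) \<le> e" if "0 < e" for e
    unfolding G_def using eventually_compose_filterlim[OF osc_integral_small[OF qQ that] npi] .
  \<comment> \<open>first improvement, from the Riemann-Lebesgue lemma for \<open>q Q\<close>\<close>
  have D1: "\<forall>\<^sub>F n in sequentially. norm (D n) * real n \<le> e" if e: "0 < e" for e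
    using rel[OF half_gt_zero[OF e]] Gsmall[OF half_gt_zero[OF e]] ge1
  proof eventually_elim
    case (elim n)
    have n: "real n \<le> (real n)\<^sup>2" using elim by (intro self_le_power) auto
    have "norm (D n) * real n \<le> (norm (D n - F n) + norm (F n)) * real n"
      by (intro mult_right_mono) (use norm_triangle_ineq[of "D n - F n" "F n"] in auto)
    also have "\<dots> = norm (D n - F n) * real n + norm (F n) * real n" by (rule distrib_right)
    also have "norm (D n - F n) * real n \<le> norm (D n - F n) * (real n)\<^sup>2" using n by (intro mult_left_mono) auto
    also have "norm (F n) * real n \<le> norm (G n)"
    proof -
      have "1 * (real n * norm (F n)) \<le> pi * (real n * norm (F n))" using pi_gt3 by (intro mult_right_mono) auto
      then show ?thesis unfolding nG by (simp add: mult_ac)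
    qed
    finally show ?case using elim by simp
  qed
  have decay: "\<exists>M. \<forall>m. M \<le> \<bar>m\<bar> \<longrightarrow> norm (fcoef (\<lambda>t. of_real (Q t)) m) * (real_of_int m)\<^sup>2 \<le> e" if e: "0 < e" for e
  proof -
    obtain N where N: "\<And>n. N \<le> n \<Longrightarrow> norm (D n) * real n \<le> e"
      using D1[OF e] unfolding eventually_sequentially by blast
    have "norm (fcoef (\<lambda>t. of_real (Q t)) m) * (real_of_int m)\<^sup>2 \<le> e" if m: "int N \<le> \<bar>m\<bar>" for m
    proof -
      define n where "n = nat \<bar>m\<bar>"
      have n: "N \<le> n" "\<bar>m\<bar> = int n" using m by (auto simp: n_def)
      have "norm (fcoef (\<lambda>t. of_real (Q t)) m) = norm (fcoef (\<lambda>t. of_real (Q t)) (- int n))"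
        using n(2) fcoef_Q_uminus[of m] fcoef_Q_uminus[of "int n"] by (cases "0 \<le> m") auto
      moreover have "(real_of_int m)\<^sup>2 = (real n)\<^sup>2" using n(2) by (metis of_int_of_nat_eq of_int_abs power2_abs)
      moreover have "1 * (norm (fcoef (\<lambda>t. of_real (Q t)) (- int n)) * (real n)\<^sup>2)
          \<le> (2 * pi) * (norm (fcoef (\<lambda>t. of_real (Q t)) (- int n)) * (real n)\<^sup>2)"
        using pi_gt3 by (intro mult_right_mono) auto
      moreover have "(2 * pi) * (norm (fcoef (\<lambda>t. of_real (Q t)) (- int n)) * (real n)\<^sup>2) = norm (D n) * real n"
        unfolding nD by (simp add: power2_eq_square)
      ultimately have "norm (fcoef (\<lambda>t. of_real (Q t)) m) * (real_of_int m)\<^sup>2 \<le> norm (D n) * real n"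
        by (metis mult_1)
      then show ?thesis using N[OF n(1)] by (rule order_trans)
    qed
    then show ?thesis by blast
  qed
  obtain M where M: "\<And>m. M \<le> \<bar>m\<bar> \<Longrightarrow> norm (fcoef (\<lambda>t. complex_of_real (Q t) * of_real (Q t)) m) * (real_of_int m)\<^sup>2 \<le> \<epsilon> / 2"
    using fcoef_square_decay[OF continuous_on_Qc _ decay, of "\<epsilon> / 2"] \<epsilon> by auto
  \<comment> \<open>second improvement, from the square of the Fourier series of \<open>Q\<close>\<close>
  have F2: "\<forall>\<^sub>F n in sequentially. norm (F n) * (real n)\<^sup>2 \<le> \<epsilon> / 2"
    using eventually_ge_at_top[of "nat M"]
  proof eventually_elim
    case (elim n)
    then show ?case using M[of "- int n"] by (simp add: F_def)
  qed
  have "\<forall>\<^sub>F n in sequentially. norm (D n - F n) * (real n)\<^sup>2 \<le> \<epsilon> / 2" using \<epsilon> by (intro rel) simp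
  with F2 show ?thesis
  proof eventually_elim
    case (elim n)
    have "norm (D n) * (real n)\<^sup>2 \<le> (norm (D n - F n) + norm (F n)) * (real n)\<^sup>2"
      by (intro mult_right_mono) (use norm_triangle_ineq[of "D n - F n" "F n"] in auto)
    then show ?case using elim by (simp add: D_def distrib_right)
  qed
qed

end

section \<open>Reduction to mean zero\<close>

lemma eigenspace_shift: "eigenspace s (\<lambda>x. q x - c) t = eigenspace s q (t + c)"
proof -
  have "- z + of_real (q x - c) * y = of_real t * y \<longleftrightarrow> - z + of_real (q x) * y = of_real (t + c) * y" for z y :: complex and x
    by (auto simp: algebra_simps)
  then show ?thesis unfolding eigenspace_def by simp
qed

lemma eigenvalue_enumeration_shift:
  assumes "eigenvalue_enumeration s q e"
  shows "eigenvalue_enumeration s (\<lambda>x. q x - c) (\<lambda>n. e n - c)"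
proof -
  have "{n. e n - c = t} = {n. e n = t + c}" for t by auto
  then show ?thesis
    using assms unfolding eigenvalue_enumeration_def eigenspace_shift by (auto simp: mono_def)
qed

lemma fourier_coeff_eq_osc_integral:
  assumes q: "q absolutely_integrable_on {0..1}" and n: "1 \<le> n"
  shows "norm (fourier_coeff q n) = norm (osc_integral (\<lambda>x. q x - c) (real n * pi))"
proof -
  have qc: "(\<lambda>t. complex_of_real (q t)) absolutely_integrable_on {0..1}"
  using q by (rule absolutely_integrable_of_real)
  have i: "(\<lambda>t. of_real (q t) * mode (int n) t) integrable_on {0..1}"
    using absolutely_integrable_mult_continuous[OF qc continuous_on_mode] by (auto simp: absolutely_integrable_on_def)
  have j: "(\<lambda>t. of_real c * mode (int n) t) integrable_on {0..1}"
    by (intro integrable_continuous_interval continuous_intros)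
  have "osc_integral (\<lambda>x. q x - c) (real n * pi) = integral {0..1} (\<lambda>t. of_real (q t) * mode (int n) t - of_real c * mode (int n) t)"
    unfolding osc_integral_def osc_pi by (simp add: left_diff_distrib)
  also have "\<dots> = integral {0..1} (\<lambda>t. of_real (q t) * mode (int n) t) - integral {0..1} (\<lambda>t. of_real c * mode (int n) t)"
    by (rule hk_integral_diff[OF i j])
  also have "integral {0..1} (\<lambda>t. of_real c * mode (int n) t) = 0"
    using n by (simp add: integral_mode)
  finally have "osc_integral (\<lambda>x. q x - c) (real n * pi) = integral {0..1} (\<lambda>t. of_real (q t) * mode (int n) t)" by simp
  moreover have "cnj (integral {0..1} (\<lambda>t. of_real (q t) * mode (int n) t)) = fourier_coeff q n"
    unfolding fourier_coeff_def integral_cnj by (simp add: mode_def exp_cnj mult_ac)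
  ultimately show ?thesis by (metis complex_mod_cnj)
qed

theorem theorem1p1:
  fixes q :: "real \<Rightarrow> real" and lam mu :: "nat \<Rightarrow> real"
  assumes "\<And>x. q (x + 1) = q x"
    and "q absolutely_integrable_on {0..1}"
    and "periodic_eigenvalues q lam"
    and "antiperiodic_eigenvalues q mu"
    and "(\<lambda>n. instability_length lam mu n) \<in> o(\<lambda>n. 1 / real n ^ 2)"
  shows "(\<lambda>n. fourier_coeff q n) \<in> o(\<lambda>n. 1 / of_nat n ^ 2)"
proof -
  define c where "c = integral {0..1} q"
  define p where "p = (\<lambda>x. q x - c)"
  have const: "(\<lambda>x::real. c) absolutely_integrable_on {0..1}"
    by (intro absolutely_integrable_continuous_real continuous_intros)
  interpret mean_zero_potential p
  proof
    show "p absolutely_integrable_on {0..1}"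
      unfolding p_def using assms(2) const by (rule set_integral_diff(1))
    have "integral {0..1} p = integral {0..1} q - integral {0..1} (\<lambda>x::real. c)"
      unfolding p_def using assms(2) const
      by (intro hk_integral_diff) (auto simp: absolutely_integrable_on_def)
    then show "integral {0..1} p = 0" by (simp add: c_def)
  qed
  have gaps: "\<exists>N. \<forall>n\<ge>N. \<bar>instability_length lam mu n\<bar> \<le> \<epsilon> / (real n)\<^sup>2" if "0 < \<epsilon>" for \<epsilon>
    using landau_o.smallD[OF assms(5) that] unfolding eventually_sequentially by simp
  have ev: "eigenvalue_enumeration ((-1) ^ 0) p (\<lambda>n. lam n - c)"
    unfolding p_def using eigenvalue_enumeration_shift[OF assms(3)] by simp
  have od: "eigenvalue_enumeration ((-1) ^ 1) p (\<lambda>n. mu n - c)"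
    unfolding p_def using eigenvalue_enumeration_shift[OF assms(4)] by simp
  have sequence: "\<exists>N. \<forall>n\<ge>N. even (n + r) \<longrightarrow> small_B_near \<epsilon> n"
    if en: "eigenvalue_enumeration ((-1) ^ r) p (\<lambda>n. e n - c)" and \<epsilon>: "0 < \<epsilon>"
      and L: "\<And>n. even (n + r) \<Longrightarrow> instability_length lam mu n = e n - e (n - 1)" for e r \<epsilon>
  proof (rule small_gaps_imp_small_B[OF en _ \<epsilon>])
    fix \<delta> :: real assume \<delta>: "0 < \<delta>"
    obtain N where N: "\<And>n. N \<le> n \<Longrightarrow> \<bar>instability_length lam mu n\<bar> \<le> \<delta> / (real n)\<^sup>2" using gaps[OF \<delta>] by blast
    have "(e n - c) - (e (n - 1) - c) \<le> \<delta> / (real n)\<^sup>2" if "N \<le> n" "even (n + r)" for n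
      using N[OF that(1)] L[OF that(2)] by linarith
    then show "\<exists>N. \<forall>n\<ge>N. even (n + r) \<longrightarrow> (e n - c) - (e (n - 1) - c) \<le> \<delta> / (real n)\<^sup>2" by blast
  qed
  have small_B: "\<forall>\<^sub>F n in sequentially. small_B_near \<epsilon> n" if \<epsilon>: "0 < \<epsilon>" for \<epsilon>
  proof -
    obtain N where N: "\<And>n. N \<le> n \<Longrightarrow> even (n + 0) \<Longrightarrow> small_B_near \<epsilon> n"
      using sequence[OF ev \<epsilon>] by (auto simp: instability_length_def)
    obtain M where M: "\<And>n. M \<le> n \<Longrightarrow> even (n + 1) \<Longrightarrow> small_B_near \<epsilon> n"
      using sequence[OF od \<epsilon>] by (auto simp: instability_length_def)
    show ?thesis
      unfolding eventually_sequentially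
    proof (intro exI[of _ "N + M"] allI impI)
      fix n assume "N + M \<le> n"
      then show "small_B_near \<epsilon> n"
        using N[of n] M[of n] by (cases "even n") auto
    qed
  qed
  show ?thesis
  proof (rule landau_o.smallI)
    fix \<epsilon> :: real assume \<epsilon>: "0 < \<epsilon>"
    have "\<forall>\<^sub>F n in sequentially. (1 :: nat) \<le> n" by (rule eventually_ge_at_top)
    moreover have "\<forall>\<^sub>F n in sequentially. norm (osc_integral p (real n * pi)) * (real n)\<^sup>2 \<le> \<epsilon>"
      by (rule small_B_imp_small_coefficients[OF small_B \<epsilon>])
    ultimately show "\<forall>\<^sub>F n in sequentially. norm (fourier_coeff q n) \<le> \<epsilon> * norm (1 / of_nat n ^ 2 :: complex)"
    proof eventually_elim
      case (elim n)
      then show ?case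
        using fourier_coeff_eq_osc_integral[OF assms(2), of n c, folded p_def]
        by (simp add: norm_divide norm_power field_simps)
    qed
  qed
qed

end
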